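(* Let $k$ be a field of characteristic zero and let $(R,\Delta)$ be a commutative noetherian differential $k$-algebra with $\dim_k R<|k|$ and $|\Delta|<|k|$. Suppose that $\Delta\text{-}{\rm spec}\,R=\bigcup_i X_i$ is a union of locally closed subsets such that each $X_i$, endowed with the subspace topology, is homeomorphic to $\Delta_i\text{-}{\rm spec}\,R_i$ for some noetherian commutative differential $k$-algebra $(R_i,\Delta_i)$ with $\dim_k R_i<|k|$ and $|\Delta_i|<|k|$. Then $R$ satisfies the $\Delta$-Dixmier-Moeglin equivalence if and only if each $R_i$ satisfies the $\Delta_i$-Dixmier-Moeglin equivalence.
   Context: A commutative differential $k$-algebra is a pair $(R,\Delta)$ with $R$ a commutative $k$-algebra and $\Delta\subseteq{\rm Der}_k R$ a subset of $k$-linear derivations. A $\Delta$-ideal is an ideal $I$ with $\delta(I)\subseteq I$ for all $\delta\in\Delta$. A $\Delta$-prime ideal is a proper $\Delta$-ideal that is prime among $\Delta$-ideals; for noetherian $R$ these are exactly the prime ideals that are $\Delta$-ideals. $\Delta\text{-}{\rm spec}\,R$ is the set of $\Delta$-prime ideals with the subspace topology from ${\rm spec}\,R$. The $\Delta$-core $(J:\Delta)$ of an ideal $J$ is the largest $\Delta$-ideal contained in $J$. A $\Delta$-primitive ideal is the $\Delta$-core of a maximal ideal. For a $\Delta$-prime ideal $P$, derivations in $\Delta$ induce derivations on $R/P$ and extend uniquely to ${\rm Frac}(R/P)$; $Z_\Delta({\rm Frac}\,R/P)$ is the subfield of elements killed by all $\delta\in\Delta$, and $P$ is $\Delta$-rational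 if this field is algebraic over $k$. A subset of a topological space is locally closed if it is the intersection of an open and a closed subset; a $\Delta$-prime $P$ is locally closed if $\{P\}$ is. $R$ satisfies the $\Delta$-Dixmier-Moeglin equivalence if for every $P\in\Delta\text{-}{\rm spec}\,R$: $P$ is locally closed in $\Delta\text{-}{\rm spec}\,R$ $\iff$ $P$ is $\Delta$-primitive $\iff$ $P$ is $\Delta$-rational. *)

theory Defs
  imports
    "HOL-Algebra.Finite_Extensions"
    "HOL-Algebra.Ideal_Product"
    "HOL-Algebra.QuotRing"
    "HOL-Analysis.Abstract_Topology"
    "HOL-Library.Equipollence"
    "Jordan_Normal_Form.Missing_VectorSpace"
begin

section \<open>Derivations and differential algebras\<close>

text \<open>
  Derivations are taken to be extensional on the carrier, so that two of them are equal as
  functions on the ambient type exactly if they agree on the ring.  The cardinality of a set of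
  derivations is therefore the intended one.
\<close>

definition derivations :: "('a, 'b) ring_scheme \<Rightarrow> ('a \<Rightarrow> 'a) set" where
  "derivations A = {d \<in> carrier A \<rightarrow>\<^sub>E carrier A.
     (\<forall>x\<in>carrier A. \<forall>y\<in>carrier A. d (x \<oplus>\<^bsub>A\<^esub> y) = d x \<oplus>\<^bsub>A\<^esub> d y) \<and>
     (\<forall>x\<in>carrier A. \<forall>y\<in>carrier A. d (x \<otimes>\<^bsub>A\<^esub> y) = (x \<otimes>\<^bsub>A\<^esub> d y) \<oplus>\<^bsub>A\<^esub> (d x \<otimes>\<^bsub>A\<^esub> y))}"

definition Der :: "('k, 'm) ring_scheme \<Rightarrow> ('k, 'a, 'n) module_scheme \<Rightarrow> ('a \<Rightarrow> 'a) set" where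
  "Der K R = {d \<in> derivations R.
     \<forall>c\<in>carrier K. \<forall>x\<in>carrier R. d (c \<odot>\<^bsub>R\<^esub> x) = c \<odot>\<^bsub>R\<^esub> d x}"

locale differential_algebra = K?: field K + algebra K R for K and R +
  fixes \<Delta>
  assumes derivations: "\<Delta> \<subseteq> Der K R"

definition char_zero_field :: "('k, 'm) ring_scheme \<Rightarrow> bool" where
  "char_zero_field K \<longleftrightarrow> field K \<and> (\<forall>n::nat. n > 0 \<longrightarrow> [n] \<cdot>\<^bsub>K\<^esub> \<one>\<^bsub>K\<^esub> \<noteq> \<zero>\<^bsub>K\<^esub>)"

text \<open>\<open>vectorspace.dim\<close> is a natural number and meaningless in infinite dimension, hence the
  cardinality of a basis.\<close>

definition dim_less_card_field :: "('k, 'm) ring_scheme \<Rightarrow> ('k, 'a, 'n) module_scheme \<Rightarrow> bool" where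
  "dim_less_card_field K R \<longleftrightarrow> (\<exists>B. vectorspace.basis K R B \<and> B \<prec> carrier K)"


section \<open>Differential ideals\<close>

definition delta_ideal :: "('a, 'b) ring_scheme \<Rightarrow> ('a \<Rightarrow> 'a) set \<Rightarrow> 'a set \<Rightarrow> bool" where
  "delta_ideal R \<Delta> I \<longleftrightarrow> ideal I R \<and> (\<forall>\<delta>\<in>\<Delta>. \<delta> ` I \<subseteq> I)"

definition delta_prime :: "('a, 'b) ring_scheme \<Rightarrow> ('a \<Rightarrow> 'a) set \<Rightarrow> 'a set \<Rightarrow> bool" where
  "delta_prime R \<Delta> P \<longleftrightarrow> delta_ideal R \<Delta> P \<and> P \<noteq> carrier R \<and>
     (\<forall>I J. delta_ideal R \<Delta> I \<longrightarrow> delta_ideal R \<Delta> J \<longrightarrow> I \<cdot>\<^bsub>R\<^esub> J \<subseteq> P \<longrightarrow> I \<subseteq> P \<or> J \<subseteq> P)"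

text \<open>\<open>GREATEST\<close> is with respect to inclusion; it exists by \<open>delta_core_greatest\<close>.\<close>

definition delta_core :: "('a, 'b) ring_scheme \<Rightarrow> ('a \<Rightarrow> 'a) set \<Rightarrow> 'a set \<Rightarrow> 'a set" where
  "delta_core R \<Delta> J = (GREATEST I. delta_ideal R \<Delta> I \<and> I \<subseteq> J)"

definition delta_primitive :: "('a, 'b) ring_scheme \<Rightarrow> ('a \<Rightarrow> 'a) set \<Rightarrow> 'a set \<Rightarrow> bool" where
  "delta_primitive R \<Delta> P \<longleftrightarrow> (\<exists>M. maximalideal M R \<and> P = delta_core R \<Delta> M)"

lemma delta_core_greatest:
  assumes "differential_algebra K R \<Delta>" and J: "ideal J R"
  shows "delta_ideal R \<Delta> (delta_core R \<Delta> J)" "delta_core R \<Delta> J \<subseteq> J"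
    and "\<And>I. \<lbrakk>delta_ideal R \<Delta> I; I \<subseteq> J\<rbrakk> \<Longrightarrow> I \<subseteq> delta_core R \<Delta> J"
proof -
  interpret J: ideal J R by (fact J)
  have derivations: "\<Delta> \<subseteq> Der K R" by (rule differential_algebra.derivations) fact
  let ?S = "\<Union>{I. delta_ideal R \<Delta> I \<and> I \<subseteq> J}"
  define G where "G = genideal R ?S"
  have SJ: "?S \<subseteq> J" by auto
  have Sc: "?S \<subseteq> carrier R" using SJ J.a_subset by blast
  have G: "ideal G R" unfolding G_def by (rule J.genideal_ideal[OF Sc])
  interpret G: ideal G R by (fact G)
  have SG: "?S \<subseteq> G" unfolding G_def by (rule J.genideal_self[OF Sc])
  have GJ: "G \<subseteq> J" unfolding G_def by (rule J.genideal_minimal[OF J SJ])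
  have Gd: "\<delta> ` G \<subseteq> G" if d: "\<delta> \<in> \<Delta>" for \<delta>
  proof -
    have D: "\<delta> \<in> derivations R" using d derivations by (auto simp: Der_def)
    have Dc: "\<And>x. x \<in> carrier R \<Longrightarrow> \<delta> x \<in> carrier R"
      and Da: "\<And>x y. x \<in> carrier R \<Longrightarrow> y \<in> carrier R \<Longrightarrow> \<delta> (x \<oplus>\<^bsub>R\<^esub> y) = \<delta> x \<oplus>\<^bsub>R\<^esub> \<delta> y"
      and Dm: "\<And>x y. x \<in> carrier R \<Longrightarrow> y \<in> carrier R \<Longrightarrow>
                \<delta> (x \<otimes>\<^bsub>R\<^esub> y) = (x \<otimes>\<^bsub>R\<^esub> \<delta> y) \<oplus>\<^bsub>R\<^esub> (\<delta> x \<otimes>\<^bsub>R\<^esub> y)"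
      using D by (auto simp: derivations_def)
    let ?H = "{x \<in> G. \<delta> x \<in> G}"
    have D0: "\<delta> \<zero>\<^bsub>R\<^esub> = \<zero>\<^bsub>R\<^esub>"
      using Da[of "\<zero>\<^bsub>R\<^esub>" "\<zero>\<^bsub>R\<^esub>"] Dc[of "\<zero>\<^bsub>R\<^esub>"] by (simp add: J.add.l_cancel_one')
    have Dn: "\<delta> (\<ominus>\<^bsub>R\<^esub> x) = \<ominus>\<^bsub>R\<^esub> \<delta> x" if x: "x \<in> carrier R" for x
      using Da[OF x, of "\<ominus>\<^bsub>R\<^esub> x"] x D0 Dc
      by (metis J.a_inv_closed J.minus_equality J.r_neg J.a_comm)
    have "ideal ?H R"
    proof (rule idealI)
      show "ring R" by (fact J.ring_axioms)
      show "subgroup ?H (add_monoid R)"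
      proof (rule subgroup.intro)
        show "?H \<subseteq> carrier (add_monoid R)" using G.a_subset by auto
        show "\<one>\<^bsub>add_monoid R\<^esub> \<in> ?H" using D0 additive_subgroup.zero_closed[OF G.additive_subgroup_axioms] by simp
        show "x \<otimes>\<^bsub>add_monoid R\<^esub> y \<in> ?H" if "x \<in> ?H" "y \<in> ?H" for x y
          using that Da G.a_closed G.Icarr by auto
        show "inv\<^bsub>add_monoid R\<^esub> x \<in> ?H" if "x \<in> ?H" for x
          using that Dn G.a_inv_closed G.Icarr by (auto simp: a_inv_def[symmetric])
      qed
      fix a x assume a: "a \<in> ?H" and x: "x \<in> carrier R"
      have ac: "a \<in> carrier R" using a G.Icarr by auto
      show "x \<otimes>\<^bsub>R\<^esub> a \<in> ?H"
        using a x ac Dm Dc G.I_l_closed G.I_r_closed G.a_closed by auto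
      show "a \<otimes>\<^bsub>R\<^esub> x \<in> ?H"
        using a x ac Dm Dc G.I_l_closed G.I_r_closed G.a_closed by auto
    qed
    moreover have "?S \<subseteq> ?H"
    proof
      fix x assume "x \<in> ?S"
      then obtain I where I: "delta_ideal R \<Delta> I" "I \<subseteq> J" "x \<in> I" by blast
      then have "\<delta> x \<in> I" using d unfolding delta_ideal_def by blast
      then show "x \<in> ?H" using I SG by blast
    qed
    ultimately have "G \<subseteq> ?H" unfolding G_def using J.genideal_minimal by blast
    then show ?thesis by auto
  qed
  have Gd: "delta_ideal R \<Delta> G" using G Gd by (simp add: delta_ideal_def)
  have ub: "I \<subseteq> G" if "delta_ideal R \<Delta> I \<and> I \<subseteq> J" for I using that SG by blast
  have "delta_core R \<Delta> J = G"
    unfolding delta_core_def using Gd GJ ub by (intro Greatest_equality) auto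
  then show "delta_ideal R \<Delta> (delta_core R \<Delta> J)" "delta_core R \<Delta> J \<subseteq> J"
    "\<And>I. \<lbrakk>delta_ideal R \<Delta> I; I \<subseteq> J\<rbrakk> \<Longrightarrow> I \<subseteq> delta_core R \<Delta> J"
    using Gd GJ ub by auto
qed


section \<open>The differential spectrum\<close>

definition zariski_topology :: "('a, 'b) ring_scheme \<Rightarrow> 'a set topology" where
  "zariski_topology R = topology (\<lambda>U. \<exists>S\<subseteq>carrier R. U = {P. primeideal P R \<and> \<not> S \<subseteq> P})"

lemma istopology_zariski:
  "istopology (\<lambda>U. \<exists>S\<subseteq>carrier R. U = {P. primeideal P R \<and> \<not> S \<subseteq> P})"
  unfolding istopology_def
proof (intro conjI allI impI)
  fix U V
  assume "\<exists>S\<subseteq>carrier R. U = {P. primeideal P R \<and> \<not> S \<subseteq> P}"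
    and "\<exists>S\<subseteq>carrier R. V = {P. primeideal P R \<and> \<not> S \<subseteq> P}"
  then obtain S T where S: "S \<subseteq> carrier R" "U = {P. primeideal P R \<and> \<not> S \<subseteq> P}"
    and T: "T \<subseteq> carrier R" "V = {P. primeideal P R \<and> \<not> T \<subseteq> P}" by blast
  let ?W = "{s \<otimes>\<^bsub>R\<^esub> t | s t. s \<in> S \<and> t \<in> T}"
  have eq: "(\<not> S \<subseteq> P \<and> \<not> T \<subseteq> P) \<longleftrightarrow> \<not> ?W \<subseteq> P" if P: "primeideal P R" for P
  proof -
    interpret P: primeideal P R by (fact P)
    have "?W \<subseteq> P" if "S \<subseteq> P \<or> T \<subseteq> P"
      using that S(1) T(1) P.I_l_closed P.I_r_closed by blast
    moreover have "\<not> ?W \<subseteq> P" if "s \<in> S" "t \<in> T" "s \<notin> P" "t \<notin> P" for s t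
    proof -
      have "s \<otimes>\<^bsub>R\<^esub> t \<notin> P" using that S(1) T(1) P.I_prime[of s t] by blast
      then show ?thesis using that by blast
    qed
    ultimately show ?thesis by blast
  qed
  have W: "?W \<subseteq> carrier R" if "primeideal P R" for P
  proof -
    interpret P: primeideal P R by (fact that)
    show ?thesis using S(1) T(1) by auto
  qed
  show "\<exists>S\<subseteq>carrier R. U \<inter> V = {P. primeideal P R \<and> \<not> S \<subseteq> P}"
  proof (cases "\<exists>P. primeideal P R")
    case True
    then show ?thesis using W eq S(2) T(2) by (intro exI[of _ ?W]) blast
  next
    case False
    then show ?thesis using S T by blast
  qed
next
  fix \<U> assume *: "\<forall>U\<in>\<U>. \<exists>S\<subseteq>carrier R. U = {P. primeideal P R \<and> \<not> S \<subseteq> P}"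
  then obtain f where f: "\<And>U. U \<in> \<U> \<Longrightarrow> f U \<subseteq> carrier R \<and> U = {P. primeideal P R \<and> \<not> f U \<subseteq> P}"
    by metis
  have "P \<in> \<Union>\<U> \<longleftrightarrow> primeideal P R \<and> \<not> \<Union>(f ` \<U>) \<subseteq> P" for P
  proof -
    have "P \<in> \<Union>\<U> \<longleftrightarrow> (\<exists>U\<in>\<U>. primeideal P R \<and> \<not> f U \<subseteq> P)"
    proof -
      have "P \<in> U \<longleftrightarrow> primeideal P R \<and> \<not> f U \<subseteq> P" if "U \<in> \<U>" for U
        using f[OF that] by (metis (mono_tags, lifting) mem_Collect_eq)
      then show ?thesis by (simp only: Union_iff cong: bex_cong)
    qed
    then show ?thesis by (simp add: UN_subset_iff)
  qed
  then have "\<Union>\<U> = {P. primeideal P R \<and> \<not> \<Union>(f ` \<U>) \<subseteq> P}" by blast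
  moreover have "\<Union>(f ` \<U>) \<subseteq> carrier R" using f by blast
  ultimately show "\<exists>S\<subseteq>carrier R. \<Union>\<U> = {P. primeideal P R \<and> \<not> S \<subseteq> P}" by blast
qed

lemma openin_zariski:
  "openin (zariski_topology R) U \<longleftrightarrow> (\<exists>S\<subseteq>carrier R. U = {P. primeideal P R \<and> \<not> S \<subseteq> P})"
  by (simp add: zariski_topology_def topology_inverse'[OF istopology_zariski])

lemma topspace_zariski: "topspace (zariski_topology R) = {P. primeideal P R}"
proof
  show "topspace (zariski_topology R) \<subseteq> {P. primeideal P R}"
    using openin_topspace[of "zariski_topology R"] unfolding openin_zariski by blast
  have "\<not> carrier R \<subseteq> P" if "primeideal P R" for P
    using primeideal.I_notcarr[OF that]
      ideal.Icarr[OF primeideal.axioms(1)[OF that]] by blast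
  then have "{P. primeideal P R} = {P. primeideal P R \<and> \<not> carrier R \<subseteq> P}" by blast
  then have "openin (zariski_topology R) {P. primeideal P R}" unfolding openin_zariski by blast
  then show "{P. primeideal P R} \<subseteq> topspace (zariski_topology R)" by (rule openin_subset)
qed

definition delta_spec :: "('a, 'b) ring_scheme \<Rightarrow> ('a \<Rightarrow> 'a) set \<Rightarrow> 'a set set" where
  "delta_spec R \<Delta> = {P. delta_prime R \<Delta> P}"

text \<open>For noetherian \<open>R\<close> over a field of characteristic zero every differential prime ideal is
  prime, so that the following topology has \<^term>\<open>delta_spec R \<Delta>\<close> as underlying set.\<close>

definition delta_spec_topology :: "('a, 'b) ring_scheme \<Rightarrow> ('a \<Rightarrow> 'a) set \<Rightarrow> 'a set topology" where
  "delta_spec_topology R \<Delta> = subtopology (zariski_topology R) (delta_spec R \<Delta>)"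

definition locally_closed_in :: "'a topology \<Rightarrow> 'a set \<Rightarrow> bool" where
  "locally_closed_in T S \<longleftrightarrow> (\<exists>U C. openin T U \<and> closedin T C \<and> S = U \<inter> C)"


section \<open>Fraction fields and rational ideals\<close>

definition frac_rel :: "('a, 'b) ring_scheme \<Rightarrow> (('a \<times> 'a) \<times> ('a \<times> 'a)) set" where
  "frac_rel A = {((a, b), (c, d)). a \<in> carrier A \<and> c \<in> carrier A \<and>
     b \<in> carrier A - {\<zero>\<^bsub>A\<^esub>} \<and> d \<in> carrier A - {\<zero>\<^bsub>A\<^esub>} \<and> a \<otimes>\<^bsub>A\<^esub> d = c \<otimes>\<^bsub>A\<^esub> b}"

definition fraction :: "('a, 'b) ring_scheme \<Rightarrow> 'a \<Rightarrow> 'a \<Rightarrow> ('a \<times> 'a) set" where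
  "fraction A a b = frac_rel A `` {(a, b)}"

text \<open>The unions defining sum and product range over all representatives; each of them is
  a union of copies of a single class, see \<open>Frac_add\<close> and \<open>Frac_mult\<close>.\<close>

definition Frac :: "('a, 'b) ring_scheme \<Rightarrow> ('a \<times> 'a) set ring" where
  "Frac A = \<lparr>carrier = (carrier A \<times> (carrier A - {\<zero>\<^bsub>A\<^esub>})) // frac_rel A,
     mult = (\<lambda>U V. \<Union>(a, b)\<in>U. \<Union>(c, d)\<in>V. fraction A (a \<otimes>\<^bsub>A\<^esub> c) (b \<otimes>\<^bsub>A\<^esub> d)),
     one = fraction A \<one>\<^bsub>A\<^esub> \<one>\<^bsub>A\<^esub>,
     zero = fraction A \<zero>\<^bsub>A\<^esub> \<one>\<^bsub>A\<^esub>,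
     add = (\<lambda>U V. \<Union>(a, b)\<in>U. \<Union>(c, d)\<in>V.
       fraction A ((a \<otimes>\<^bsub>A\<^esub> d) \<oplus>\<^bsub>A\<^esub> (c \<otimes>\<^bsub>A\<^esub> b)) (b \<otimes>\<^bsub>A\<^esub> d))\<rparr>"

text \<open>The fraction construction yields a field, and derivations extend uniquely to it.\<close>

lemma derivationsD:
  assumes "d \<in> derivations A"
  shows "x \<in> carrier A \<Longrightarrow> d x \<in> carrier A"
    and "x \<in> carrier A \<Longrightarrow> y \<in> carrier A \<Longrightarrow> d (x \<oplus>\<^bsub>A\<^esub> y) = d x \<oplus>\<^bsub>A\<^esub> d y"
    and "x \<in> carrier A \<Longrightarrow> y \<in> carrier A \<Longrightarrow>
           d (x \<otimes>\<^bsub>A\<^esub> y) = (x \<otimes>\<^bsub>A\<^esub> d y) \<oplus>\<^bsub>A\<^esub> (d x \<otimes>\<^bsub>A\<^esub> y)"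
    and "d \<in> extensional (carrier A)"
  using assms by (auto simp: derivations_def PiE_def)

lemma derivationsI:
  assumes "d \<in> carrier A \<rightarrow>\<^sub>E carrier A"
    and "\<And>x y. x \<in> carrier A \<Longrightarrow> y \<in> carrier A \<Longrightarrow> d (x \<oplus>\<^bsub>A\<^esub> y) = d x \<oplus>\<^bsub>A\<^esub> d y"
    and "\<And>x y. x \<in> carrier A \<Longrightarrow> y \<in> carrier A \<Longrightarrow>
           d (x \<otimes>\<^bsub>A\<^esub> y) = (x \<otimes>\<^bsub>A\<^esub> d y) \<oplus>\<^bsub>A\<^esub> (d x \<otimes>\<^bsub>A\<^esub> y)"
  shows "d \<in> derivations A"
  using assms by (simp add: derivations_def)

lemma UN_const2:
  assumes "U \<noteq> {}" "V \<noteq> {}" "\<And>p q. p \<in> U \<Longrightarrow> q \<in> V \<Longrightarrow> f p q = C"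
  shows "(\<Union>p\<in>U. \<Union>q\<in>V. f p q) = C"
proof -
  have "(\<Union>q\<in>V. f p q) = C" if "p \<in> U" for p
    using assms(2) assms(3)[OF that] by auto
  then show ?thesis using assms(1) by auto
qed

context cring
begin

lemma diff_cancel:
  assumes "s \<in> carrier R" "t \<in> carrier R" "u \<in> carrier R" "v \<in> carrier R" "w \<in> carrier R" "z \<in> carrier R"
  shows "((s \<oplus> u) \<oplus> (t \<oplus> v)) \<ominus> ((s \<oplus> w) \<oplus> (z \<oplus> t)) = (u \<ominus> w) \<oplus> (v \<ominus> z)"
  using assms by algebra

lemma quotient_rule_add:
  assumes "a \<in> carrier R" "b \<in> carrier R" "c \<in> carrier R" "d \<in> carrier R"
    "a' \<in> carrier R" "b' \<in> carrier R" "c' \<in> carrier R" "d' \<in> carrier R"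
  shows "(b \<otimes> d) \<otimes> (((a \<otimes> d') \<oplus> (a' \<otimes> d)) \<oplus> ((c \<otimes> b') \<oplus> (c' \<otimes> b))) \<ominus> ((a \<otimes> d \<oplus> c \<otimes> b) \<otimes> ((b \<otimes> d') \<oplus> (b' \<otimes> d)))
  = (b \<otimes> a' \<ominus> a \<otimes> b') \<otimes> (d \<otimes> d) \<oplus> (d \<otimes> c' \<ominus> c \<otimes> d') \<otimes> (b \<otimes> b)" (is "?l = ?r")
proof -
  let ?s = "b \<otimes> d \<otimes> (a \<otimes> d')" and ?u = "b \<otimes> d \<otimes> (a' \<otimes> d)" and ?t = "b \<otimes> d \<otimes> (c \<otimes> b')"
    and ?v = "b \<otimes> d \<otimes> (c' \<otimes> b)" and ?w = "a \<otimes> d \<otimes> (b' \<otimes> d)" and ?z = "c \<otimes> b \<otimes> (b \<otimes> d')"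
  have "?l = ((?s \<oplus> ?u) \<oplus> (?t \<oplus> ?v)) \<ominus> ((?s \<oplus> ?w) \<oplus> (?z \<oplus> ?t))"
    using assms by (simp add: r_distr l_distr m_ac a_ac)
  also have "\<dots> = (?u \<ominus> ?w) \<oplus> (?v \<ominus> ?z)"
    using assms by (intro diff_cancel) auto
  also have "\<dots> = ?r"
    using assms by (simp add: minus_eq l_distr r_distr l_minus r_minus m_ac)
  finally show ?thesis .
qed

lemma quotient_rule_mult:
  assumes "a \<in> carrier R" "b \<in> carrier R" "c \<in> carrier R" "d \<in> carrier R"
    "a' \<in> carrier R" "b' \<in> carrier R" "c' \<in> carrier R" "d' \<in> carrier R"
  shows "(b \<otimes> d) \<otimes> ((a \<otimes> c') \<oplus> (a' \<otimes> c)) \<ominus> ((a \<otimes> c) \<otimes> ((b \<otimes> d') \<oplus> (b' \<otimes> d)))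
  = (b \<otimes> a' \<ominus> a \<otimes> b') \<otimes> (c \<otimes> d) \<oplus> (d \<otimes> c' \<ominus> c \<otimes> d') \<otimes> (a \<otimes> b)" (is "?l = ?r")
proof -
  let ?u = "b \<otimes> d \<otimes> (a' \<otimes> c)"
    and ?v = "b \<otimes> d \<otimes> (a \<otimes> c')" and ?w = "a \<otimes> c \<otimes> (b' \<otimes> d)" and ?z = "a \<otimes> c \<otimes> (b \<otimes> d')"
  have "?l = (?v \<oplus> ?u) \<ominus> (?z \<oplus> ?w)"
    using assms by (simp add: r_distr)
  also have "\<dots> = (?u \<ominus> ?w) \<oplus> (?v \<ominus> ?z)"
    using assms diff_cancel[of \<zero> \<zero> ?u ?v ?w ?z] by (simp add: a_comm)
  also have "\<dots> = ?r"
    using assms by (simp add: minus_eq l_distr r_distr l_minus r_minus m_ac)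
  finally show ?thesis .
qed

lemma quotient_rule_denominators:
  assumes "n \<in> carrier R" "m \<in> carrier R" "a \<in> carrier R" "b \<in> carrier R" "c \<in> carrier R" "d \<in> carrier R"
  shows "(m \<otimes> (c \<otimes> d) \<oplus> n \<otimes> (a \<otimes> b)) \<otimes> (b \<otimes> (d \<otimes> d) \<otimes> (b \<otimes> b \<otimes> d)) =
        (a \<otimes> n \<otimes> (b \<otimes> b \<otimes> d) \<oplus> m \<otimes> c \<otimes> (b \<otimes> (d \<otimes> d))) \<otimes> (b \<otimes> d \<otimes> (b \<otimes> d))"
  using assms by (simp add: l_distr r_distr m_ac a_ac)

lemma fraction_identities:
  assumes "a \<in> carrier R" "b \<in> carrier R" "c \<in> carrier R" "d \<in> carrier R" "e \<in> carrier R" "f \<in> carrier R"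
  shows "((a \<otimes> d \<oplus> c \<otimes> b) \<otimes> f \<oplus> e \<otimes> (b \<otimes> d)) \<otimes> (b \<otimes> (d \<otimes> f)) =
            (a \<otimes> (d \<otimes> f) \<oplus> (c \<otimes> f \<oplus> e \<otimes> d) \<otimes> b) \<otimes> (b \<otimes> d \<otimes> f)"
    "((a \<otimes> d \<oplus> c \<otimes> b) \<otimes> e) \<otimes> (b \<otimes> f \<otimes> (d \<otimes> f)) =
          (a \<otimes> e \<otimes> (d \<otimes> f) \<oplus> c \<otimes> e \<otimes> (b \<otimes> f)) \<otimes> (b \<otimes> d \<otimes> f)"
  using assms by (simp_all add: l_distr r_distr m_ac a_ac)

lemma quotient_rule_well_defined:
  assumes "a \<in> carrier R" "b \<in> carrier R" "a' \<in> carrier R" "b' \<in> carrier R"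
    "\<delta>a \<in> carrier R" "\<delta>b \<in> carrier R" "\<delta>a' \<in> carrier R" "\<delta>b' \<in> carrier R"
  and h: "a \<otimes> b' = a' \<otimes> b" and h': "(a \<otimes> \<delta>b') \<oplus> (\<delta>a \<otimes> b') = (a' \<otimes> \<delta>b) \<oplus> (\<delta>a' \<otimes> b)"
  shows "(b \<otimes> \<delta>a \<ominus> a \<otimes> \<delta>b) \<otimes> (b' \<otimes> b') = (b' \<otimes> \<delta>a' \<ominus> a' \<otimes> \<delta>b') \<otimes> (b \<otimes> b)"
proof -
  let ?p = "b \<otimes> \<delta>b' \<otimes> (a \<otimes> b')" and ?q = "b' \<otimes> \<delta>b \<otimes> (a \<otimes> b')"
  have c2: "(s \<oplus> u) \<ominus> (s \<oplus> w) = u \<ominus> w" if "s \<in> carrier R" "u \<in> carrier R" "w \<in> carrier R" for s u w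
    using that by algebra
  have "(b \<otimes> \<delta>a \<ominus> a \<otimes> \<delta>b) \<otimes> (b' \<otimes> b') = (b \<otimes> \<delta>a \<otimes> (b' \<otimes> b')) \<ominus> ?q"
    using assms(1-8) by (simp add: minus_eq l_distr r_distr l_minus r_minus m_ac)
  also have "\<dots> = (?p \<oplus> b \<otimes> \<delta>a \<otimes> (b' \<otimes> b')) \<ominus> (?p \<oplus> ?q)"
    using assms(1-8) by (simp add: c2)
  also have "?p \<oplus> b \<otimes> \<delta>a \<otimes> (b' \<otimes> b') = (b \<otimes> b') \<otimes> ((a \<otimes> \<delta>b') \<oplus> (\<delta>a \<otimes> b'))"
    using assms(1-8) by (simp add: r_distr m_ac)
  also have "\<dots> = ?q \<oplus> (b' \<otimes> \<delta>a' \<otimes> (b \<otimes> b))"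
    unfolding h h' using assms(1-8) by (simp add: r_distr m_ac)
  also have "(?q \<oplus> (b' \<otimes> \<delta>a' \<otimes> (b \<otimes> b))) \<ominus> (?p \<oplus> ?q) = (b' \<otimes> \<delta>a' \<otimes> (b \<otimes> b)) \<ominus> ?p"
    using assms(1-8) by (simp add: c2 a_comm[of ?p ?q])
  also have "\<dots> = (b' \<otimes> \<delta>a' \<ominus> a' \<otimes> \<delta>b') \<otimes> (b \<otimes> b)"
    unfolding h using assms(1-8) by (simp add: minus_eq l_distr r_distr l_minus r_minus m_ac)
  finally show ?thesis .
qed

lemma fraction_add_well_defined:
  assumes "a \<in> carrier R" "b \<in> carrier R" "c \<in> carrier R" "d \<in> carrier R"
    "a' \<in> carrier R" "b' \<in> carrier R" "c' \<in> carrier R" "d' \<in> carrier R"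
  shows "((a' \<otimes> d') \<oplus> (c' \<otimes> b')) \<otimes> (b \<otimes> d) = (a' \<otimes> b) \<otimes> (d \<otimes> d') \<oplus> (c' \<otimes> d) \<otimes> (b \<otimes> b')"
  using assms by (simp add: l_distr r_distr m_ac a_ac)
end

context "domain"
begin

lemma equiv_frac_rel: "equiv (carrier R \<times> (carrier R - {\<zero>})) (frac_rel R)"
proof (rule equivI)
  show "refl_on (carrier R \<times> (carrier R - {\<zero>})) (frac_rel R)"
    by (auto simp: refl_on_def frac_rel_def)
  show "sym (frac_rel R)" by (auto simp: sym_def frac_rel_def)
  show "trans (frac_rel R)"
  proof (rule transI)
    fix p q r assume pq: "(p, q) \<in> frac_rel R" and qr: "(q, r) \<in> frac_rel R"
    obtain a b c d e f where e: "p = (a, b)" "q = (c, d)" "r = (e, f)"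
      by (metis surj_pair)
    have c: "a \<in> carrier R" "b \<in> carrier R" "c \<in> carrier R" "d \<in> carrier R"
      "e \<in> carrier R" "f \<in> carrier R" "b \<noteq> \<zero>" "d \<noteq> \<zero>" "f \<noteq> \<zero>"
      and h: "a \<otimes> d = c \<otimes> b" "c \<otimes> f = e \<otimes> d"
      using pq qr by (auto simp: e frac_rel_def)
    have "(a \<otimes> f) \<otimes> d = (a \<otimes> d) \<otimes> f" using c by (simp add: m_ac)
    also have "\<dots> = (c \<otimes> f) \<otimes> b" using c by (simp add: h(1) m_ac)
    also have "\<dots> = (e \<otimes> b) \<otimes> d" using c by (simp add: h(2) m_ac)
    finally have "a \<otimes> f = e \<otimes> b" using c by (simp add: m_rcancel)
    then show "(p, r) \<in> frac_rel R" using c by (auto simp: e frac_rel_def)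
  qed
qed (auto simp: frac_rel_def)

lemma fraction_eq_iff:
  assumes "a \<in> carrier R" "b \<in> carrier R" "c \<in> carrier R" "d \<in> carrier R" "b \<noteq> \<zero>" "d \<noteq> \<zero>"
  shows "fraction R a b = fraction R c d \<longleftrightarrow> a \<otimes> d = c \<otimes> b"
proof -
  have "fraction R a b = fraction R c d \<longleftrightarrow> ((a, b), (c, d)) \<in> frac_rel R"
    unfolding fraction_def using assms by (intro eq_equiv_class_iff[OF equiv_frac_rel]) auto
  then show ?thesis using assms by (simp add: frac_rel_def)
qed

lemma mem_fraction:
  assumes "p \<in> fraction R a b"
  obtains c d where "p = (c, d)" "c \<in> carrier R" "d \<in> carrier R" "d \<noteq> \<zero>"
    "a \<in> carrier R" "b \<in> carrier R" "b \<noteq> \<zero>" "a \<otimes> d = c \<otimes> b"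
  using assms by (cases p) (auto simp: fraction_def frac_rel_def)

lemma fraction_nonempty:
  assumes "a \<in> carrier R" "b \<in> carrier R" "b \<noteq> \<zero>"
  shows "fraction R a b \<noteq> {}"
  using assms by (auto simp: fraction_def frac_rel_def)

lemma fraction_carrier:
  assumes "a \<in> carrier R" "b \<in> carrier R" "b \<noteq> \<zero>"
  shows "fraction R a b \<in> carrier (Frac R)"
  using assms by (auto simp: Frac_def fraction_def intro!: quotientI)

lemma Frac_cases:
  assumes "x \<in> carrier (Frac R)"
  obtains a b where "a \<in> carrier R" "b \<in> carrier R" "b \<noteq> \<zero>" "x = fraction R a b"
  using assms by (auto simp: Frac_def fraction_def elim!: quotientE)

lemma Frac_cases2:
  assumes "x \<in> carrier (Frac R)" "y \<in> carrier (Frac R)"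
  obtains a b c d where "a \<in> carrier R" "b \<in> carrier R" "c \<in> carrier R" "d \<in> carrier R"
    "b \<noteq> \<zero>" "d \<noteq> \<zero>" "x = fraction R a b" "y = fraction R c d"
  using assms by (elim Frac_cases) blast

lemma Frac_cases3:
  assumes "x \<in> carrier (Frac R)" "y \<in> carrier (Frac R)" "z \<in> carrier (Frac R)"
  obtains a b c d e f where "a \<in> carrier R" "b \<in> carrier R" "c \<in> carrier R" "d \<in> carrier R"
    "e \<in> carrier R" "f \<in> carrier R" "b \<noteq> \<zero>" "d \<noteq> \<zero>" "f \<noteq> \<zero>"
    "x = fraction R a b" "y = fraction R c d" "z = fraction R e f"
  using assms by (elim Frac_cases) blast

lemma Frac_add:
  assumes "a \<in> carrier R" "b \<in> carrier R" "c \<in> carrier R" "d \<in> carrier R" "b \<noteq> \<zero>" "d \<noteq> \<zero>"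
  shows "fraction R a b \<oplus>\<^bsub>Frac R\<^esub> fraction R c d = fraction R ((a \<otimes> d) \<oplus> (c \<otimes> b)) (b \<otimes> d)"
proof -
  have "(\<Union>p\<in>fraction R a b. \<Union>q\<in>fraction R c d.
      (case p of (a, b) \<Rightarrow> case q of (c, d) \<Rightarrow>
        fraction R ((a \<otimes> d) \<oplus> (c \<otimes> b)) (b \<otimes> d))) =
    fraction R ((a \<otimes> d) \<oplus> (c \<otimes> b)) (b \<otimes> d)"
  proof (rule UN_const2)
    fix p q assume "p \<in> fraction R a b" "q \<in> fraction R c d"
    then obtain a' b' c' d' where e: "p = (a', b')" "q = (c', d')"
      and c: "a' \<in> carrier R" "b' \<in> carrier R" "c' \<in> carrier R" "d' \<in> carrier R" "b' \<noteq> \<zero>" "d' \<noteq> \<zero>"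
      and h: "a \<otimes> b' = a' \<otimes> b" "c \<otimes> d' = c' \<otimes> d"
      by (metis mem_fraction)
    have "((a' \<otimes> d') \<oplus> (c' \<otimes> b')) \<otimes> (b \<otimes> d) = (a' \<otimes> b) \<otimes> (d \<otimes> d') \<oplus> (c' \<otimes> d) \<otimes> (b \<otimes> b')"
      using assms c by (simp add: fraction_add_well_defined)
    also have "\<dots> = (a \<otimes> b') \<otimes> (d \<otimes> d') \<oplus> (c \<otimes> d') \<otimes> (b \<otimes> b')" by (simp only: h)
    also have "\<dots> = ((a \<otimes> d) \<oplus> (c \<otimes> b)) \<otimes> (b' \<otimes> d')"
      using assms c fraction_add_well_defined[of a b' c d' d d' b b'] by (simp add: l_distr r_distr m_ac)
    finally show "(case p of (a, b) \<Rightarrow> case q of (c, d) \<Rightarrow>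
        fraction R ((a \<otimes> d) \<oplus> (c \<otimes> b)) (b \<otimes> d)) = fraction R ((a \<otimes> d) \<oplus> (c \<otimes> b)) (b \<otimes> d)"
      unfolding e using assms c by (simp add: fraction_eq_iff integral_iff)
  qed (use assms fraction_nonempty in auto)
  then show ?thesis by (simp add: Frac_def case_prod_unfold)
qed

lemma Frac_mult:
  assumes "a \<in> carrier R" "b \<in> carrier R" "c \<in> carrier R" "d \<in> carrier R" "b \<noteq> \<zero>" "d \<noteq> \<zero>"
  shows "fraction R a b \<otimes>\<^bsub>Frac R\<^esub> fraction R c d = fraction R (a \<otimes> c) (b \<otimes> d)"
proof -
  have "(\<Union>p\<in>fraction R a b. \<Union>q\<in>fraction R c d.
      (case p of (a, b) \<Rightarrow> case q of (c, d) \<Rightarrow> fraction R (a \<otimes> c) (b \<otimes> d))) =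
    fraction R (a \<otimes> c) (b \<otimes> d)"
  proof (rule UN_const2)
    fix p q assume "p \<in> fraction R a b" "q \<in> fraction R c d"
    then obtain a' b' c' d' where e: "p = (a', b')" "q = (c', d')"
      and c: "a' \<in> carrier R" "b' \<in> carrier R" "c' \<in> carrier R" "d' \<in> carrier R" "b' \<noteq> \<zero>" "d' \<noteq> \<zero>"
      and h: "a \<otimes> b' = a' \<otimes> b" "c \<otimes> d' = c' \<otimes> d"
      by (metis mem_fraction)
    have "(a' \<otimes> c') \<otimes> (b \<otimes> d) = (a' \<otimes> b) \<otimes> (c' \<otimes> d)"
      using assms c by (simp add: m_ac)
    also have "\<dots> = (a \<otimes> b') \<otimes> (c \<otimes> d')" by (simp only: h)
    also have "\<dots> = (a \<otimes> c) \<otimes> (b' \<otimes> d')" using assms c by (simp add: m_ac)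
    finally show "(case p of (a, b) \<Rightarrow> case q of (c, d) \<Rightarrow>
        fraction R (a \<otimes> c) (b \<otimes> d)) = fraction R (a \<otimes> c) (b \<otimes> d)"
      unfolding e using assms c by (simp add: fraction_eq_iff integral_iff)
  qed (use assms fraction_nonempty in auto)
  then show ?thesis by (simp add: Frac_def case_prod_unfold)
qed

lemma Frac_zero: "\<zero>\<^bsub>Frac R\<^esub> = fraction R \<zero> \<one>"
  and Frac_one: "\<one>\<^bsub>Frac R\<^esub> = fraction R \<one> \<one>"
  by (simp_all add: Frac_def)

lemma Frac_field: "field (Frac R)"
proof -
  have cr: "cring (Frac R)"
  proof (rule cringI)
    show "abelian_group (Frac R)"
    proof (rule abelian_groupI)
      fix x y z assume "x \<in> carrier (Frac R)" "y \<in> carrier (Frac R)" "z \<in> carrier (Frac R)"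
      then obtain a b c d e f
        where c: "a \<in> carrier R" "b \<in> carrier R" "c \<in> carrier R" "d \<in> carrier R"
          "e \<in> carrier R" "f \<in> carrier R" "b \<noteq> \<zero>" "d \<noteq> \<zero>" "f \<noteq> \<zero>"
          and eq: "x = fraction R a b" "y = fraction R c d" "z = fraction R e f"
        by (rule Frac_cases3)
      have "((a \<otimes> d \<oplus> c \<otimes> b) \<otimes> f \<oplus> e \<otimes> (b \<otimes> d)) \<otimes> (b \<otimes> (d \<otimes> f)) =
            (a \<otimes> (d \<otimes> f) \<oplus> (c \<otimes> f \<oplus> e \<otimes> d) \<otimes> b) \<otimes> (b \<otimes> d \<otimes> f)"
        using c by (simp add: fraction_identities(1))
      then show "(x \<oplus>\<^bsub>Frac R\<^esub> y) \<oplus>\<^bsub>Frac R\<^esub> z = x \<oplus>\<^bsub>Frac R\<^esub> (y \<oplus>\<^bsub>Frac R\<^esub> z)"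
        unfolding eq using c by (simp add: Frac_add integral_iff fraction_eq_iff)
    next
      fix x y assume "x \<in> carrier (Frac R)" "y \<in> carrier (Frac R)"
      then obtain a b c d
        where c: "a \<in> carrier R" "b \<in> carrier R" "c \<in> carrier R" "d \<in> carrier R" "b \<noteq> \<zero>" "d \<noteq> \<zero>"
          and eq: "x = fraction R a b" "y = fraction R c d"
        by (rule Frac_cases2)
      show "x \<oplus>\<^bsub>Frac R\<^esub> y \<in> carrier (Frac R)"
        unfolding eq using c by (simp add: Frac_add fraction_carrier integral_iff)
      have "(a \<otimes> d \<oplus> c \<otimes> b) \<otimes> (d \<otimes> b) = (c \<otimes> b \<oplus> a \<otimes> d) \<otimes> (b \<otimes> d)"
        using c by (simp add: m_ac a_ac)
      then show "x \<oplus>\<^bsub>Frac R\<^esub> y = y \<oplus>\<^bsub>Frac R\<^esub> x"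
        unfolding eq using c by (simp add: Frac_add integral_iff fraction_eq_iff)
    next
      fix x assume "x \<in> carrier (Frac R)"
      then obtain a b where c: "a \<in> carrier R" "b \<in> carrier R" "b \<noteq> \<zero>" and eq: "x = fraction R a b"
        by (rule Frac_cases)
      show "\<zero>\<^bsub>Frac R\<^esub> \<oplus>\<^bsub>Frac R\<^esub> x = x"
        unfolding eq Frac_zero using c by (simp add: Frac_add fraction_eq_iff)
      have "\<ominus> a \<otimes> b \<oplus> a \<otimes> b = \<zero>" using c by (simp add: l_minus l_neg)
      then have "fraction R (\<ominus> a) b \<oplus>\<^bsub>Frac R\<^esub> x = \<zero>\<^bsub>Frac R\<^esub>"
        unfolding eq Frac_zero using c by (simp add: Frac_add fraction_eq_iff integral_iff)
      then show "\<exists>y\<in>carrier (Frac R). y \<oplus>\<^bsub>Frac R\<^esub> x = \<zero>\<^bsub>Frac R\<^esub>"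
        using c fraction_carrier[of "\<ominus> a" b] by auto
    qed (simp add: Frac_zero fraction_carrier)
    show "comm_monoid (Frac R)"
    proof (rule comm_monoidI)
      fix x y z assume "x \<in> carrier (Frac R)" "y \<in> carrier (Frac R)" "z \<in> carrier (Frac R)"
      then obtain a b c d e f
        where c: "a \<in> carrier R" "b \<in> carrier R" "c \<in> carrier R" "d \<in> carrier R"
          "e \<in> carrier R" "f \<in> carrier R" "b \<noteq> \<zero>" "d \<noteq> \<zero>" "f \<noteq> \<zero>"
          and eq: "x = fraction R a b" "y = fraction R c d" "z = fraction R e f"
        by (rule Frac_cases3)
      show "(x \<otimes>\<^bsub>Frac R\<^esub> y) \<otimes>\<^bsub>Frac R\<^esub> z = x \<otimes>\<^bsub>Frac R\<^esub> (y \<otimes>\<^bsub>Frac R\<^esub> z)"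
        unfolding eq using c by (simp add: Frac_mult integral_iff m_assoc)
    next
      fix x y assume "x \<in> carrier (Frac R)" "y \<in> carrier (Frac R)"
      then obtain a b c d
        where c: "a \<in> carrier R" "b \<in> carrier R" "c \<in> carrier R" "d \<in> carrier R" "b \<noteq> \<zero>" "d \<noteq> \<zero>"
          and eq: "x = fraction R a b" "y = fraction R c d"
        by (rule Frac_cases2)
      show "x \<otimes>\<^bsub>Frac R\<^esub> y \<in> carrier (Frac R)"
        unfolding eq using c by (simp add: Frac_mult fraction_carrier integral_iff)
      show "x \<otimes>\<^bsub>Frac R\<^esub> y = y \<otimes>\<^bsub>Frac R\<^esub> x"
        unfolding eq using c by (simp add: Frac_mult m_comm)
    next
      fix x assume "x \<in> carrier (Frac R)"
      then obtain a b where c: "a \<in> carrier R" "b \<in> carrier R" "b \<noteq> \<zero>" and eq: "x = fraction R a b"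
        by (rule Frac_cases)
      show "\<one>\<^bsub>Frac R\<^esub> \<otimes>\<^bsub>Frac R\<^esub> x = x"
        unfolding eq Frac_one using c by (simp add: Frac_mult)
    qed (simp add: Frac_one fraction_carrier)
    fix x y z assume "x \<in> carrier (Frac R)" "y \<in> carrier (Frac R)" "z \<in> carrier (Frac R)"
    then obtain a b c d e f
      where c: "a \<in> carrier R" "b \<in> carrier R" "c \<in> carrier R" "d \<in> carrier R"
        "e \<in> carrier R" "f \<in> carrier R" "b \<noteq> \<zero>" "d \<noteq> \<zero>" "f \<noteq> \<zero>"
        and eq: "x = fraction R a b" "y = fraction R c d" "z = fraction R e f"
      by (rule Frac_cases3)
    have "((a \<otimes> d \<oplus> c \<otimes> b) \<otimes> e) \<otimes> (b \<otimes> f \<otimes> (d \<otimes> f)) =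
          (a \<otimes> e \<otimes> (d \<otimes> f) \<oplus> c \<otimes> e \<otimes> (b \<otimes> f)) \<otimes> (b \<otimes> d \<otimes> f)"
      using c by (simp add: fraction_identities(2))
    then show "(x \<oplus>\<^bsub>Frac R\<^esub> y) \<otimes>\<^bsub>Frac R\<^esub> z = x \<otimes>\<^bsub>Frac R\<^esub> z \<oplus>\<^bsub>Frac R\<^esub> y \<otimes>\<^bsub>Frac R\<^esub> z"
      unfolding eq using c by (simp add: Frac_add Frac_mult integral_iff fraction_eq_iff)
  qed
  interpret F: cring "Frac R" by (fact cr)
  have ne: "fraction R a b = \<zero>\<^bsub>Frac R\<^esub> \<longleftrightarrow> a = \<zero>" if "a \<in> carrier R" "b \<in> carrier R" "b \<noteq> \<zero>" for a b
    using that by (simp add: Frac_zero fraction_eq_iff)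
  show ?thesis
  proof (rule F.cring_fieldI2)
    show "\<zero>\<^bsub>Frac R\<^esub> \<noteq> \<one>\<^bsub>Frac R\<^esub>" using ne[of \<one> \<one>] by (auto simp: Frac_one)
    fix x assume "x \<in> carrier (Frac R)" "x \<noteq> \<zero>\<^bsub>Frac R\<^esub>"
    then obtain a b where c: "a \<in> carrier R" "b \<in> carrier R" "b \<noteq> \<zero>" "a \<noteq> \<zero>"
      and eq: "x = fraction R a b"
      using ne by (metis Frac_cases)
    have "x \<otimes>\<^bsub>Frac R\<^esub> fraction R b a = \<one>\<^bsub>Frac R\<^esub>"
      unfolding eq Frac_one using c by (simp add: Frac_mult fraction_eq_iff integral_iff m_comm)
    then show "\<exists>y\<in>carrier (Frac R). x \<otimes>\<^bsub>Frac R\<^esub> y = \<one>\<^bsub>Frac R\<^esub>"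
      using c fraction_carrier by blast
  qed
qed

lemma frac_derivation_ex1:
  assumes \<delta>: "\<delta> \<in> derivations R"
  shows "\<exists>!D. D \<in> derivations (Frac R) \<and>
    (\<forall>a\<in>carrier R. D (fraction R a \<one>) = fraction R (\<delta> a) \<one>)"
proof -
  interpret F: field "Frac R" by (rule Frac_field)
  note dc [simp] = derivationsD(1)[OF \<delta>] and da = derivationsD(2)[OF \<delta>] and dm = derivationsD(3)[OF \<delta>]
  have d1: "\<delta> \<one> = \<zero>"
  proof -
    have "\<delta> \<one> \<oplus> \<delta> \<one> = \<delta> \<one>" using dm[of \<one> \<one>] by simp
    then show ?thesis by (simp add: add.l_cancel_one')
  qed
  define N where "N a b = (b \<otimes> \<delta> a) \<ominus> (a \<otimes> \<delta> b)" for a b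
  have N [simp]: "a \<in> carrier R \<Longrightarrow> b \<in> carrier R \<Longrightarrow> N a b \<in> carrier R" for a b
    by (simp add: N_def)
  define D where "D = (\<lambda>U\<in>carrier (Frac R). \<Union>(a, b)\<in>U. fraction R (N a b) (b \<otimes> b))"
  have D: "D (fraction R a b) = fraction R (N a b) (b \<otimes> b)"
    if c: "a \<in> carrier R" "b \<in> carrier R" "b \<noteq> \<zero>" for a b
  proof -
    have "(case p of (a, b) \<Rightarrow> fraction R (N a b) (b \<otimes> b)) = fraction R (N a b) (b \<otimes> b)"
      if p: "p \<in> fraction R a b" for p
    proof -
      obtain a' b' where e: "p = (a', b')" and c': "a' \<in> carrier R" "b' \<in> carrier R" "b' \<noteq> \<zero>"
        and h: "a \<otimes> b' = a' \<otimes> b"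
        using p by (blast elim: mem_fraction)
      have h': "(a \<otimes> \<delta> b') \<oplus> (\<delta> a \<otimes> b') = (a' \<otimes> \<delta> b) \<oplus> (\<delta> a' \<otimes> b)"
        using dm[of a b'] dm[of a' b] c c' by (simp add: h)
      have cd: "\<delta> a \<in> carrier R" "\<delta> b \<in> carrier R" "\<delta> a' \<in> carrier R" "\<delta> b' \<in> carrier R"
        using c c' by auto
      have "N a b \<otimes> (b' \<otimes> b') = N a' b' \<otimes> (b \<otimes> b)"
        unfolding N_def using c c' cd h h' by (intro quotient_rule_well_defined)
      then show ?thesis unfolding e using c c' by (simp add: fraction_eq_iff integral_iff)
    qed
    then have "(\<Union>(a, b)\<in>fraction R a b. fraction R (N a b) (b \<otimes> b)) = fraction R (N a b) (b \<otimes> b)"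
      using fraction_nonempty[OF c] by auto
    then show ?thesis using fraction_carrier[OF c] by (simp add: D_def)
  qed
  have "D \<in> derivations (Frac R)"
  proof (rule derivationsI)
    have "D x \<in> carrier (Frac R)" if "x \<in> carrier (Frac R)" for x
      using that by (rule Frac_cases) (simp add: D fraction_carrier integral_iff)
    then show "D \<in> carrier (Frac R) \<rightarrow>\<^sub>E carrier (Frac R)"
      by (auto simp: D_def PiE_def extensional_def)
    fix x y assume "x \<in> carrier (Frac R)" "y \<in> carrier (Frac R)"
    then obtain a b c d
      where c: "a \<in> carrier R" "b \<in> carrier R" "c \<in> carrier R" "d \<in> carrier R" "b \<noteq> \<zero>" "d \<noteq> \<zero>"
        and eq: "x = fraction R a b" "y = fraction R c d"
      by (rule Frac_cases2)
    have cd: "\<delta> a \<in> carrier R" "\<delta> b \<in> carrier R" "\<delta> c \<in> carrier R" "\<delta> d \<in> carrier R"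
      using c by auto
    have "N (a \<otimes> d \<oplus> c \<otimes> b) (b \<otimes> d) \<otimes> (b \<otimes> b \<otimes> (d \<otimes> d)) =
        (N a b \<otimes> (d \<otimes> d) \<oplus> N c d \<otimes> (b \<otimes> b)) \<otimes> (b \<otimes> d \<otimes> (b \<otimes> d))"
    proof -
      have "N (a \<otimes> d \<oplus> c \<otimes> b) (b \<otimes> d) = N a b \<otimes> (d \<otimes> d) \<oplus> N c d \<otimes> (b \<otimes> b)"
        unfolding N_def using c cd quotient_rule_add[of a b c d] by (simp add: da dm)
      moreover have "b \<otimes> b \<otimes> (d \<otimes> d) = b \<otimes> d \<otimes> (b \<otimes> d)" using c by (simp add: m_ac)
      ultimately show ?thesis by (simp only:)
    qed
    then show "D (x \<oplus>\<^bsub>Frac R\<^esub> y) = D x \<oplus>\<^bsub>Frac R\<^esub> D y"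
      unfolding eq using c by (simp add: D Frac_add integral_iff fraction_eq_iff)
    have "N (a \<otimes> c) (b \<otimes> d) \<otimes> (b \<otimes> (d \<otimes> d) \<otimes> (b \<otimes> b \<otimes> d)) =
        (a \<otimes> N c d \<otimes> (b \<otimes> b \<otimes> d) \<oplus> N a b \<otimes> c \<otimes> (b \<otimes> (d \<otimes> d))) \<otimes> (b \<otimes> d \<otimes> (b \<otimes> d))"
    proof -
      have "N (a \<otimes> c) (b \<otimes> d) = N a b \<otimes> (c \<otimes> d) \<oplus> N c d \<otimes> (a \<otimes> b)"
        unfolding N_def using c cd quotient_rule_mult[of a b c d] by (simp add: dm)
      then show ?thesis using c by (simp add: quotient_rule_denominators)
    qed
    then show "D (x \<otimes>\<^bsub>Frac R\<^esub> y) = (x \<otimes>\<^bsub>Frac R\<^esub> D y) \<oplus>\<^bsub>Frac R\<^esub> (D x \<otimes>\<^bsub>Frac R\<^esub> y)"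
      unfolding eq using c by (simp add: D Frac_add Frac_mult integral_iff fraction_eq_iff)
  qed
  moreover have "\<forall>a\<in>carrier R. D (fraction R a \<one>) = fraction R (\<delta> a) \<one>"
    by (simp add: D N_def d1 minus_eq)
  moreover have "E = E'"
    if E: "E \<in> derivations (Frac R)" "\<forall>a\<in>carrier R. E (fraction R a \<one>) = fraction R (\<delta> a) \<one>"
      and E': "E' \<in> derivations (Frac R)" "\<forall>a\<in>carrier R. E' (fraction R a \<one>) = fraction R (\<delta> a) \<one>"
    for E E'
  proof (rule extensionalityI)
    show "E \<in> extensional (carrier (Frac R))" "E' \<in> extensional (carrier (Frac R))"
      using E(1) E'(1) by (auto intro: derivationsD)
    fix q assume q: "q \<in> carrier (Frac R)"
    then obtain a b where c: "a \<in> carrier R" "b \<in> carrier R" "b \<noteq> \<zero>" and eq: "q = fraction R a b"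
      by (rule Frac_cases)
    let ?x = "fraction R a \<one>" and ?y = "fraction R b \<one>"
    have xy: "?x \<in> carrier (Frac R)" "?y \<in> carrier (Frac R)" "?y \<noteq> \<zero>\<^bsub>Frac R\<^esub>"
      using c by (auto simp: fraction_carrier Frac_zero fraction_eq_iff)
    have qy: "q \<otimes>\<^bsub>Frac R\<^esub> ?y = ?x"
      unfolding eq using c by (simp add: Frac_mult fraction_eq_iff m_comm)
    have Exy: "E ?x = E' ?x" "E ?y = E' ?y" using E(2) E'(2) c by auto
    note carr = derivationsD(1)[OF E(1) q] derivationsD(1)[OF E'(1) q] derivationsD(1)[OF E'(1) xy(2)]
    have "(q \<otimes>\<^bsub>Frac R\<^esub> E' ?y) \<oplus>\<^bsub>Frac R\<^esub> (E q \<otimes>\<^bsub>Frac R\<^esub> ?y) =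
          (q \<otimes>\<^bsub>Frac R\<^esub> E' ?y) \<oplus>\<^bsub>Frac R\<^esub> (E' q \<otimes>\<^bsub>Frac R\<^esub> ?y)"
      using derivationsD(3)[OF E(1) q xy(2)] derivationsD(3)[OF E'(1) q xy(2)] by (simp only: qy Exy)
    then have "E q \<otimes>\<^bsub>Frac R\<^esub> ?y = E' q \<otimes>\<^bsub>Frac R\<^esub> ?y"
      by (rule F.add.l_cancel) (intro F.m_closed q xy carr)+
    then show "E q = E' q"
      using F.m_rcancel[OF xy(3) xy(2) derivationsD(1)[OF E(1) q] derivationsD(1)[OF E'(1) q]] by blast
  qed
  ultimately show ?thesis by blast
qed

end

definition quotient_derivation ::
    "('a, 'b) ring_scheme \<Rightarrow> 'a set \<Rightarrow> ('a \<Rightarrow> 'a) \<Rightarrow> 'a set \<Rightarrow> 'a set" where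
  "quotient_derivation R P \<delta> = (\<lambda>C\<in>carrier (R Quot P). \<Union>x\<in>C. P +>\<^bsub>R\<^esub> \<delta> x)"

lemma quotient_derivation:
  assumes "cring R" and P: "delta_ideal R \<Delta> P" and \<delta>: "\<delta> \<in> \<Delta>" "\<delta> \<in> derivations R"
  shows "quotient_derivation R P \<delta> \<in> derivations (R Quot P)"
    and "x \<in> carrier R \<Longrightarrow> quotient_derivation R P \<delta> (P +>\<^bsub>R\<^esub> x) = P +>\<^bsub>R\<^esub> \<delta> x"
proof -
  interpret R: cring R by fact
  interpret P: ideal P R using P by (simp add: delta_ideal_def)
  have stable: "\<And>x. x \<in> P \<Longrightarrow> \<delta> x \<in> P" using P \<delta> by (auto simp: delta_ideal_def)
  note dc [simp] = derivationsD(1)[OF \<delta>(2)]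
    and da = derivationsD(2)[OF \<delta>(2)] and dm = derivationsD(3)[OF \<delta>(2)]
  let ?d = "quotient_derivation R P \<delta>"
  have coset: "P +>\<^bsub>R\<^esub> x \<in> carrier (R Quot P)" if "x \<in> carrier R" for x
    using that by (auto simp: FactRing_simps)
  have cosetE: "\<exists>x\<in>carrier R. C = P +>\<^bsub>R\<^esub> x" if "C \<in> carrier (R Quot P)" for C
    using that by (auto simp: FactRing_simps)
  show *: "?d (P +>\<^bsub>R\<^esub> x) = P +>\<^bsub>R\<^esub> \<delta> x" if x: "x \<in> carrier R" for x
  proof -
    have "P +>\<^bsub>R\<^esub> \<delta> y = P +>\<^bsub>R\<^esub> \<delta> x" if "y \<in> P +>\<^bsub>R\<^esub> x" for y
    proof -
      obtain p where p: "p \<in> P" "y = p \<oplus>\<^bsub>R\<^esub> x" using \<open>y \<in> P +>\<^bsub>R\<^esub> x\<close> by (auto simp: a_r_coset_def')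
      then have "\<delta> y = \<delta> p \<oplus>\<^bsub>R\<^esub> \<delta> x" using x by (simp add: da)
      then have "\<delta> y \<in> P +>\<^bsub>R\<^esub> \<delta> x" using stable[OF p(1)] by (auto simp: a_r_coset_def')
      then show ?thesis using P.a_repr_independence'[of "\<delta> y" "\<delta> x"] x by simp
    qed
    moreover have "P +>\<^bsub>R\<^esub> x \<noteq> {}" using P.a_rcos_self[OF x] by blast
    ultimately show ?thesis using coset[OF x] by (simp add: quotient_derivation_def)
  qed
  have add: "(P +>\<^bsub>R\<^esub> x) \<oplus>\<^bsub>R Quot P\<^esub> (P +>\<^bsub>R\<^esub> y) = P +>\<^bsub>R\<^esub> (x \<oplus>\<^bsub>R\<^esub> y)"
    and mult: "(P +>\<^bsub>R\<^esub> x) \<otimes>\<^bsub>R Quot P\<^esub> (P +>\<^bsub>R\<^esub> y) = P +>\<^bsub>R\<^esub> (x \<otimes>\<^bsub>R\<^esub> y)"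
    if "x \<in> carrier R" "y \<in> carrier R" for x y
    using that by (simp_all add: FactRing_def P.a_rcos_sum P.rcoset_mult_add)
  show "?d \<in> derivations (R Quot P)"
  proof (rule derivationsI)
    have "?d C \<in> carrier (R Quot P)" if "C \<in> carrier (R Quot P)" for C
      using cosetE[OF that] * coset by auto
    then show "?d \<in> carrier (R Quot P) \<rightarrow>\<^sub>E carrier (R Quot P)"
      by (auto simp: quotient_derivation_def PiE_def extensional_def)
    fix C E assume "C \<in> carrier (R Quot P)" "E \<in> carrier (R Quot P)"
    then obtain x y where x: "x \<in> carrier R" "C = P +>\<^bsub>R\<^esub> x" and y: "y \<in> carrier R" "E = P +>\<^bsub>R\<^esub> y"
      using cosetE by blast
    show "?d (C \<oplus>\<^bsub>R Quot P\<^esub> E) = ?d C \<oplus>\<^bsub>R Quot P\<^esub> ?d E"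
      unfolding x(2) y(2) using x(1) y(1) by (simp add: add * da)
    show "?d (C \<otimes>\<^bsub>R Quot P\<^esub> E) = (C \<otimes>\<^bsub>R Quot P\<^esub> ?d E) \<oplus>\<^bsub>R Quot P\<^esub> (?d C \<otimes>\<^bsub>R Quot P\<^esub> E)"
      unfolding x(2) y(2) using x(1) y(1) by (simp add: add mult * dm)
  qed
qed

text \<open>The unique extension to the fraction field; existence and uniqueness are
  \<open>frac_derivation_ex1\<close>.  Uniqueness already holds among derivations that are not
  assumed linear over the base field.\<close>

definition frac_derivation ::
    "('a, 'b) ring_scheme \<Rightarrow> ('a \<Rightarrow> 'a) \<Rightarrow> ('a \<times> 'a) set \<Rightarrow> ('a \<times> 'a) set" where
  "frac_derivation A d = (THE D. D \<in> derivations (Frac A) \<and>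
     (\<forall>a\<in>carrier A. D (fraction A a \<one>\<^bsub>A\<^esub>) = fraction A (d a) \<one>\<^bsub>A\<^esub>))"

definition frac_constants ::
    "('a, 'b) ring_scheme \<Rightarrow> ('a \<Rightarrow> 'a) set \<Rightarrow> 'a set \<Rightarrow> ('a set \<times> 'a set) set set" where
  "frac_constants R \<Delta> P = {z \<in> carrier (Frac (R Quot P)).
     \<forall>\<delta>\<in>\<Delta>. frac_derivation (R Quot P) (quotient_derivation R P \<delta>) z = \<zero>\<^bsub>Frac (R Quot P)\<^esub>}"

text \<open>The image of the base field in the fraction field of \<^term>\<open>R Quot P\<close>.\<close>

definition frac_scalars ::
    "('k, 'm) ring_scheme \<Rightarrow> ('k, 'a, 'n) module_scheme \<Rightarrow> 'a set \<Rightarrow> ('a set \<times> 'a set) set set" where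
  "frac_scalars K R P =
     (\<lambda>c. fraction (R Quot P) (P +>\<^bsub>R\<^esub> (c \<odot>\<^bsub>R\<^esub> \<one>\<^bsub>R\<^esub>)) \<one>\<^bsub>R Quot P\<^esub>) ` carrier K"

definition delta_rational ::
    "('k, 'm) ring_scheme \<Rightarrow> ('k, 'a, 'n) module_scheme \<Rightarrow> ('a \<Rightarrow> 'a) set \<Rightarrow> 'a set \<Rightarrow> bool" where
  "delta_rational K R \<Delta> P \<longleftrightarrow> (\<forall>z\<in>frac_constants R \<Delta> P.
     (ring.algebraic (Frac (R Quot P)) over frac_scalars K R P) z)"

definition delta_dixmier_moeglin ::
    "('k, 'm) ring_scheme \<Rightarrow> ('k, 'a, 'n) module_scheme \<Rightarrow> ('a \<Rightarrow> 'a) set \<Rightarrow> bool" where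
  "delta_dixmier_moeglin K R \<Delta> \<longleftrightarrow> (\<forall>P\<in>delta_spec R \<Delta>.
     (locally_closed_in (delta_spec_topology R \<Delta>) {P} \<longleftrightarrow> delta_primitive R \<Delta> P) \<and>
     (delta_primitive R \<Delta> P \<longleftrightarrow> delta_rational K R \<Delta> P))"

end

theory Submission
  imports Defs "HOL-Algebra.Free_Abelian_Groups"
begin

text \<open>
  Locally closed points are visibly topological.  The key observation is that differential
  primitivity and differential rationality are topological as well: for a differential prime \<open>P\<close>
  both are equivalent to \<open>{P}\<close> being the intersection of a closed set with fewer than \<open>|K|\<close> open
  sets, that is, to the existence of fewer than \<open>|K|\<close> elements outside \<open>P\<close> such that every
  differential prime strictly above \<open>P\<close> contains one of them.  Hence the Dixmier-Moeglin equivalence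
  says that all points of this kind are locally closed, and this property is inherited by and
  detected on locally closed pieces.

  If such elements are given, invert them in \<open>R / P\<close>; since the dimension stays below \<open>|K|\<close>, a
  maximal ideal of the localisation contracts to a maximal ideal of \<open>R\<close>, whose core is \<open>P\<close>.
  If \<open>P\<close> is the core of \<open>M\<close>, a constant of \<open>Frac (R / P)\<close> is defined at \<open>M\<close>, and a polynomial
  satisfied by its residue in the algebraic extension \<open>R / M\<close> of \<open>K\<close> is satisfied by the constant.
  If \<open>P\<close> is rational, take generalised Wronskians of finite subsets of a basis: an element of a
  differential prime \<open>Q\<close> above \<open>P\<close> is a combination with constant coefficients of basis elements
  independent over the constants, and a differential operator isolating one of them shows that the
  corresponding Wronskian lies in \<open>Q\<close>.
\<close>


section \<open>Cardinalities\<close>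

text \<open>Local closedness is the same cutting condition with finitely many open sets, so the
  notion takes the cardinal as a parameter and is transported once for both. The delicate case of
  the counting is a countable \<open>K\<close>: there "fewer than |K|" means finite, yet finitely
  many separating elements can generate an infinite multiplicative set. A finite spanning set is
  therefore treated by finite-dimensional algebra, while an infinite one with fewer than |K|
  elements forces \<open>K\<close> to be uncountable and leaves room for a pigeonhole argument.
  Rationality only makes constants algebraic over \<open>K\<close>, so in the Wronskian step a
  constant coefficient cannot simply be moved into \<open>R\<close>; it is removed at the price of a
  power of the Wronskian, which a prime ideal forgives. Neither the localisation nor operators over
  the fraction field are built: denominators are cleared, and operators keep coefficients in
  \<open>R\<close> so that they preserve differential ideals. Characteristic zero cancels the
  integers that appear when powers are differentiated; this makes cores of prime ideals
  prime.\<close>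

lemma lesspoll_iff_card_of_ordLess: "A \<prec> B \<longleftrightarrow> |A| <o |B|"
  unfolding lesspoll_def lepoll_def eqpoll_iff_card_of_ordIso card_of_ordLeq
  by (metis ordIso_symmetric ordLeq_iff_ordLess_or_ordIso not_ordLess_ordIso)

text \<open>An infinite disjoint sum absorbs its own square, so the product is bounded by the sum,
  which stays below \<open>K\<close>.\<close>

lemma lesspoll_Times:
  assumes "infinite K" "A \<prec> K" "B \<prec> K"
  shows "A \<times> B \<prec> K"
proof (cases "finite A \<and> finite B")
  case True
  then show ?thesis using assms(1) by (simp add: finite_lesspoll_infinite)
next
  case False
  then have "infinite (Sum_Type.Plus A B)" by simp
  moreover have "A \<times> B \<lesssim> (Sum_Type.Plus A B) \<times> (Sum_Type.Plus A B)"
    by (intro times_lepoll_mono) (auto simp: lepoll_def intro: inj_on_subset[OF inj_Inl] inj_on_subset[OF inj_Inr])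
  ultimately have "A \<times> B \<lesssim> Sum_Type.Plus A B"
    using card_of_Times_same_infinite[of "Sum_Type.Plus A B"] unfolding eqpoll_iff_card_of_ordIso[symmetric]
    by (blast intro: lepoll_trans2)
  moreover have "Sum_Type.Plus A B \<prec> K"
    using assms unfolding lesspoll_iff_card_of_ordLess by (rule card_of_Plus_ordLess_infinite)
  ultimately show ?thesis by (rule lesspoll_trans1)
qed

lemma lesspoll_insert: "infinite K \<Longrightarrow> A \<prec> K \<Longrightarrow> insert a A \<prec> K"
  by (metis finite_insert finite_lesspoll_infinite infinite_insert_lepoll lesspoll_trans1)

lemma lesspoll_lists:
  assumes "A \<prec> K" "infinite A"
  shows "lists A \<prec> K"
  using assms card_of_lists_infinite[of A] eqpoll_iff_card_of_ordIso eq_lesspoll_trans by blast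

lemma lesspoll_Fpow:
  assumes "A \<prec> K" "infinite K"
  shows "Fpow A \<prec> K"
proof (cases "finite A")
  case True
  then have "finite (Fpow A)" by (metis Fpow_subset_Pow finite_Pow_iff finite_subset)
  then show ?thesis using assms by (simp add: finite_lesspoll_infinite)
next
  case False
  then show ?thesis using assms eqpoll_Fpow eq_lesspoll_trans by blast
qed

text \<open>With finite fibres only, an infinite \<open>T\<close> would bound |K| by |T|, and a
  finite \<open>T\<close> would make \<open>K\<close> finite. An infinite fibre is claimed rather
  than one of size |K|, which can fail for singular |K|.\<close>

lemma infinite_fibre_lesspoll:
  assumes "infinite K" "T \<prec> K" "f ` K \<subseteq> T"
  shows "\<exists>t\<in>T. infinite {c \<in> K. f c = t}"
proof (rule ccontr)
  assume "\<not> ?thesis"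
  then have fin: "\<And>t. t \<in> T \<Longrightarrow> finite {c \<in> K. f c = t}" by blast
  have K: "K = (\<Union>t\<in>T. {c \<in> K. f c = t})" using assms(3) by auto
  show False
  proof (cases "finite T")
    case True
    then have "finite K" using fin K by (metis (no_types, lifting) finite_UN)
    then show False using assms(1) by simp
  next
    case False
    have "|\<Union>t\<in>T. {c \<in> K. f c = t}| \<le>o |T|"
    proof (rule card_of_UNION_ordLeq_infinite[OF False])
      show "|T| \<le>o |T|" by simp
      show "\<forall>t\<in>T. |{c \<in> K. f c = t}| \<le>o |T|"
        using fin False by (meson finite_lepoll_infinite card_of_ordLeq lepoll_def)
    qed
    then have "|K| \<le>o |T|" using K by simp
    then show False using assms(2) unfolding lesspoll_iff_card_of_ordLess
      using not_ordLess_ordLeq by blast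
  qed
qed


section \<open>Points cut out by few open sets\<close>

text \<open>Only the cardinality of the set \<kappa> matters: \<open>carrier K\<close> gives the
  cuts of the theorem, \<open>UNIV :: nat set\<close> gives local closedness. The family of open
  sets may be empty, which covers closed points.\<close>

definition small_cut :: "'a topology \<Rightarrow> 'c set \<Rightarrow> 'a \<Rightarrow> bool" where
  "small_cut T \<kappa> p \<longleftrightarrow>
     (\<exists>\<U> C. (\<forall>U\<in>\<U>. openin T U) \<and> \<U> \<prec> \<kappa> \<and> closedin T C \<and> C \<inter> \<Inter>\<U> = {p})"

text \<open>Below the natural numbers means finite, and finite intersections of open sets are
  open.\<close>

lemma locally_closed_in_iff_small_cut:
  "locally_closed_in T {p} \<longleftrightarrow> small_cut T (UNIV :: nat set) p"
proof
  assume "locally_closed_in T {p}"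
  then obtain U C where "openin T U" "closedin T C" "{p} = U \<inter> C"
    unfolding locally_closed_in_def by blast
  then show "small_cut T (UNIV :: nat set) p"
    unfolding small_cut_def
    by (intro exI[of _ "{U}"] exI[of _ C]) (auto simp: finite_lesspoll_infinite)
next
  assume "small_cut T (UNIV :: nat set) p"
  then obtain \<U> C where U: "\<forall>U\<in>\<U>. openin T U" "\<U> \<prec> (UNIV :: nat set)"
    and C: "closedin T C" "C \<inter> \<Inter>\<U> = {p}"
    unfolding small_cut_def by blast
  have "finite \<U>" using U(2) by (meson infinite_le_lepoll lesspoll_def lepoll_antisym)
  \<comment> \<open>Inserting \<open>topspace T\<close> keeps the intersection open when the family
    is empty.\<close>
  then have "openin T (\<Inter>(insert (topspace T) \<U>))" using U(1) by (intro openin_Inter) auto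
  moreover have "{p} = \<Inter>(insert (topspace T) \<U>) \<inter> C"
    using C closedin_subset[OF C(1)] by auto
  ultimately show "locally_closed_in T {p}"
    using C(1) unfolding locally_closed_in_def by blast
qed

lemma small_cut_mono:
  assumes "\<kappa> \<lesssim> \<mu>" "small_cut T \<kappa> p"
  shows "small_cut T \<mu> p"
proof -
  obtain \<U> C where U: "\<forall>U\<in>\<U>. openin T U" "\<U> \<prec> \<kappa>" and C: "closedin T C" "C \<inter> \<Inter>\<U> = {p}"
    using assms(2) unfolding small_cut_def by (elim exE conjE)
  then show ?thesis unfolding small_cut_def using lesspoll_trans2[OF U(2) assms(1)]
    by (intro exI conjI)
qed

lemma small_cut_homeomorphic_map:
  assumes f: "homeomorphic_map T T' f" and cut: "small_cut T \<kappa> p"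
  shows "small_cut T' \<kappa> (f p)"
proof -
  obtain \<U> C where U: "\<forall>U\<in>\<U>. openin T U" "\<U> \<prec> \<kappa>"
    and C: "closedin T C" "C \<inter> \<Inter>\<U> = {p}"
    using cut unfolding small_cut_def by blast
  have inj: "inj_on f (topspace T)" using f by (rule homeomorphic_imp_injective_map)
  have sub: "C \<subseteq> topspace T" "\<And>U. U \<in> \<U> \<Longrightarrow> U \<subseteq> topspace T"
    using C(1) U(1) closedin_subset openin_subset by blast+
  \<comment> \<open>Images commute with this intersection because \<open>f\<close> is injective on
    the space; the factor \<open>C\<close> supplies the preimage even if the family is
    empty.\<close>
  have "f ` C \<inter> \<Inter>((`) f ` \<U>) = f ` (C \<inter> \<Inter>\<U>)"
  proof
    show "f ` C \<inter> \<Inter>((`) f ` \<U>) \<subseteq> f ` (C \<inter> \<Inter>\<U>)"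
    proof
      fix y assume y: "y \<in> f ` C \<inter> \<Inter>((`) f ` \<U>)"
      then obtain x where x: "x \<in> C" "y = f x" by blast
      have "x \<in> U" if "U \<in> \<U>" for U
      proof -
        obtain x' where "x' \<in> U" "y = f x'" using y \<open>U \<in> \<U>\<close> by blast
        then show ?thesis using inj x sub \<open>U \<in> \<U>\<close> by (metis inj_onD subsetD)
      qed
      then show "y \<in> f ` (C \<inter> \<Inter>\<U>)" using x by blast
    qed
  qed blast
  then have "f ` C \<inter> \<Inter>((`) f ` \<U>) = {f p}" using C(2) by simp
  moreover have "\<forall>U\<in>(`) f ` \<U>. openin T' U"
    using U(1) f homeomorphic_imp_open_map unfolding open_map_def by blast
  moreover have "closedin T' (f ` C)"
    using C(1) f homeomorphic_imp_closed_map unfolding closed_map_def by blast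
  moreover have "(`) f ` \<U> \<prec> \<kappa>" by (rule lesspoll_trans1[OF image_lepoll U(2)])
  ultimately show ?thesis unfolding small_cut_def by blast
qed

text \<open>Upwards, a locally closed \<open>Y\<close> costs one further open set and one further
  closed set, and one more open set is harmless below an infinite cardinal.\<close>

lemma small_cut_subtopology:
  assumes Y: "locally_closed_in T Y" and \<kappa>: "infinite \<kappa>" and p: "p \<in> Y"
  shows "small_cut (subtopology T Y) \<kappa> p \<longleftrightarrow> small_cut T \<kappa> p"
proof
  assume "small_cut T \<kappa> p"
  then obtain \<U> C where U: "\<forall>U\<in>\<U>. openin T U" "\<U> \<prec> \<kappa>"
    and C: "closedin T C" "C \<inter> \<Inter>\<U> = {p}"
    unfolding small_cut_def by blast
  show "small_cut (subtopology T Y) \<kappa> p"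
    unfolding small_cut_def
  proof (intro exI conjI)
    show "\<forall>U\<in>(\<lambda>U. U \<inter> Y) ` \<U>. openin (subtopology T Y) U"
      using U(1) unfolding openin_subtopology by blast
    show "(\<lambda>U. U \<inter> Y) ` \<U> \<prec> \<kappa>" by (rule lesspoll_trans1[OF image_lepoll U(2)])
    show "closedin (subtopology T Y) (C \<inter> Y)" using C(1) unfolding closedin_subtopology by blast
    show "(C \<inter> Y) \<inter> \<Inter>((\<lambda>U. U \<inter> Y) ` \<U>) = {p}" using C(2) p by auto
  qed
next
  assume "small_cut (subtopology T Y) \<kappa> p"
  then obtain \<U> C where U: "\<forall>U\<in>\<U>. openin (subtopology T Y) U" "\<U> \<prec> \<kappa>"
    and C: "closedin (subtopology T Y) C" "C \<inter> \<Inter>\<U> = {p}"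
    unfolding small_cut_def by blast
  obtain U0 C0 where 0: "openin T U0" "closedin T C0" "Y = U0 \<inter> C0"
    using Y unfolding locally_closed_in_def by blast
  obtain C' where C': "closedin T C'" "C = C' \<inter> Y"
    using C(1) by (auto simp: closedin_subtopology)
  obtain g where g: "\<And>U. U \<in> \<U> \<Longrightarrow> openin T (g U) \<and> U = g U \<inter> Y"
    using U(1) unfolding openin_subtopology by metis
  show "small_cut T \<kappa> p"
    unfolding small_cut_def
  proof (intro exI conjI)
    show "\<forall>U\<in>insert U0 (g ` \<U>). openin T U" using g 0 by auto
    show "insert U0 (g ` \<U>) \<prec> \<kappa>"
      by (intro lesspoll_insert[OF \<kappa>] lesspoll_trans1[OF image_lepoll U(2)])
    show "closedin T (C' \<inter> C0)" using C' 0 by auto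
    have "Y \<inter> \<Inter>\<U> = Y \<inter> \<Inter>(g ` \<U>)" using g by fast
    then have "(C' \<inter> C0) \<inter> \<Inter>(insert U0 (g ` \<U>)) = C \<inter> \<Inter>\<U>"
      unfolding C'(2) using 0(3) by blast
    then show "(C' \<inter> C0) \<inter> \<Inter>(insert U0 (g ` \<U>)) = {p}" using C(2) by simp
  qed
qed

text \<open>Both properties of a point are cutting conditions, so each can be tested in any piece
  that contains the point; the pieces may overlap.\<close>

lemma small_cut_imp_locally_closed_local:
  assumes \<kappa>: "infinite \<kappa>" and cover: "topspace T = (\<Union>i\<in>I. Y i)"
    and Y: "\<And>i. i \<in> I \<Longrightarrow> locally_closed_in T (Y i)"
    and homeo: "\<And>i. i \<in> I \<Longrightarrow> subtopology T (Y i) homeomorphic_space T' i"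
  shows "(\<forall>p\<in>topspace T. small_cut T \<kappa> p \<longrightarrow> locally_closed_in T {p}) \<longleftrightarrow>
    (\<forall>i\<in>I. \<forall>q\<in>topspace (T' i). small_cut (T' i) \<kappa> q \<longrightarrow> locally_closed_in (T' i) {q})"
proof -
  have top: "topspace (subtopology T (Y i)) = Y i" if "i \<in> I" for i
    using cover that by auto
  have piece: "(\<forall>p\<in>Y i. small_cut T \<kappa> p \<longrightarrow> locally_closed_in T {p}) \<longleftrightarrow>
      (\<forall>q\<in>topspace (T' i). small_cut (T' i) \<kappa> q \<longrightarrow> locally_closed_in (T' i) {q})"
    if i: "i \<in> I" for i
  proof -
    obtain f where f: "homeomorphic_map (subtopology T (Y i)) (T' i) f"
      using homeo[OF i] homeomorphic_space by blast
    then obtain g where fg: "homeomorphic_maps (subtopology T (Y i)) (T' i) f g"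
      using homeomorphic_map_maps by blast
    then have g: "homeomorphic_map (T' i) (subtopology T (Y i)) g"
      by (simp add: homeomorphic_maps_map)
    have gf: "\<And>p. p \<in> Y i \<Longrightarrow> g (f p) = p"
      using fg unfolding homeomorphic_maps_def top[OF i] by blast
    have surj: "topspace (T' i) = f ` Y i"
      using homeomorphic_imp_surjective_map[OF f] top[OF i] by simp
    have eq': "small_cut (T' i) \<kappa> (f p) \<longleftrightarrow> small_cut T \<kappa> p"
      if p: "p \<in> Y i" for p
      using small_cut_homeomorphic_map[OF f, of \<kappa> p] small_cut_homeomorphic_map[OF g, of \<kappa> "f p"]
        small_cut_subtopology[OF Y[OF i] \<kappa> p] gf[OF p] by auto
    have eq'': "small_cut (T' i) (UNIV :: nat set) (f p) \<longleftrightarrow> small_cut T (UNIV :: nat set) p"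
      if p: "p \<in> Y i" for p
      using small_cut_homeomorphic_map[OF f, of "UNIV :: nat set" p]
        small_cut_homeomorphic_map[OF g, of "UNIV :: nat set" "f p"]
        small_cut_subtopology[OF Y[OF i] infinite_UNIV_nat p] gf[OF p] by auto
    have "(\<forall>p\<in>Y i. small_cut T \<kappa> p \<longrightarrow> locally_closed_in T {p}) \<longleftrightarrow>
      (\<forall>p\<in>Y i. small_cut (T' i) \<kappa> (f p) \<longrightarrow> locally_closed_in (T' i) {f p})"
      unfolding locally_closed_in_iff_small_cut using eq' eq'' by (intro ball_cong) simp_all
    then show ?thesis unfolding surj by blast
  qed
  show ?thesis unfolding cover UN_iff ball_UN using piece by (rule ball_cong[OF refl])
qed


section \<open>Differential prime ideals\<close>

context cring
begin

lemma colon_ideal: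
  assumes "ideal J R" "x \<in> carrier R"
  shows "ideal {y \<in> carrier R. x \<otimes> y \<in> J} R"
proof -
  interpret J: ideal J R by fact
  have x: "x \<in> carrier R" by fact
  show ?thesis
  proof (rule idealI)
    show "ring R" by (rule ring_axioms)
    show "subgroup {y \<in> carrier R. x \<otimes> y \<in> J} (add_monoid R)"
    proof (rule subgroup.intro)
      show "inv\<^bsub>add_monoid R\<^esub> y \<in> {y \<in> carrier R. x \<otimes> y \<in> J}"
        if "y \<in> {y \<in> carrier R. x \<otimes> y \<in> J}" for y
        using that x by (simp add: a_inv_def[symmetric] r_minus)
    qed (use x in \<open>auto simp: r_distr J.zero_closed\<close>)
    fix a y assume a: "a \<in> {y \<in> carrier R. x \<otimes> y \<in> J}" and y: "y \<in> carrier R"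
    have "x \<otimes> (y \<otimes> a) = y \<otimes> (x \<otimes> a)" using a x y by (simp add: m_lcomm)
    moreover have "x \<otimes> (a \<otimes> y) = y \<otimes> (x \<otimes> a)" using a x y by (simp add: m_ac)
    moreover have "y \<otimes> (x \<otimes> a) \<in> J" using a x y by (simp add: J.I_l_closed)
    ultimately show "y \<otimes> a \<in> {y \<in> carrier R. x \<otimes> y \<in> J}" "a \<otimes> y \<in> {y \<in> carrier R. x \<otimes> y \<in> J}"
      using a y by simp_all
  qed
qed

text \<open>Elements of the generated ideals are not written out: one factor at a time is confined
  to a colon ideal of \<open>J\<close>, first that of \<open>b\<close>, then that of each element of
  the other factor.\<close>

lemma prod_genideal_insert_subset:
  assumes J: "ideal J R" and a: "a \<in> carrier R" and b: "b \<in> carrier R" and "a \<otimes> b \<in> J"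
  shows "(Idl (insert a J)) \<cdot> (Idl (insert b J)) \<subseteq> J"
proof -
  interpret J: ideal J R by fact
  have sub: "insert a J \<subseteq> carrier R" "insert b J \<subseteq> carrier R" using a b J.a_subset by auto
  have "insert a J \<subseteq> {x \<in> carrier R. b \<otimes> x \<in> J}"
    using assms J.I_l_closed by (auto simp: m_comm J.Icarr)
  then have A: "Idl (insert a J) \<subseteq> {x \<in> carrier R. b \<otimes> x \<in> J}"
    by (intro genideal_minimal colon_ideal J b)
  have xy: "x \<otimes> y \<in> J" if x: "x \<in> Idl (insert a J)" and y: "y \<in> Idl (insert b J)" for x y
  proof -
    have xc: "x \<in> carrier R" "b \<otimes> x \<in> J" using x A by auto
    then have "insert b J \<subseteq> {y \<in> carrier R. x \<otimes> y \<in> J}"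
      using b J.I_l_closed J.Icarr by (auto simp: m_comm)
    then have "Idl (insert b J) \<subseteq> {y \<in> carrier R. x \<otimes> y \<in> J}"
      by (intro genideal_minimal colon_ideal J xc)
    then show ?thesis using y by auto
  qed
  show ?thesis
  proof
    fix s assume "s \<in> (Idl (insert a J)) \<cdot> (Idl (insert b J))"
    then show "s \<in> J" by (induct s rule: ideal_prod.induct) (auto simp: xy)
  qed
qed

lemma mem_genideal_insert:
  assumes M: "ideal M R" and x: "x \<in> carrier R" and s: "s \<in> Idl (insert x M)"
  shows "\<exists>r\<in>carrier R. \<exists>m\<in>M. m \<oplus> r \<otimes> x = s"
proof -
  interpret M: ideal M R by fact
  have "insert x M \<subseteq> M <+> PIdl x"
  proof
    fix y assume y: "y \<in> insert x M"
    have P: "x \<in> PIdl x" "\<zero> \<in> PIdl x"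
      using cgenideal_self[OF x]
        additive_subgroup.zero_closed[OF ideal.axioms(1)[OF cgenideal_ideal[OF x]]] .
    have "\<zero> \<oplus> x \<in> M <+> PIdl x" "y \<in> M \<Longrightarrow> y \<oplus> \<zero> \<in> M <+> PIdl x"
      using P M.zero_closed unfolding set_add_def' by blast+
    then show "y \<in> M <+> PIdl x" using y x M.Icarr by fastforce
  qed
  then have "Idl (insert x M) \<subseteq> M <+> PIdl x"
    by (intro genideal_minimal add_ideals M cgenideal_ideal x)
  then show ?thesis using s unfolding set_add_def' cgenideal_def by blast
qed

lemma derivation_zero: "d \<in> derivations R \<Longrightarrow> d \<zero> = \<zero>"
  using derivationsD(2)[of d R \<zero> \<zero>] derivationsD(1)[of d R \<zero>] by (simp add: add.l_cancel_one')

lemma derivation_one: "d \<in> derivations R \<Longrightarrow> d \<one> = \<zero>"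
  using derivationsD(3)[of d R \<one> \<one>] derivationsD(1)[of d R \<one>] by (simp add: add.l_cancel_one')

lemma derivation_minus: "d \<in> derivations R \<Longrightarrow> x \<in> carrier R \<Longrightarrow> d (\<ominus> x) = \<ominus> d x"
  using derivationsD(2)[of d R x "\<ominus> x"] derivationsD(1)[of d R] derivation_zero[of d]
  by (metis a_comm a_inv_closed minus_equality r_neg)

end

lemma (in primeideal) pow_memD:
  "x \<in> carrier R \<Longrightarrow> x [^] (n::nat) \<in> I \<Longrightarrow> x \<in> I"
proof (induct n)
  case 0
  then show ?case using I_notcarr one_imp_carrier by simp
next
  case (Suc n)
  then show ?case using I_prime[of "x [^] n" x] by auto
qed

section \<open>Differential ideals in characteristic zero\<close>

locale char_zero_differential_algebra = cring R for R :: "('k, 'a, 'n) module_scheme" (structure) +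
  fixes K :: "('k, 'm) ring_scheme" and \<Delta> :: "('a \<Rightarrow> 'a) set"
  assumes differential_algebra: "differential_algebra K R \<Delta>"
    and char_zero: "char_zero_field K"
begin

lemma field_K: "field K"
  using char_zero by (simp add: char_zero_field_def)

sublocale K: field K by (rule field_K)

sublocale module K R
  using differential_algebra by (simp add: differential_algebra_def algebra_def)

lemma smult_assoc2:
  "c \<in> carrier K \<Longrightarrow> x \<in> carrier R \<Longrightarrow> y \<in> carrier R \<Longrightarrow> (c \<odot>\<^bsub>R\<^esub> x) \<otimes> y = c \<odot>\<^bsub>R\<^esub> (x \<otimes> y)"
  using differential_algebra
  by (simp add: differential_algebra_def algebra_def algebra_axioms_def)

lemma DeltaD:
  assumes "\<delta> \<in> \<Delta>"
  shows "\<delta> \<in> derivations R"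
    and "x \<in> carrier R \<Longrightarrow> \<delta> x \<in> carrier R"
    and "x \<in> carrier R \<Longrightarrow> y \<in> carrier R \<Longrightarrow> \<delta> (x \<oplus> y) = \<delta> x \<oplus> \<delta> y"
    and "x \<in> carrier R \<Longrightarrow> y \<in> carrier R \<Longrightarrow> \<delta> (x \<otimes> y) = (x \<otimes> \<delta> y) \<oplus> (\<delta> x \<otimes> y)"
    and "c \<in> carrier K \<Longrightarrow> x \<in> carrier R \<Longrightarrow> \<delta> (c \<odot>\<^bsub>R\<^esub> x) = c \<odot>\<^bsub>R\<^esub> \<delta> x"
proof -
  have "\<delta> \<in> Der K R" using differential_algebra.derivations[OF differential_algebra] assms by blast
  then show der: "\<delta> \<in> derivations R"
    and "c \<in> carrier K \<Longrightarrow> x \<in> carrier R \<Longrightarrow> \<delta> (c \<odot>\<^bsub>R\<^esub> x) = c \<odot>\<^bsub>R\<^esub> \<delta> x"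
    by (simp_all add: Der_def)
  show "x \<in> carrier R \<Longrightarrow> \<delta> x \<in> carrier R"
    "x \<in> carrier R \<Longrightarrow> y \<in> carrier R \<Longrightarrow> \<delta> (x \<oplus> y) = \<delta> x \<oplus> \<delta> y"
    "x \<in> carrier R \<Longrightarrow> y \<in> carrier R \<Longrightarrow> \<delta> (x \<otimes> y) = (x \<otimes> \<delta> y) \<oplus> (\<delta> x \<otimes> y)"
    by (rule derivationsD[OF der]; assumption)+
qed

lemmas Delta_zero = derivation_zero[OF DeltaD(1)]
lemmas Delta_one = derivation_one[OF DeltaD(1)]
lemmas Delta_minus = derivation_minus[OF DeltaD(1)]
lemmas delta_core = delta_core_greatest[OF differential_algebra]

text \<open>Replacing the action of \<open>K\<close> by multiplication with elements of
  \<open>R\<close> lets ring homomorphisms out of \<open>R\<close> carry the base field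
  along.\<close>

definition scalar :: "'k \<Rightarrow> 'a" where "scalar c = c \<odot>\<^bsub>R\<^esub> \<one>"

lemma scalar_closed [simp]: "c \<in> carrier K \<Longrightarrow> scalar c \<in> carrier R"
  by (simp add: scalar_def)

lemma scalar_mult: "c \<in> carrier K \<Longrightarrow> x \<in> carrier R \<Longrightarrow> scalar c \<otimes> x = c \<odot>\<^bsub>R\<^esub> x"
  by (simp add: scalar_def smult_assoc2)

lemma scalar_hom: "ring_hom_cring K R scalar"
proof -
  have "scalar (x \<otimes>\<^bsub>K\<^esub> y) = scalar x \<otimes> scalar y" if "x \<in> carrier K" "y \<in> carrier K" for x y
    using that by (simp add: scalar_mult) (simp add: scalar_def smult_assoc1)
  moreover have "scalar (x \<oplus>\<^bsub>K\<^esub> y) = scalar x \<oplus> scalar y" if "x \<in> carrier K" "y \<in> carrier K" for x y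
    using that by (simp add: scalar_def smult_l_distr)
  ultimately have "scalar \<in> ring_hom K R"
    by (intro ring_hom_memI) (auto simp: scalar_def)
  then show ?thesis
    by (simp add: ring_hom_cring_def ring_hom_cring_axioms_def K.cring_axioms cring_axioms)
qed

sublocale scalar: ring_hom_cring K R scalar by (rule scalar_hom)

lemma Delta_scalar: "\<delta> \<in> \<Delta> \<Longrightarrow> c \<in> carrier K \<Longrightarrow> \<delta> (scalar c) = \<zero>"
  by (simp add: scalar_def DeltaD(5) Delta_one)

lemma scalar_nat: "scalar ([n] \<cdot>\<^bsub>K\<^esub> \<one>\<^bsub>K\<^esub>) = [n] \<cdot> \<one>" for n :: nat
  by (induct n) simp_all

text \<open>A positive integer is a unit of \<open>K\<close>, and its inverse acts on ideals.
  Characteristic zero enters the theory of differential ideals here.\<close>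

lemma nat_mult_mem_ideal:
  fixes n :: nat
  assumes "ideal J R" "x \<in> carrier R" "[n] \<cdot> x \<in> J" "n > 0"
  shows "x \<in> J"
proof -
  interpret J: ideal J R by fact
  let ?n = "[n] \<cdot>\<^bsub>K\<^esub> \<one>\<^bsub>K\<^esub>"
  have n: "?n \<in> carrier K" "?n \<noteq> \<zero>\<^bsub>K\<^esub>"
    using char_zero assms(4) by (auto simp: char_zero_field_def)
  then have u: "?n \<in> Units K" by (simp add: K.field_Units)
  have e: "scalar ?n \<otimes> x = [n] \<cdot> x"
    unfolding scalar_nat using assms(2) by (simp add: add_pow_ldistr)
  have "x = scalar (inv\<^bsub>K\<^esub> ?n \<otimes>\<^bsub>K\<^esub> ?n) \<otimes> x" using u assms(2) by simp
  also have "\<dots> = scalar (inv\<^bsub>K\<^esub> ?n) \<otimes> (scalar ?n \<otimes> x)"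
    using u n assms(2) by (simp only: scalar.hom_mult K.Units_inv_closed m_assoc scalar_closed)
  also have "\<dots> \<in> J" unfolding e using assms(3) u by (intro J.I_l_closed) auto
  finally show ?thesis .
qed

text \<open>The elements of \<open>Idl S\<close> whose derivative stays in \<open>Idl S\<close> form
  an ideal, so the generators decide.\<close>

lemma delta_ideal_genideal:
  assumes S: "S \<subseteq> carrier R" and d: "\<And>\<delta> x. \<delta> \<in> \<Delta> \<Longrightarrow> x \<in> S \<Longrightarrow> \<delta> x \<in> Idl S"
  shows "delta_ideal R \<Delta> (Idl S)"
proof -
  interpret G: ideal "Idl S" R by (rule genideal_ideal[OF S])
  have "\<delta> ` (Idl S) \<subseteq> Idl S" if \<delta>: "\<delta> \<in> \<Delta>" for \<delta>
  proof -
    note [simp] = DeltaD(2)[OF \<delta>]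
    let ?H = "{x \<in> Idl S. \<delta> x \<in> Idl S}"
    have "ideal ?H R"
    proof (rule idealI)
      show "ring R" by (rule ring_axioms)
      show "subgroup ?H (add_monoid R)"
      proof (rule subgroup.intro)
        show "inv\<^bsub>add_monoid R\<^esub> y \<in> ?H" if "y \<in> ?H" for y
          using that by (simp add: a_inv_def[symmetric] Delta_minus[OF \<delta>] G.Icarr)
      qed (auto simp: G.Icarr DeltaD(3)[OF \<delta>] Delta_zero[OF \<delta>] G.zero_closed)
      fix a x assume "a \<in> ?H" "x \<in> carrier R"
      then show "x \<otimes> a \<in> ?H" "a \<otimes> x \<in> ?H"
        by (simp_all add: DeltaD(4)[OF \<delta>] G.Icarr G.I_l_closed G.I_r_closed)
    qed
    moreover have "S \<subseteq> ?H" using d[OF \<delta>] genideal_self[OF S] by blast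
    ultimately have "Idl S \<subseteq> ?H" by (rule genideal_minimal)
    then show ?thesis by blast
  qed
  then show ?thesis using G.ideal_axioms by (simp add: delta_ideal_def)
qed

lemma delta_ideal_prod:
  assumes I: "delta_ideal R \<Delta> I" and J: "delta_ideal R \<Delta> J"
  shows "delta_ideal R \<Delta> (I \<cdot> J)"
proof -
  interpret I: ideal I R using I by (simp add: delta_ideal_def)
  interpret J: ideal J R using J by (simp add: delta_ideal_def)
  have eq: "I \<cdot> J = Idl (I <#> J)"
    by (rule ideal_prod_eq_genideal[OF I.ideal_axioms J.ideal_axioms])
  show ?thesis unfolding eq
  proof (rule delta_ideal_genideal)
    show "I <#> J \<subseteq> carrier R" by (rule set_mult_closed[OF I.a_subset J.a_subset])
    fix \<delta> x assume \<delta>: "\<delta> \<in> \<Delta>" and "x \<in> I <#> J"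
    then obtain i j where ij: "i \<in> I" "j \<in> J" "x = i \<otimes> j" by (auto simp: set_mult_def)
    have "\<delta> i \<in> I" "\<delta> j \<in> J" using I J \<delta> ij unfolding delta_ideal_def by blast+
    then have "i \<otimes> \<delta> j \<oplus> \<delta> i \<otimes> j \<in> I \<cdot> J"
      using ij by (intro ideal_prod.sum ideal_prod.prod)
    then show "\<delta> x \<in> Idl (I <#> J)"
      using ij by (simp add: DeltaD(4)[OF \<delta>] I.Icarr J.Icarr eq)
  qed
qed

lemma Delta_pow:
  assumes "\<delta> \<in> \<Delta>" "a \<in> carrier R"
  shows "\<delta> (a [^] Suc n) = [Suc n] \<cdot> (a [^] n \<otimes> \<delta> a)"
proof (induct n)
  case 0
  then show ?case using assms DeltaD(2) by simp
next
  case (Suc n)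
  have [simp]: "\<delta> a \<in> carrier R" using assms DeltaD(2) by simp
  have "\<delta> (a [^] Suc (Suc n)) = \<delta> (a [^] Suc n \<otimes> a)" by simp
  also have "\<dots> = a [^] Suc n \<otimes> \<delta> a \<oplus> ([Suc n] \<cdot> (a [^] n \<otimes> \<delta> a)) \<otimes> a"
    using assms by (simp only: DeltaD(4) nat_pow_closed Suc nat_pow_Suc[of a "Suc n"])
  also have "([Suc n] \<cdot> (a [^] n \<otimes> \<delta> a)) \<otimes> a = [Suc n] \<cdot> (a [^] n \<otimes> \<delta> a \<otimes> a)"
    using assms by (intro add_pow_ldistr) auto
  also have "a [^] n \<otimes> \<delta> a \<otimes> a = a [^] Suc n \<otimes> \<delta> a"
    using assms by (simp add: m_ac)
  also have "a [^] Suc n \<otimes> \<delta> a \<oplus> [Suc n] \<cdot> (a [^] Suc n \<otimes> \<delta> a) = [Suc (Suc n)] \<cdot> (a [^] Suc n \<otimes> \<delta> a)"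
    using assms by (simp add: a_ac)
  finally show ?case .
qed

text \<open>Differentiation loses one factor \<open>b\<close> and the multiplication by
  \<open>b\<close> restores it; no exponent \<open>j - 1\<close> has to be written.\<close>

lemma mult_Delta_pow:
  assumes \<delta>: "\<delta> \<in> \<Delta>" and b: "b \<in> carrier R"
  shows "\<exists>c\<in>carrier R. b \<otimes> \<delta> (b [^] j) = b [^] (j::nat) \<otimes> c"
proof (cases j)
  case 0
  then show ?thesis using assms by (auto simp: Delta_one intro!: bexI[of _ \<zero>])
next
  case (Suc n)
  have "b \<otimes> ([Suc n] \<cdot> (b [^] n \<otimes> \<delta> b)) = b [^] Suc n \<otimes> ([Suc n] \<cdot> \<delta> b)"
    using assms DeltaD(2)[OF \<delta> b]
    by (simp only: add_pow_rdistr[symmetric] m_closed nat_pow_closed) (simp add: m_ac del: add.nat_pow_Suc)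
  then show ?thesis unfolding Suc Delta_pow[OF assms] using assms DeltaD(2) by blast
qed

text \<open>Each differentiation trades one factor \<open>a\<close> for two factors
  \<open>\<delta> a\<close>. Apply \<delta> to
  \<open>a [^] Suc m \<otimes> \<delta> a [^] (2 * k)\<close> and multiply by
  \<open>\<delta> a\<close>: one summand is again a multiple of the given element of
  \<open>P\<close>, the other is \<open>Suc m\<close> times the desired one. For
  \<open>m = 0\<close> it follows that derivatives of elements nilpotent modulo \<open>P\<close> are
  nilpotent modulo \<open>P\<close>.\<close>

lemma Delta_nilpotent:
  assumes P: "delta_ideal R \<Delta> P" and \<delta>: "\<delta> \<in> \<Delta>" and a: "a \<in> carrier R"
  shows "a [^] (m + k) \<in> P \<Longrightarrow> a [^] m \<otimes> \<delta> a [^] (2 * k :: nat) \<in> P"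
proof (induct k arbitrary: m)
  case 0
  then show ?case using a by simp
next
  case (Suc k)
  interpret P: ideal P R using P by (simp add: delta_ideal_def)
  let ?b = "\<delta> a"
  let ?B = "?b [^] (2 * k)"
  have b: "?b \<in> carrier R" using \<delta> a by (rule DeltaD)
  have B: "?B \<in> carrier R" "\<delta> ?B \<in> carrier R" using b DeltaD(2)[OF \<delta>] by auto
  have "a [^] Suc m \<otimes> ?B \<in> P" using Suc(1)[of "Suc m"] Suc(2) by simp
  then have "?b \<otimes> \<delta> (a [^] Suc m \<otimes> ?B) \<in> P"
    using P \<delta> b by (intro P.I_l_closed) (auto simp: delta_ideal_def)
  also have "?b \<otimes> \<delta> (a [^] Suc m \<otimes> ?B) =
      a [^] Suc m \<otimes> (?b \<otimes> \<delta> ?B) \<oplus> [Suc m] \<cdot> (a [^] m \<otimes> ?b [^] (2 * Suc k))"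
  proof -
    have "\<delta> (a [^] Suc m \<otimes> ?B) = a [^] Suc m \<otimes> \<delta> ?B \<oplus> [Suc m] \<cdot> (a [^] m \<otimes> ?b) \<otimes> ?B"
      using a B by (simp only: DeltaD(4)[OF \<delta>] nat_pow_closed Delta_pow[OF \<delta> a])
    moreover have "?b \<otimes> (a [^] Suc m \<otimes> \<delta> ?B) = a [^] Suc m \<otimes> (?b \<otimes> \<delta> ?B)"
      using a b B by (intro m_lcomm) auto
    moreover have "?b \<otimes> ([Suc m] \<cdot> (a [^] m \<otimes> ?b) \<otimes> ?B) = [Suc m] \<cdot> (?b \<otimes> (a [^] m \<otimes> ?b \<otimes> ?B))"
      using a b B by (simp only: add_pow_ldistr add_pow_rdistr m_closed nat_pow_closed)
    moreover have "?b \<otimes> (a [^] m \<otimes> ?b \<otimes> ?B) = a [^] m \<otimes> ?b [^] (2 * Suc k)"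
      using a b B by (simp add: m_ac)
    ultimately show ?thesis using a b B by (simp add: r_distr del: add.nat_pow_Suc nat_pow_Suc)
  qed
  finally have s: "a [^] Suc m \<otimes> (?b \<otimes> \<delta> ?B) \<oplus> [Suc m] \<cdot> (a [^] m \<otimes> ?b [^] (2 * Suc k)) \<in> P" .
  obtain c where c: "c \<in> carrier R" "?b \<otimes> \<delta> ?B = ?B \<otimes> c" using mult_Delta_pow[OF \<delta> b] by blast
  have t: "a [^] Suc m \<otimes> (?b \<otimes> \<delta> ?B) \<in> P"
    unfolding c(2) using P.I_r_closed[OF \<open>a [^] Suc m \<otimes> ?B \<in> P\<close> c(1)] a B c
    by (simp add: m_assoc del: nat_pow_Suc)
  let ?z = "[Suc m] \<cdot> (a [^] m \<otimes> ?b [^] (2 * Suc k))"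
  have z: "?z \<in> carrier R" using a b by simp
  have "?z = \<ominus> (a [^] Suc m \<otimes> (?b \<otimes> \<delta> ?B)) \<oplus> (a [^] Suc m \<otimes> (?b \<otimes> \<delta> ?B) \<oplus> ?z)"
    using z P.Icarr[OF t] by (simp only: r_neg1)
  then have "?z \<in> P" using P.a_closed[OF P.a_inv_closed[OF t] s] by simp
  then show ?case using nat_mult_mem_ideal[OF P.ideal_axioms, of "a [^] m \<otimes> ?b [^] (2 * Suc k)" "Suc m"] a b
    by simp
qed

text \<open>The elements with a power in the core lie in the prime \<open>M\<close>, and their
  derivatives are of the same kind. Hence they generate a differential ideal inside
  \<open>M\<close>, which the core must contain.\<close>

lemma delta_core_radical:
  assumes M: "primeideal M R" and a: "a \<in> carrier R" "a [^] (n::nat) \<in> delta_core R \<Delta> M"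
  shows "a \<in> delta_core R \<Delta> M"
proof -
  interpret M: primeideal M R by fact
  let ?P = "delta_core R \<Delta> M"
  note core = delta_core[OF M.ideal_axioms]
  let ?T = "{a \<in> carrier R. \<exists>n::nat. a [^] n \<in> ?P}"
  have "?T \<subseteq> M" using core(2) M.pow_memD by blast
  then have TM: "Idl ?T \<subseteq> M" by (rule genideal_minimal[OF M.ideal_axioms])
  have "delta_ideal R \<Delta> (Idl ?T)"
  proof (rule delta_ideal_genideal)
    fix \<delta> x assume \<delta>: "\<delta> \<in> \<Delta>" and "x \<in> ?T"
    then obtain n where x: "x \<in> carrier R" "x [^] (n::nat) \<in> ?P" by blast
    then have "\<delta> x [^] (2 * n) \<in> ?P"
      using Delta_nilpotent[OF core(1) \<delta> x(1), of 0 n] DeltaD(2)[OF \<delta> x(1)] by simp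
    then have "\<delta> x \<in> ?T" using DeltaD(2)[OF \<delta> x(1)] by blast
    then show "\<delta> x \<in> Idl ?T" using genideal_self[of ?T] by blast
  qed blast
  then have "Idl ?T \<subseteq> ?P" by (rule core(3)[OF _ TM])
  moreover have "a \<in> Idl ?T" using a genideal_self[of ?T] by blast
  ultimately show ?thesis by blast
qed

text \<open>Multiplying \<open>\<delta> (a \<otimes> x)\<close> by
  \<open>a \<otimes> \<delta> x\<close> gives the square of \<open>a \<otimes> \<delta> x\<close>
  plus a multiple of \<open>a \<otimes> x\<close>. So the square lies in \<open>P\<close>, and
  radicality removes it.\<close>

lemma delta_ideal_colon:
  assumes P: "delta_ideal R \<Delta> P" and rad: "\<And>a n. a \<in> carrier R \<Longrightarrow> a [^] (n::nat) \<in> P \<Longrightarrow> a \<in> P"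
    and a: "a \<in> carrier R"
  shows "delta_ideal R \<Delta> {x \<in> carrier R. a \<otimes> x \<in> P}"
proof -
  interpret P: ideal P R using P by (simp add: delta_ideal_def)
  have "a \<otimes> \<delta> x \<in> P" if \<delta>: "\<delta> \<in> \<Delta>" and x: "x \<in> carrier R" "a \<otimes> x \<in> P" for \<delta> x
  proof -
    note [simp] = DeltaD(2)[OF \<delta>]
    let ?u = "a \<otimes> \<delta> x"
    have "\<delta> (a \<otimes> x) \<in> P" using P \<delta> x by (auto simp: delta_ideal_def)
    then have "?u \<otimes> (?u \<oplus> \<delta> a \<otimes> x) \<in> P"
      using a x by (intro P.I_l_closed) (auto simp: DeltaD(4)[OF \<delta>])
    then have s: "?u \<otimes> ?u \<oplus> (\<delta> a \<otimes> \<delta> x) \<otimes> (a \<otimes> x) \<in> P"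
      using a x by (simp add: r_distr m_ac)
    have t: "(\<delta> a \<otimes> \<delta> x) \<otimes> (a \<otimes> x) \<in> P" using a x by (simp add: P.I_l_closed)
    have "?u \<otimes> ?u = (?u \<otimes> ?u \<oplus> (\<delta> a \<otimes> \<delta> x) \<otimes> (a \<otimes> x)) \<ominus> (\<delta> a \<otimes> \<delta> x) \<otimes> (a \<otimes> x)"
      using a x by (simp add: minus_eq a_assoc r_neg)
    also have "\<dots> \<in> P" using P.a_closed[OF s P.a_inv_closed[OF t]] by (simp add: minus_eq)
    finally show ?thesis using rad[of ?u 2] a x by (simp add: numeral_2_eq_2)
  qed
  then show ?thesis
    using colon_ideal[OF P.ideal_axioms a] DeltaD(2) by (auto simp: delta_ideal_def)
qed

lemma delta_ideal_Inter:
  assumes "\<S> \<noteq> {}" "\<And>I. I \<in> \<S> \<Longrightarrow> delta_ideal R \<Delta> I"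
  shows "delta_ideal R \<Delta> (\<Inter>\<S>)"
  using assms i_Intersect[of \<S>] unfolding delta_ideal_def by blast

text \<open>A double annihilator argument: modulo the core let \<open>J\<close> annihilate
  \<open>a\<close> and let \<open>J'\<close> annihilate \<open>J\<close>. Both are differential
  ideals and their product lies in \<open>M\<close>, so one of them lies in \<open>M\<close> and
  hence in the core; \<open>b\<close> belongs to \<open>J\<close> and \<open>a\<close> to
  \<open>J'\<close>.\<close>

theorem delta_core_prime:
  assumes M: "primeideal M R"
  shows "primeideal (delta_core R \<Delta> M) R"
proof -
  interpret M: primeideal M R by fact
  let ?P = "delta_core R \<Delta> M"
  note core = delta_core[OF M.ideal_axioms]
  have colon: "delta_ideal R \<Delta> {x \<in> carrier R. a \<otimes> x \<in> ?P}" if "a \<in> carrier R" for a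
    using delta_ideal_colon[OF core(1) _ that] delta_core_radical[OF M] by blast
  interpret P: ideal ?P R using core(1) by (simp add: delta_ideal_def)
  show ?thesis
  proof (rule primeidealI)
    show "carrier R \<noteq> ?P" using core(2) M.I_notcarr M.a_subset by blast
    fix a b assume ab: "a \<in> carrier R" "b \<in> carrier R" "a \<otimes> b \<in> ?P"
    let ?J = "{x \<in> carrier R. a \<otimes> x \<in> ?P}"
    let ?J' = "\<Inter>y\<in>?J. {x \<in> carrier R. y \<otimes> x \<in> ?P}"
    have b: "b \<in> ?J" using ab by blast
    have J: "delta_ideal R \<Delta> ?J" using colon ab(1) by blast
    have J': "delta_ideal R \<Delta> ?J'" using b by (intro delta_ideal_Inter) (auto intro: colon)
    have "?J \<subseteq> M \<or> ?J' \<subseteq> M"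
    proof (rule ccontr)
      assume "\<not> ?thesis"
      then obtain y x where "y \<in> ?J" "y \<notin> M" "x \<in> ?J'" "x \<notin> M" by blast
      then show False using M.I_prime[of y x] core(2) by blast
    qed
    then have "?J \<subseteq> ?P \<or> ?J' \<subseteq> ?P" using core(3) J J' by blast
    moreover have "a \<in> ?J'" using ab by (auto simp: m_comm)
    ultimately show "a \<in> ?P \<or> b \<in> ?P" using b by blast
  qed (rule P.ideal_axioms, rule cring_axioms)
qed

lemma delta_prime_if_prime:
  assumes P: "delta_ideal R \<Delta> P" and "primeideal P R"
  shows "delta_prime R \<Delta> P"
  unfolding delta_prime_def
proof (intro conjI allI impI)
  interpret P: primeideal P R by fact
  show "P \<noteq> carrier R" using P.I_notcarr by blast
  fix I J assume "delta_ideal R \<Delta> I" "delta_ideal R \<Delta> J" "I \<cdot> J \<subseteq> P"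
  then show "I \<subseteq> P \<or> J \<subseteq> P"
  proof -
    have "x \<in> P \<or> y \<in> P" if "x \<in> I" "y \<in> J" for x y
    proof -
      have "x \<otimes> y \<in> P" using that \<open>I \<cdot> J \<subseteq> P\<close> ideal_prod.prod by fast
      then show ?thesis using that \<open>delta_ideal R \<Delta> I\<close> \<open>delta_ideal R \<Delta> J\<close>
        by (intro P.I_prime) (auto simp: delta_ideal_def intro: ideal.Icarr)
    qed
    then show ?thesis by blast
  qed
qed (rule P)

lemma delta_spec_delta_core: "primeideal M R \<Longrightarrow> delta_core R \<Delta> M \<in> delta_spec R \<Delta>"
  unfolding delta_spec_def mem_Collect_eq
  by (intro delta_prime_if_prime delta_core_prime delta_core(1) primeideal.axioms(1))

text \<open>An ideal that is maximal among those whose core lies in a differential prime \<open>P\<close> is prime,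
  so \<open>P\<close> is the core of a prime ideal.\<close>

theorem delta_spec_prime:
  assumes noeth: "noetherian_ring R" and "P \<in> delta_spec R \<Delta>"
  shows "primeideal P R"
proof -
  interpret noetherian_ring R by (rule noeth)
  have P: "delta_prime R \<Delta> P" using assms(2) by (simp add: delta_spec_def)
  have Pd: "delta_ideal R \<Delta> P" and Pn: "P \<noteq> carrier R" using P by (auto simp: delta_prime_def)
  interpret P: ideal P R using Pd by (simp add: delta_ideal_def)
  define \<A> where "\<A> = {J. ideal J R \<and> P \<subseteq> J \<and> delta_core R \<Delta> J \<subseteq> P}"
  have PA: "P \<in> \<A>" using delta_core(2)[OF P.ideal_axioms] P.ideal_axioms by (simp add: \<A>_def)
  have "\<exists>J\<in>\<A>. \<forall>Y\<in>\<A>. J \<subseteq> Y \<longrightarrow> Y = J"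
  proof (rule subset_Zorn)
    fix C assume C: "subset.chain \<A> C"
    show "\<exists>U\<in>\<A>. \<forall>Y\<in>C. Y \<subseteq> U"
    proof (cases "C = {}")
      case True
      then show ?thesis using PA by blast
    next
      case False
      have "subset.chain {I. ideal I R} C" using C unfolding pred_on.chain_def \<A>_def by blast
      \<comment> \<open>The noetherian condition enters here: the union is a member of the chain, so
        the bound on its core needs no argument about cores of unions.\<close>
      then have "\<Union>C \<in> C" by (rule ideal_chain_is_trivial[OF False])
      then have "\<Union>C \<in> \<A>" using C unfolding pred_on.chain_def by blast
      then show ?thesis by (rule bexI[rotated]) blast
    qed
  qed
  then obtain J where J: "ideal J R" "P \<subseteq> J" "delta_core R \<Delta> J \<subseteq> P"
    and max: "\<And>Y. ideal Y R \<Longrightarrow> J \<subseteq> Y \<Longrightarrow> delta_core R \<Delta> Y \<subseteq> P \<Longrightarrow> Y = J" unfolding \<A>_def by auto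
  interpret J: ideal J R by (rule J(1))
  have PJ: "delta_core R \<Delta> J = P" using J delta_core(3)[OF J(1) Pd] by blast
  have "primeideal J R"
  proof (rule primeidealI)
    show "carrier R \<noteq> J"
    proof
      assume "carrier R = J"
      moreover have "delta_ideal R \<Delta> (carrier R)"
        using oneideal DeltaD(2) by (auto simp: delta_ideal_def)
      ultimately show False using delta_core(3)[OF J(1)] J(3) P.a_subset Pn by blast
    qed
    fix a b assume ab: "a \<in> carrier R" "b \<in> carrier R" "a \<otimes> b \<in> J"
    let ?A = "Idl (insert a J)" and ?B = "Idl (insert b J)"
    have sub: "insert a J \<subseteq> carrier R" "insert b J \<subseteq> carrier R" using ab J.a_subset by auto
    note id = genideal_ideal[OF sub(1)] genideal_ideal[OF sub(2)]
    note self = genideal_self[OF sub(1)] genideal_self[OF sub(2)]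
    have "(delta_core R \<Delta> ?A) \<cdot> (delta_core R \<Delta> ?B) \<subseteq> J"
    proof
      fix s assume "s \<in> (delta_core R \<Delta> ?A) \<cdot> (delta_core R \<Delta> ?B)"
      then have "s \<in> ?A \<cdot> ?B"
        by (induct s rule: ideal_prod.induct)
          (use delta_core(2)[OF id(1)] delta_core(2)[OF id(2)] in \<open>blast intro: ideal_prod.intros\<close>)+
      then show "s \<in> J" using prod_genideal_insert_subset[OF J(1) ab] by blast
    qed
    \<comment> \<open>A product of differential ideals is differential, so from \<open>J\<close> it
      drops into the core \<open>P\<close> of \<open>J\<close>, where primeness among differential
      ideals applies.\<close>
    then have "(delta_core R \<Delta> ?A) \<cdot> (delta_core R \<Delta> ?B) \<subseteq> P"
      using delta_core(3)[OF J(1) delta_ideal_prod] delta_core(1) id PJ by blast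
    then have "delta_core R \<Delta> ?A \<subseteq> P \<or> delta_core R \<Delta> ?B \<subseteq> P"
      using P delta_core(1) id unfolding delta_prime_def by blast
    then have "?A = J \<or> ?B = J" using max id self by blast
    then show "a \<in> J \<or> b \<in> J" using self by blast
  qed (rule J.ideal_axioms, rule cring_axioms)
  then show ?thesis using delta_core_prime PJ by metis
qed

end


section \<open>Algebras of small dimension are algebraic\<close>

context "domain"
begin

text \<open>If \<open>r\<^sub>c (t - c) = s\<close> for the \<open>c\<close> in a list, then multiplying a linear combination of the
  \<open>r\<^sub>c\<close> by \<open>\<Prod>\<^sub>c (t - c)\<close> gives \<open>s\<close> times the value at \<open>t\<close> of the polynomial \<open>p\<close> below.\<close>

lemma Lagrange_polynomial:
  assumes k: "subfield k R" and t: "t \<in> carrier R" and s: "s \<in> carrier R"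
    and r: "\<And>c. c \<in> set cs \<Longrightarrow> r c \<in> carrier R \<and> r c \<otimes> (t \<ominus> c) = s"
    and cs: "distinct cs" "set cs \<subseteq> k" and as: "length as = length cs" "set as \<subseteq> k"
  shows "\<exists>p\<in>carrier (k[X]). \<exists>q\<in>carrier (k[X]). (\<forall>c\<in>k - set cs. eval q c \<noteq> \<zero>) \<and>
    eval p t \<otimes> s = combine as (map r cs) \<otimes> eval q t \<and> (set as \<subseteq> {\<zero>} \<or> p \<noteq> [])"
  using as(1) r cs as(2)
proof (induct as cs rule: list_induct2)
  case Nil
  have "[\<one>] \<in> carrier (k[X])" "[] \<in> carrier (k[X])"
    using subfieldE(6)[OF k] subringE(3)[OF subfieldE(1)[OF k]]
    by (auto simp: univ_poly_def polynomial_def)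
  then show ?case using s by (intro bexI[of _ "[]"] bexI[of _ "[\<one>]"]) auto
next
  case (Cons a as c cs)
  note kR = subfieldE(1)[OF k] and kc = subfieldE(3)[OF k]
  interpret U: domain "k[X]" by (rule univ_poly_is_domain[OF kR])
  have hom: "ring_hom_ring (k[X]) R (\<lambda>p. eval p x)" if "x \<in> carrier R" for x
    by (rule eval_ring_hom[OF kR that])
  note ev = ring_hom_memE[OF ring_hom_ring.homh[OF hom]]
  obtain p q where p: "p \<in> carrier (k[X])" and q: "q \<in> carrier (k[X])"
    and q0: "\<And>c. c \<in> k - set cs \<Longrightarrow> eval q c \<noteq> \<zero>"
    and eq: "eval p t \<otimes> s = combine as (map r cs) \<otimes> eval q t"
    and p0: "set as \<subseteq> {\<zero>} \<or> p \<noteq> []"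
    using Cons(2)[OF Cons(3)] Cons(4-6) by auto
  let ?l = "[\<one>, \<ominus> c]"
  have c: "c \<in> k" "c \<in> carrier R" "c \<notin> set cs" and a: "a \<in> k" "a \<in> carrier R"
    using Cons kc by auto
  have l: "?l \<in> carrier (k[X])" "?l \<noteq> []"
    using subringE(2-3,5)[OF kR] c by (auto simp: univ_poly_def polynomial_def)
  have el: "eval ?l x = x \<ominus> c" if "x \<in> carrier R" for x
    using that c by (simp add: minus_eq)
  let ?q = "q \<otimes>\<^bsub>k[X]\<^esub> ?l"
  have q': "?q \<in> carrier (k[X])" using q l by simp
  have eq': "eval ?q x = eval q x \<otimes> (x \<ominus> c)" if "x \<in> carrier R" for x
    using ev(2)[OF that q l(1)] el[OF that] by simp
  have q0': "eval ?q d \<noteq> \<zero>" if d: "d \<in> k - set (c # cs)" for d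
  proof -
    have "d \<in> carrier R" "d \<ominus> c \<noteq> \<zero>" using d kc c by (auto simp: r_right_minus_eq)
    then show ?thesis using q0[of d] d ev(1)[OF \<open>d \<in> carrier R\<close> q] c
      by (simp add: eq' integral_iff)
  qed
  have r: "r c \<in> carrier R" "r c \<otimes> (t \<ominus> c) = s" using Cons(3) by auto
  have tc: "t \<ominus> c \<in> carrier R" using t c by simp
  have et: "eval p t \<in> carrier R" "eval q t \<in> carrier R" using ev(1)[OF t] p q by auto
  have C: "combine as (map r cs) \<in> carrier R"
    using Cons(3,6) kc by (intro combine_in_carrier) auto
  have step: "eval p t \<otimes> (t \<ominus> c) \<otimes> s = combine as (map r cs) \<otimes> eval ?q t"
  proof -
    have "eval p t \<otimes> (t \<ominus> c) \<otimes> s = (eval p t \<otimes> s) \<otimes> (t \<ominus> c)" using et tc s by (simp add: m_ac)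
    then show ?thesis using et tc C by (simp add: eq eq'[OF t] m_assoc)
  qed
  show ?case
  \<comment> \<open>Polynomials are coefficient lists with nonzero head, so \<open>[a]\<close> is a
    constant polynomial only for nonzero \<open>a\<close>.\<close>
  proof (cases "a = \<zero>")
    case True
    let ?p = "p \<otimes>\<^bsub>k[X]\<^esub> ?l"
    have "?p \<in> carrier (k[X])" using p l by simp
    moreover have "eval ?p t \<otimes> s = combine (a # as) (map r (c # cs)) \<otimes> eval ?q t"
      using step ev(2)[OF t p l(1)] el[OF t] True r C by simp
    moreover have "set (a # as) \<subseteq> {\<zero>} \<or> ?p \<noteq> []"
      using p0 True U.integral_iff[OF p l(1)] l(2) by (auto simp: univ_poly_zero)
    ultimately show ?thesis using q' q0' by blast
  next
    case False
    then have ca: "[a] \<in> carrier (k[X])" using a by (auto simp: univ_poly_def polynomial_def)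
    let ?p = "([a] \<otimes>\<^bsub>k[X]\<^esub> q) \<oplus>\<^bsub>k[X]\<^esub> (p \<otimes>\<^bsub>k[X]\<^esub> ?l)"
    have cl: "[a] \<otimes>\<^bsub>k[X]\<^esub> q \<in> carrier (k[X])" "p \<otimes>\<^bsub>k[X]\<^esub> ?l \<in> carrier (k[X])"
      using ca p q l by auto
    have e: "eval ?p x = a \<otimes> eval q x \<oplus> eval p x \<otimes> (x \<ominus> c)" if "x \<in> carrier R" for x
      using ev(3)[OF that cl] ev(2)[OF that ca q] ev(2)[OF that p l(1)] el[OF that] a by simp
    have "a \<otimes> eval q t \<otimes> s = a \<otimes> eval q t \<otimes> (r c \<otimes> (t \<ominus> c))" by (simp only: r)
    also have "\<dots> = (a \<otimes> r c) \<otimes> eval ?q t" using a et r(1) tc by (simp add: eq'[OF t] m_ac)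
    finally have "eval ?p t \<otimes> s = combine (a # as) (map r (c # cs)) \<otimes> eval ?q t"
      using step a et tc s r(1) C q' ev(1)[OF t q'] by (simp add: e[OF t] l_distr)
    \<comment> \<open>At \<open>c\<close> the summand with the factor \<open>X - c\<close> vanishes,
      and the other is \<open>a\<close> times a value of \<open>q\<close> that is nonzero since
      \<open>c\<close> does not occur in \<open>cs\<close>.\<close>
    moreover have "?p \<noteq> []"
    proof
      assume "?p = []"
      then have "a \<otimes> eval q c \<oplus> eval p c \<otimes> (c \<ominus> c) = \<zero>" using e[OF c(2)] by simp
      then have "a \<otimes> eval q c = \<zero>"
        using a c(2) ev(1)[OF c(2) p] ev(1)[OF c(2) q] by (simp add: minus_eq r_neg)
      then show False using False a q0[of c] c ev(1)[OF c(2) q] by (simp add: integral_iff)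
    qed
    ultimately show ?thesis using q' q0' cl by blast
  qed
qed

text \<open>The elements \<open>r c\<close> play the role of \<open>s / (t - c)\<close>. One more of
  them than the dimension of the span satisfies a linear relation, and clearing denominators turns
  it into a polynomial equation for \<open>t\<close>.\<close>

lemma algebraic_if_inverses_in_Span:
  assumes k: "subfield k R" and t: "t \<in> carrier R" and s: "s \<in> carrier R" "s \<noteq> \<zero>"
    and Us: "set Us \<subseteq> carrier R" and G: "infinite G" "G \<subseteq> k"
    and r: "\<And>c. c \<in> G \<Longrightarrow> r c \<in> Span k Us \<and> r c \<otimes> (t \<ominus> c) = s"
  shows "(algebraic over k) t"
proof -
  obtain n where n: "dimension n k (Span k Us)"
    using Span_finite_dimension[OF k Us] by blast
  obtain S where "S \<subseteq> G" "finite S" "card S = Suc n"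
    using infinite_arbitrarily_large[OF G(1)] by metis
  then obtain cs where cs: "set cs \<subseteq> G" "distinct cs" "length cs = Suc n"
    by (metis finite_distinct_list distinct_card)
  have rs: "set (map r cs) \<subseteq> Span k Us" using cs r by auto
  then have rc: "set (map r cs) \<subseteq> carrier R" using Span_in_carrier[OF _ Us] subfieldE(3)[OF k] by blast
  have "dependent k (map r cs)"
    using independent_length_le_dimension[OF k n _ rs] cs(3) by auto
  then obtain as where as: "length as = length (map r cs)" "combine as (map r cs) = \<zero>"
    "set as \<subseteq> k" "set as \<noteq> {\<zero>}"
    using dependent_imp_non_trivial_combine[OF k rc] by blast
  obtain p q where p: "p \<in> carrier (k[X])" and q: "q \<in> carrier (k[X])"
    and e: "eval p t \<otimes> s = combine as (map r cs) \<otimes> eval q t"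
    and ne: "set as \<subseteq> {\<zero>} \<or> p \<noteq> []"
  proof -
    have "r c \<in> carrier R \<and> r c \<otimes> (t \<ominus> c) = s" if "c \<in> set cs" for c
      using that cs(1) r rc by auto
    moreover have "set cs \<subseteq> k" "length as = length cs" using cs(1) G(2) as(1) by auto
    ultimately show thesis
      using Lagrange_polynomial[OF k t s(1), of cs r as] cs(2) as(3) that by blast
  qed
  have ev: "eval p t \<in> carrier R" "eval q t \<in> carrier R"
    using ring_hom_memE(1)[OF eval_is_hom[OF subfieldE(1)[OF k] t]] p q by blast+
  have "eval p t = \<zero>" using e ev s by (simp add: as(2) integral_iff)
  moreover have "p \<noteq> []" using ne as(1,4) cs(3) by (cases as) auto
  ultimately show ?thesis using algebraicI[OF p] by blast
qed

text \<open>\<Sigma> is a set of denominators whose inversion would make the ring a field. For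
  \<open>t\<close> outside \<open>k\<close>, record for every \<open>c\<close> the denominator of
  \<open>1 / (t - c)\<close> and a list of elements of \<open>B\<close> that spans its numerator.
  There are fewer than |k| such records, so infinitely many \<open>c\<close> share one, and these
  inverses lie in a single finite-dimensional space. For finite \<open>B\<close> the ring is itself
  finite-dimensional; the bound on \<Sigma> is demanded only for infinite \<open>B\<close> because
  over a countable \<open>k\<close> the intended \<Sigma> may be as large as
  \<open>k\<close>.\<close>

theorem algebraic_if_small:
  assumes k: "subfield k R" "infinite k" and B: "B \<subseteq> carrier R" "B \<prec> k"
    and span: "\<And>x. x \<in> carrier R \<Longrightarrow> \<exists>Us. set Us \<subseteq> B \<and> x \<in> Span k Us"
    and \<Sigma>: "\<Sigma> \<subseteq> carrier R - {\<zero>}" "infinite B \<Longrightarrow> \<Sigma> \<prec> k"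
    and div: "\<And>x. x \<in> carrier R \<Longrightarrow> x \<noteq> \<zero> \<Longrightarrow> \<exists>r\<in>carrier R. r \<otimes> x \<in> \<Sigma>"
    and t: "t \<in> carrier R"
  shows "(algebraic over k) t"
proof (cases "finite B")
  case True
  then obtain Us where Us: "set Us = B" using finite_list by blast
  have "carrier R \<subseteq> Span k Us"
  proof
    fix x assume "x \<in> carrier R"
    then obtain Vs where Vs: "set Vs \<subseteq> B" "x \<in> Span k Vs" using span by blast
    have "Span k Vs \<subseteq> Span k Us"
      using Vs(1) Us B(1) Span_base_incl[OF k(1), of Us] by (intro mono_Span_subset[OF k(1)]) auto
    then show "x \<in> Span k Us" using Vs(2) by blast
  qed
  then have "Span k Us = carrier R" using Span_in_carrier[OF subfieldE(3)[OF k(1)], of Us] B(1) Us by blast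
  then have "finite_dimension k (carrier R)"
    using Span_finite_dimension[OF k(1), of Us] B(1) Us by simp
  then show ?thesis using finite_dimension_imp_algebraic[OF k(1) carrier_is_subring _ t] by blast
next
  case False
  show ?thesis
  proof (cases "t \<in> k")
    case True
    then show ?thesis using algebraic_self[OF subfieldE(1)[OF k(1)]] by blast
  next
    case tk: False
    have kc: "k \<subseteq> carrier R" by (rule subfieldE(3)[OF k(1)])
    have "\<exists>r\<in>carrier R. r \<otimes> (t \<ominus> c) \<in> \<Sigma>" if "c \<in> k" for c
      using that kc t tk by (intro div) (auto simp: r_right_minus_eq)
    then obtain r where r: "\<And>c. c \<in> k \<Longrightarrow> r c \<in> carrier R \<and> r c \<otimes> (t \<ominus> c) \<in> \<Sigma>" by metis
    obtain U where U: "\<And>c. c \<in> k \<Longrightarrow> set (U c) \<subseteq> B \<and> r c \<in> Span k (U c)"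
    proof -
      have "\<forall>c\<in>k. \<exists>Us. set Us \<subseteq> B \<and> r c \<in> Span k Us" using r span by blast
      then show thesis using that by metis
    qed
    have "\<Sigma> \<times> lists B \<prec> k"
      using lesspoll_Times[OF k(2) \<Sigma>(2)[OF False] lesspoll_lists[OF B(2) False]] .
    moreover have "(\<lambda>c. (r c \<otimes> (t \<ominus> c), U c)) ` k \<subseteq> \<Sigma> \<times> lists B"
      using r U by (auto simp: lists_eq_set)
    ultimately obtain p where p: "p \<in> \<Sigma> \<times> lists B"
      and inf: "infinite {c \<in> k. (r c \<otimes> (t \<ominus> c), U c) = p}"
      using infinite_fibre_lesspoll[OF k(2)] by blast
    obtain s Us where sU: "p = (s, Us)" by (rule prod.exhaust)
    have s: "s \<in> carrier R" "s \<noteq> \<zero>" and Us: "set Us \<subseteq> carrier R"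
      using p \<Sigma>(1) B(1) by (auto simp: sU lists_eq_set)
    show ?thesis
    proof (rule algebraic_if_inverses_in_Span[OF k(1) t s Us inf])
      show "r c \<in> Span k Us \<and> r c \<otimes> (t \<ominus> c) = s"
        if "c \<in> {c \<in> k. (r c \<otimes> (t \<ominus> c), U c) = p}" for c
        using that U[of c] unfolding sU by blast
    qed blast
  qed
qed

lemma algebraic_inverse:
  assumes k: "subfield k R" and t: "t \<in> carrier R" "t \<noteq> \<zero>" "(algebraic over k) t"
  obtains u where "u \<in> simple_extension k t" "u \<in> carrier R" "t \<otimes> u = \<one>"
proof -
  have E: "subfield (simple_extension k t) R"
    using simple_extension_is_subfield[OF k t(1)] t(3) by blast
  have "t \<in> simple_extension k t - {\<zero>}"
    using simple_extension_mem[OF subfieldE(1)[OF k] t(1)] t(2) by blast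
  from subfield_m_inv[OF E this] show thesis using that subfieldE(3)[OF E] by blast
qed

end


lemma (in ring) coset_eq_zero_iff:
  assumes "ideal M R" "x \<in> carrier R"
  shows "M +> x = \<zero>\<^bsub>R Quot M\<^esub> \<longleftrightarrow> x \<in> M"
  using a_rcos_zero[OF assms(1)] ideal.rcos_const_imp_mem[OF assms] by (auto simp: FactRing_def)

section \<open>Maximal ideals from small dimension\<close>

context char_zero_differential_algebra
begin

lemma infinite_K: "infinite (carrier K)"
proof -
  let ?f = "\<lambda>n::nat. [n] \<cdot>\<^bsub>K\<^esub> \<one>\<^bsub>K\<^esub>"
  have ne: "?f m \<noteq> ?f n" if "m < n" for m n
  proof
    assume e: "?f m = ?f n"
    have "?f n = ?f m \<oplus>\<^bsub>K\<^esub> ?f (n - m)"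
      using that by (simp add: K.add.nat_pow_mult)
    then have "?f (n - m) = \<zero>\<^bsub>K\<^esub>" using e by (simp add: K.add.l_cancel_one')
    then show False using char_zero that by (auto simp: char_zero_field_def)
  qed
  have "inj ?f" by (rule linorder_injI) (rule ne)
  moreover have "range ?f \<subseteq> carrier K" by auto
  ultimately show ?thesis using infinite_super range_inj_infinite by blast
qed

lemma scalar_image:
  assumes "ring_hom_ring R S \<psi>" "\<one>\<^bsub>S\<^esub> \<noteq> \<zero>\<^bsub>S\<^esub>"
  shows "inj_on (\<lambda>c. \<psi> (scalar c)) (carrier K)"
    and "subfield ((\<lambda>c. \<psi> (scalar c)) ` carrier K) S"
proof -
  interpret \<psi>: ring_hom_ring R S \<psi> by fact
  have "\<psi> \<circ> scalar \<in> ring_hom K S"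
    using scalar.homh \<psi>.homh by (rule ring_hom_trans)
  then interpret c: ring_hom_ring K S "\<psi> \<circ> scalar"
    by (intro ring_hom_ringI2 K.ring_axioms \<psi>.S.ring_axioms)
  show "inj_on (\<lambda>c. \<psi> (scalar c)) (carrier K)" "subfield ((\<lambda>c. \<psi> (scalar c)) ` carrier K) S"
    using c.img_is_subfield[OF K.carrier_is_subfield assms(2)] by (simp_all add: comp_def)
qed

lemma scalar_image_eqpoll:
  assumes "ring_hom_ring R S \<psi>" "\<one>\<^bsub>S\<^esub> \<noteq> \<zero>\<^bsub>S\<^esub>"
  shows "(\<lambda>c. \<psi> (scalar c)) ` carrier K \<approx> carrier K"
  using scalar_image(1)[OF assms] by (rule inj_on_image_eqpoll_self)

lemma dim_less_card_field_imp_generators: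
  assumes "dim_less_card_field K R"
  obtains B where "B \<subseteq> carrier R" "B \<prec> carrier K" "\<And>x. x \<in> carrier R \<Longrightarrow> x \<in> span B"
proof -
  interpret V: vectorspace K R ..
  obtain B where "V.basis B" "B \<prec> carrier K"
    using assms by (auto simp: dim_less_card_field_def)
  then show thesis using that unfolding V.basis_def by blast
qed

text \<open>Passes from combinations over \<open>K\<close> supported on a finite set to spans of
  lists over a subfield of the target, the form in which finite dimension and algebraicity are
  expressed.\<close>

lemma hom_span_subset_Span:
  assumes "ring_hom_ring R S \<psi>" "\<one>\<^bsub>S\<^esub> \<noteq> \<zero>\<^bsub>S\<^esub>" and B: "B \<subseteq> carrier R" and x: "x \<in> span B"
  obtains Us where "set Us \<subseteq> B"
    "\<psi> x \<in> ring.Span S ((\<lambda>c. \<psi> (scalar c)) ` carrier K) (map \<psi> Us)"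
proof -
  interpret \<psi>: ring_hom_ring R S \<psi> by fact
  let ?k = "(\<lambda>c. \<psi> (scalar c)) ` carrier K"
  note k = scalar_image(2)[OF assms(1,2)]
  obtain a A where A: "finite A" "A \<subseteq> B" "a \<in> A \<rightarrow> carrier K" and xA: "x = lincomb a A"
    using x unfolding span_def by blast
  obtain Us where Us: "set Us = A" using finite_list[OF A(1)] by blast
  have Uc: "set (map \<psi> Us) \<subseteq> carrier S" using Us A(2) B by auto
  note sp = \<psi>.S.Span_subgroup_props[OF k Uc] \<psi>.S.Span_smult_closed[OF k Uc]
  have "A' \<subseteq> A \<Longrightarrow> (\<Oplus>v\<in>A'. a v \<odot>\<^bsub>R\<^esub> v) \<in> carrier R \<and> \<psi> (\<Oplus>v\<in>A'. a v \<odot>\<^bsub>R\<^esub> v) \<in> \<psi>.S.Span ?k (map \<psi> Us)"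
    if "finite A'" for A'
    using that
  proof (induct A')
    case empty
    then show ?case using sp(2) by simp
  next
    case (insert v A')
    have v: "v \<in> carrier R" "a v \<in> carrier K" "\<psi> v \<in> set (map \<psi> Us)"
      using insert.prems A B Us by auto
    have s: "(\<Oplus>v\<in>insert v A'. a v \<odot>\<^bsub>R\<^esub> v) = scalar (a v) \<otimes> v \<oplus> (\<Oplus>v\<in>A'. a v \<odot>\<^bsub>R\<^esub> v)"
    proof -
      have "a w \<in> carrier K \<and> w \<in> carrier R" if "w \<in> A'" for w using that insert.prems A B by auto
      then have "(\<lambda>v. a v \<odot>\<^bsub>R\<^esub> v) \<in> A' \<rightarrow> carrier R" by simp
      then show ?thesis using insert.hyps v by (simp add: scalar_mult)
    qed
    have "\<psi> (scalar (a v)) \<otimes>\<^bsub>S\<^esub> \<psi> v \<in> \<psi>.S.Span ?k (map \<psi> Us)"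
      using v \<psi>.S.Span_base_incl[OF k Uc] Uc by (intro sp(5)) auto
    then show ?case using insert v sp(3) unfolding s
      by (simp del: \<psi>.S.Span.simps)
  qed
  then have "\<psi> x \<in> \<psi>.S.Span ?k (map \<psi> Us)" using A(1) by (simp add: xA lincomb_def)
  then show thesis using that Us A(2) by blast
qed

text \<open>The infinite \<open>B\<close> certifies that \<open>K\<close> is uncountable: a finite
  \<open>S\<close> can have countably many products, and these embed into \<open>B\<close>.\<close>

lemma lesspoll_products:
  assumes "S \<prec> carrier K" "infinite B" "B \<prec> carrier K"
  shows "(\<lambda>l. foldr (\<otimes>) l \<one>) ` lists S \<prec> carrier K"
proof (rule lesspoll_trans1[OF image_lepoll])
  show "lists S \<prec> carrier K"
  proof (cases "finite S")
    case True
    then have "countable (lists S)" by (intro countable_lists countable_finite)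
    then have "lists S \<lesssim> (UNIV :: nat set)" unfolding countable_def lepoll_def by blast
    also have "(UNIV :: nat set) \<lesssim> B" using assms(2) unfolding infinite_le_lepoll .
    finally show ?thesis by (rule lesspoll_trans1[OF _ assms(3)])
  next
    case False
    show ?thesis by (rule lesspoll_lists[OF assms(1) False])
  qed
qed

text \<open>A domain algebraic over a field is a field, so any element outside \<open>M\<close> is
  invertible modulo \<open>M\<close>.\<close>

lemma maximal_if_quotient_algebraic:
  assumes M: "primeideal M R"
    and alg: "\<And>x. x \<in> carrier (R Quot M) \<Longrightarrow>
      (ring.algebraic (R Quot M) over (\<lambda>c. M +> scalar c) ` carrier K) x"
  shows "maximalideal M R"
proof -
  interpret M: primeideal M R by fact
  interpret D: "domain" "R Quot M" by (rule M.quotient_is_domain)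
  interpret \<pi>: ring_hom_ring R "R Quot M" "(+>) M" by (rule M.rcos_ring_hom_ring)
  note k = scalar_image(2)[OF \<pi>.ring_hom_ring_axioms D.one_not_zero]
  note z = coset_eq_zero_iff[OF M.ideal_axioms]
  show ?thesis
  proof (rule maximalidealI)
    fix J assume J: "ideal J R" "M \<subseteq> J" "J \<subseteq> carrier R"
    interpret J: ideal J R by fact
    show "J = M \<or> J = carrier R"
    proof (cases "J = M")
      case False
      then obtain x where x: "x \<in> J" "x \<notin> M" "x \<in> carrier R" using J by blast
      obtain u where u: "u \<in> carrier (R Quot M)" "(M +> x) \<otimes>\<^bsub>R Quot M\<^esub> u = \<one>\<^bsub>R Quot M\<^esub>"
      proof -
        have "M +> x \<in> carrier (R Quot M)" "M +> x \<noteq> \<zero>\<^bsub>R Quot M\<^esub>" using x z by auto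
        from D.algebraic_inverse[OF k this alg[OF this(1)]] show thesis using that by blast
      qed
      then obtain y where y: "y \<in> carrier R" "u = M +> y" unfolding FactRing_simps by auto
      have "M +> (x \<otimes> y \<ominus> \<one>) = \<zero>\<^bsub>R Quot M\<^esub>"
      proof -
        have "M +> (x \<otimes> y \<ominus> \<one>) = ((M +> x) \<otimes>\<^bsub>R Quot M\<^esub> u) \<ominus>\<^bsub>R Quot M\<^esub> \<one>\<^bsub>R Quot M\<^esub>"
          unfolding y(2) using x(3) y(1) by (simp add: minus_eq D.minus_eq)
        then show ?thesis unfolding u(2) by (simp add: D.minus_eq D.r_neg)
      qed
      then have m: "x \<otimes> y \<ominus> \<one> \<in> J" using z[of "x \<otimes> y \<ominus> \<one>"] x(3) y(1) J(2) by auto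
      have "x \<otimes> y \<in> J" using x y J.I_r_closed by blast
      then have "x \<otimes> y \<ominus> (x \<otimes> y \<ominus> \<one>) \<in> J" using m by (simp add: minus_eq J.a_closed J.a_inv_closed)
      also have "x \<otimes> y \<ominus> (x \<otimes> y \<ominus> \<one>) = \<one>" using x(3) y(1) by algebra
      finally show ?thesis using J.one_imp_carrier by blast
    qed simp
  qed (rule M.ideal_axioms, rule M.I_notcarr)
qed

text \<open>The size of \<Sigma> is bounded on condition that some infinite set lies below |K|,
  since the basis is chosen only inside the proof. Two choices of \<Sigma> are made later: a
  multiplicative set disjoint from \<open>M\<close>, and \<open>{\<one>}\<close> for a maximal
  \<open>M\<close>.\<close>

lemma quotient_algebraic:
  assumes dim: "dim_less_card_field K R" and M: "primeideal M R"
    and \<Sigma>: "\<Sigma> \<subseteq> carrier R - M" "\<And>B::'a set. infinite B \<Longrightarrow> B \<prec> carrier K \<Longrightarrow> \<Sigma> \<prec> carrier K"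
    and div: "\<And>x. x \<in> carrier R \<Longrightarrow> x \<notin> M \<Longrightarrow> \<exists>r\<in>carrier R. \<exists>m\<in>M. m \<oplus> r \<otimes> x \<in> \<Sigma>"
    and x: "x \<in> carrier (R Quot M)"
  shows "(ring.algebraic (R Quot M) over (\<lambda>c. M +> scalar c) ` carrier K) x"
proof -
  interpret M: primeideal M R by fact
  interpret D: "domain" "R Quot M" by (rule M.quotient_is_domain)
  interpret \<pi>: ring_hom_ring R "R Quot M" "(+>) M" by (rule M.rcos_ring_hom_ring)
  let ?k = "(\<lambda>c. M +> scalar c) ` carrier K"
  note k = scalar_image(2)[OF \<pi>.ring_hom_ring_axioms D.one_not_zero]
  note kK = scalar_image_eqpoll[OF \<pi>.ring_hom_ring_axioms D.one_not_zero]
  note z = coset_eq_zero_iff[OF M.ideal_axioms]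
  have coset: "\<exists>y\<in>carrier R. C = M +> y" if "C \<in> carrier (R Quot M)" for C
    using that unfolding FactRing_simps by auto
  obtain B where B: "B \<subseteq> carrier R" "B \<prec> carrier K" "\<And>x. x \<in> carrier R \<Longrightarrow> x \<in> span B"
    using dim_less_card_field_imp_generators[OF dim] by blast
  have lk: "f ` A \<prec> ?k" if "A \<prec> carrier K" for f :: "'a \<Rightarrow> 'a set" and A
    by (rule lesspoll_eq_trans[OF lesspoll_trans1[OF image_lepoll that] eqpoll_sym[OF kK]])
  show ?thesis
  proof (rule D.algebraic_if_small[OF k, where B = "(+>) M ` B" and \<Sigma> = "(+>) M ` \<Sigma>"])
    show "infinite ?k" using infinite_K kK eqpoll_finite_iff by blast
    show "(+>) M ` B \<subseteq> carrier (R Quot M)" using B(1) by auto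
    show "(+>) M ` B \<prec> ?k" by (rule lk[OF B(2)])
    show "(+>) M ` \<Sigma> \<subseteq> carrier (R Quot M) - {\<zero>\<^bsub>R Quot M\<^esub>}" using \<Sigma>(1) z by auto
    show "(+>) M ` \<Sigma> \<prec> ?k" if "infinite ((+>) M ` B)"
      using that finite_imageI \<Sigma>(2)[OF _ B(2)] by (intro lk) blast
    show "\<exists>Us. set Us \<subseteq> (+>) M ` B \<and> y \<in> D.Span ?k Us" if "y \<in> carrier (R Quot M)" for y
    proof -
      obtain x where x: "x \<in> carrier R" "y = M +> x" using coset[OF \<open>y \<in> _\<close>] by blast
      obtain Us where "set Us \<subseteq> B" "y \<in> D.Span ?k (map ((+>) M) Us)"
        using hom_span_subset_Span[OF \<pi>.ring_hom_ring_axioms D.one_not_zero B(1) B(3)[OF x(1)]]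
        unfolding x(2) by blast
      then show ?thesis by (intro exI[of _ "map ((+>) M) Us"]) (auto simp del: D.Span.simps)
    qed
    show "\<exists>r\<in>carrier (R Quot M). r \<otimes>\<^bsub>R Quot M\<^esub> y \<in> (+>) M ` \<Sigma>"
      if y: "y \<in> carrier (R Quot M)" "y \<noteq> \<zero>\<^bsub>R Quot M\<^esub>" for y
    proof -
      obtain x where x: "x \<in> carrier R" "y = M +> x" using coset[OF y(1)] by blast
      then obtain r m where r: "r \<in> carrier R" "m \<in> M" "m \<oplus> r \<otimes> x \<in> \<Sigma>" using div z y(2) by blast
      have "M +> (m \<oplus> r \<otimes> x) = (M +> r) \<otimes>\<^bsub>R Quot M\<^esub> y"
        using r x z[of m] M.Icarr[OF r(2)] by (simp add: x(2))
      then show ?thesis using r by (metis \<pi>.hom_closed image_eqI)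
    qed
  qed (rule x)
qed

text \<open>An ideal containing \<open>P\<close> that is maximal among those disjoint from the multiplicative set
  generated by \<open>S\<close> is a maximal ideal, because \<open>R / M\<close> localised at that set has dimension
  less than \<open>|K|\<close> and hence is algebraic over \<open>K\<close>.\<close>

theorem delta_primitive_if_separated:
  assumes dim: "dim_less_card_field K R" and P: "delta_ideal R \<Delta> P" "primeideal P R"
    and S: "S \<subseteq> carrier R - P" "S \<prec> carrier K"
    and sep: "\<And>Q. Q \<in> delta_spec R \<Delta> \<Longrightarrow> P \<subseteq> Q \<Longrightarrow> Q \<noteq> P \<Longrightarrow> S \<inter> Q \<noteq> {}"
  shows "delta_primitive R \<Delta> P"
proof -
  interpret P: primeideal P R by (rule P(2))
  define \<Sigma> where "\<Sigma> = (\<lambda>l. foldr (\<otimes>) l \<one>) ` lists S"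
  have prod: "foldr (\<otimes>) l \<one> \<in> carrier R - P" if "set l \<subseteq> S" for l
    using that S(1) P.I_prime P.I_notcarr P.one_imp_carrier by (induct l) auto
  have \<Sigma>P: "\<Sigma> \<subseteq> carrier R - P" using prod by (auto simp: \<Sigma>_def lists_eq_set)
  have foldr: "foldr (\<otimes>) (l @ l') \<one> = foldr (\<otimes>) l \<one> \<otimes> foldr (\<otimes>) l' \<one>"
    if "set l \<subseteq> S" "set l' \<subseteq> S" for l l'
    using that prod S(1) by (induct l) (auto simp: m_assoc)
  have \<Sigma>_mult: "s \<otimes> t \<in> \<Sigma>" if st: "s \<in> \<Sigma>" "t \<in> \<Sigma>" for s t
  proof -
    obtain l l' where l: "set l \<subseteq> S" "set l' \<subseteq> S" "s = foldr (\<otimes>) l \<one>" "t = foldr (\<otimes>) l' \<one>"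
      using st by (auto simp: \<Sigma>_def lists_eq_set)
    then show ?thesis unfolding l(3,4) foldr[OF l(1,2), symmetric] \<Sigma>_def
      by (intro imageI) (simp add: lists_eq_set)
  qed
  have one: "\<one> \<in> \<Sigma>" by (auto simp: \<Sigma>_def intro: image_eqI[of _ _ "[]"])
  have S\<Sigma>: "S \<subseteq> \<Sigma>"
  proof
    fix s assume "s \<in> S"
    then have "s = foldr (\<otimes>) [s] \<one>" "[s] \<in> lists S" using S(1) by auto
    then show "s \<in> \<Sigma>" unfolding \<Sigma>_def by (rule image_eqI)
  qed
  define \<A> where "\<A> = {J. ideal J R \<and> P \<subseteq> J \<and> J \<inter> \<Sigma> = {}}"
  have PA: "P \<in> \<A>" using \<Sigma>P P.ideal_axioms by (auto simp: \<A>_def)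
  have "\<exists>J\<in>\<A>. \<forall>Y\<in>\<A>. J \<subseteq> Y \<longrightarrow> Y = J"
  proof (rule subset_Zorn)
    fix C assume C: "subset.chain \<A> C"
    show "\<exists>U\<in>\<A>. \<forall>Y\<in>C. Y \<subseteq> U"
    proof (cases "C = {}")
      case True
      then show ?thesis using PA by blast
    next
      case False
      have "subset.chain {I. ideal I R} C" using C unfolding pred_on.chain_def \<A>_def by blast
      then have "ideal (\<Union>C) R" using chain_Union_is_ideal[of C] False by simp
      then have "\<Union>C \<in> \<A>" using C False unfolding pred_on.chain_def \<A>_def by blast
      then show ?thesis by (rule bexI[rotated]) blast
    qed
  qed
  then obtain M where M: "ideal M R" "P \<subseteq> M" "M \<inter> \<Sigma> = {}"
    and max: "\<And>Y. ideal Y R \<Longrightarrow> M \<subseteq> Y \<Longrightarrow> Y \<inter> \<Sigma> = {} \<Longrightarrow> Y = M" unfolding \<A>_def by auto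
  interpret M: ideal M R by (rule M(1))
  have meets: "Idl (insert a M) \<inter> \<Sigma> \<noteq> {}" if "a \<in> carrier R" "a \<notin> M" for a
  proof -
    have sub: "insert a M \<subseteq> carrier R" using that M.a_subset by auto
    show ?thesis using max[OF genideal_ideal[OF sub]] genideal_self[OF sub] that(2) by blast
  qed
  have prime: "primeideal M R"
  proof (rule primeidealI)
    show "carrier R \<noteq> M" using one M(3) by auto
    fix a b assume ab: "a \<in> carrier R" "b \<in> carrier R" "a \<otimes> b \<in> M"
    show "a \<in> M \<or> b \<in> M"
    proof (rule ccontr)
      assume "\<not> (a \<in> M \<or> b \<in> M)"
      then obtain s t where st: "s \<in> Idl (insert a M)" "s \<in> \<Sigma>" "t \<in> Idl (insert b M)" "t \<in> \<Sigma>"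
        using meets ab by blast
      have "s \<otimes> t \<in> M"
        using prod_genideal_insert_subset[OF M(1) ab] ideal_prod.prod[OF st(1,3)] by blast
      then show False using \<Sigma>_mult st M(3) by blast
    qed
  qed (rule M.ideal_axioms, rule cring_axioms)
  have "maximalideal M R"
  proof (rule maximal_if_quotient_algebraic[OF prime quotient_algebraic[OF dim prime]])
    show "\<Sigma> \<subseteq> carrier R - M" using \<Sigma>P M(3) by blast
    show "\<Sigma> \<prec> carrier K" if "infinite B" "B \<prec> carrier K" for B :: "'a set"
      unfolding \<Sigma>_def using lesspoll_products[OF S(2) that] .
    \<comment> \<open>By maximality of \<open>M\<close> among the ideals avoiding \<Sigma>,
      adjoining \<open>x\<close> produces an element of \<Sigma>; modulo \<open>M\<close> this is a
      multiple of \<open>x\<close>.\<close>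
    fix x assume x: "x \<in> carrier R" "x \<notin> M"
    obtain s where s: "s \<in> \<Sigma>" "s \<in> Idl (insert x M)" using meets[OF x] by blast
    then show "\<exists>r\<in>carrier R. \<exists>m\<in>M. m \<oplus> r \<otimes> x \<in> \<Sigma>"
      using mem_genideal_insert[OF M.ideal_axioms x(1) s(2)] by metis
  qed
  \<comment> \<open>A larger core would be a differential prime strictly above \<open>P\<close> and
    so would meet \<open>S\<close>, but \<open>M\<close> avoids \<open>S\<close>.\<close>
  moreover have "P = delta_core R \<Delta> M"
  proof (rule ccontr)
    assume "P \<noteq> delta_core R \<Delta> M"
    then have "S \<inter> delta_core R \<Delta> M \<noteq> {}"
      using sep[OF delta_spec_delta_core[OF prime] delta_core(3)[OF M(1) P(1) M(2)]] by blast
    then show False using delta_core(2)[OF M(1)] S\<Sigma> M(3) by blast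
  qed
  ultimately show ?thesis unfolding delta_primitive_def by blast
qed

end


section \<open>Constants of the fraction field\<close>

text \<open>Abstracts from the fraction field of a quotient: \<open>F\<close> consists of quotients
  of images of elements of \<open>R\<close>, and \<open>D\<close> extends the derivations. Arguments
  then speak of elements of \<open>R\<close> and a homomorphism instead of classes of pairs of
  cosets; the kernel of \<phi> is left open.\<close>

locale differential_fraction_field = char_zero_differential_algebra R K \<Delta> + F: field F
  for R :: "('k, 'a, 'n) module_scheme" (structure) and K :: "('k, 'm) ring_scheme"
    and \<Delta> and F :: "('f, 'g) ring_scheme" +
  fixes \<phi> :: "'a \<Rightarrow> 'f" and D :: "('a \<Rightarrow> 'a) \<Rightarrow> 'f \<Rightarrow> 'f"
  assumes hom: "\<phi> \<in> ring_hom R F"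
    and D_derivation: "\<delta> \<in> \<Delta> \<Longrightarrow> D \<delta> \<in> derivations F"
    and D_hom: "\<delta> \<in> \<Delta> \<Longrightarrow> x \<in> carrier R \<Longrightarrow> D \<delta> (\<phi> x) = \<phi> (\<delta> x)"
    and fraction: "z \<in> carrier F \<Longrightarrow>
      \<exists>a\<in>carrier R. \<exists>b\<in>carrier R. \<phi> b \<noteq> \<zero>\<^bsub>F\<^esub> \<and> \<phi> b \<otimes>\<^bsub>F\<^esub> z = \<phi> a"
begin

sublocale \<phi>: ring_hom_cring R F \<phi>
  using hom by unfold_locales

definition constants :: "'f set" where
  "constants = {z \<in> carrier F. \<forall>\<delta>\<in>\<Delta>. D \<delta> z = \<zero>\<^bsub>F\<^esub>}"

definition scalars :: "'f set" where
  "scalars = (\<lambda>c. \<phi> (scalar c)) ` carrier K"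

lemma ring_hom_ring: "ring_hom_ring R F \<phi>"
  using hom by (intro ring_hom_ringI2 ring_axioms F.ring_axioms)

lemmas D_closed [simp] = derivationsD(1)[OF D_derivation]
lemmas D_add = derivationsD(2)[OF D_derivation]
lemmas D_mult = derivationsD(3)[OF D_derivation]

lemma subfield_scalars: "subfield scalars F"
  and inj_on_scalars: "inj_on (\<lambda>c. \<phi> (scalar c)) (carrier K)"
  unfolding scalars_def using scalar_image[OF ring_hom_ring F.one_not_zero] by simp_all

lemma scalars_subset_constants: "scalars \<subseteq> constants"
  by (auto simp: scalars_def constants_def D_hom Delta_scalar)

lemma subring_constants: "subring constants F"
proof (rule F.subringI)
  show "\<one>\<^bsub>F\<^esub> \<in> constants" by (simp add: constants_def F.derivation_one D_derivation)
qed (auto simp: constants_def D_add D_mult F.derivation_minus D_derivation)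

lemma inverse_constant:
  assumes z: "z \<in> constants" "z \<noteq> \<zero>\<^bsub>F\<^esub>"
  shows "inv\<^bsub>F\<^esub> z \<in> constants"
proof -
  have zc: "z \<in> carrier F" and dz: "\<And>\<delta>. \<delta> \<in> \<Delta> \<Longrightarrow> D \<delta> z = \<zero>\<^bsub>F\<^esub>"
    using z(1) by (auto simp: constants_def)
  have u: "z \<in> Units F" using zc z(2) by (simp add: F.field_Units)
  have i: "inv\<^bsub>F\<^esub> z \<in> carrier F" "z \<otimes>\<^bsub>F\<^esub> inv\<^bsub>F\<^esub> z = \<one>\<^bsub>F\<^esub>" using u by auto
  have "D \<delta> (inv\<^bsub>F\<^esub> z) = \<zero>\<^bsub>F\<^esub>" if \<delta>: "\<delta> \<in> \<Delta>" for \<delta>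
  proof -
    have "z \<otimes>\<^bsub>F\<^esub> D \<delta> (inv\<^bsub>F\<^esub> z) = D \<delta> \<one>\<^bsub>F\<^esub>"
      using D_mult[OF \<delta> zc i(1)] dz[OF \<delta>] zc i \<delta> by simp
    then show ?thesis using zc z(2) i(1) \<delta> by (simp add: F.derivation_one D_derivation F.integral_iff)
  qed
  then show ?thesis using i(1) by (simp add: constants_def)
qed

lemma subfield_constants: "subfield constants F"
  using subring_constants inverse_constant by (intro F.subfieldI') auto

text \<open>The denominators of a constant form a differential ideal, so they are not all contained in an
  ideal whose core is killed by \<open>\<phi>\<close>.\<close>

lemma constant_denominator:
  assumes z: "z \<in> constants" and M: "ideal M R"
    and ker: "\<And>x. x \<in> delta_core R \<Delta> M \<Longrightarrow> \<phi> x = \<zero>\<^bsub>F\<^esub>"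
  obtains a b where "a \<in> carrier R" "b \<in> carrier R" "b \<notin> M" "\<phi> b \<otimes>\<^bsub>F\<^esub> z = \<phi> a"
proof -
  have zc: "z \<in> carrier F" and dz: "\<And>\<delta>. \<delta> \<in> \<Delta> \<Longrightarrow> D \<delta> z = \<zero>\<^bsub>F\<^esub>"
    using z by (auto simp: constants_def)
  let ?J = "{b \<in> carrier R. \<exists>a\<in>carrier R. \<phi> b \<otimes>\<^bsub>F\<^esub> z = \<phi> a}"
  have "ideal ?J R"
  proof (rule idealI)
    show "ring R" by (rule ring_axioms)
    show "subgroup ?J (add_monoid R)"
    proof (rule subgroup.intro)
      have "\<phi> \<zero> \<otimes>\<^bsub>F\<^esub> z = \<phi> \<zero>" using zc by simp
      then have "\<zero> \<in> ?J" by blast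
      then show "\<one>\<^bsub>add_monoid R\<^esub> \<in> ?J" by simp
      show "x \<otimes>\<^bsub>add_monoid R\<^esub> y \<in> ?J" if xy: "x \<in> ?J" "y \<in> ?J" for x y
      proof -
        obtain a b where a: "a \<in> carrier R" "\<phi> x \<otimes>\<^bsub>F\<^esub> z = \<phi> a" and b: "b \<in> carrier R" "\<phi> y \<otimes>\<^bsub>F\<^esub> z = \<phi> b"
          using xy by blast
        have c: "x \<in> carrier R" "y \<in> carrier R" using xy by blast+
        have "\<phi> (x \<oplus> y) \<otimes>\<^bsub>F\<^esub> z = \<phi> (a \<oplus> b)"
          using a b c zc by (simp add: F.l_distr)
        then have "x \<oplus> y \<in> ?J" using a(1) b(1) c by blast
        then show ?thesis by simp
      qed
      show "inv\<^bsub>add_monoid R\<^esub> x \<in> ?J" if x: "x \<in> ?J" for x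
      proof -
        obtain a where a: "a \<in> carrier R" "\<phi> x \<otimes>\<^bsub>F\<^esub> z = \<phi> a" using x by blast
        have c: "x \<in> carrier R" using x by blast
        have "\<phi> (\<ominus> x) \<otimes>\<^bsub>F\<^esub> z = \<phi> (\<ominus> a)" using a c zc by (simp add: F.l_minus)
        then have "\<ominus> x \<in> ?J" using a(1) c by blast
        then show ?thesis by (simp add: a_inv_def)
      qed
    qed (simp add: subset_iff)
    fix b x assume b: "b \<in> ?J" and x: "x \<in> carrier R"
    obtain a where a: "a \<in> carrier R" "\<phi> b \<otimes>\<^bsub>F\<^esub> z = \<phi> a" using b by blast
    have c: "b \<in> carrier R" using b by blast
    have "\<phi> (x \<otimes> b) \<otimes>\<^bsub>F\<^esub> z = \<phi> (x \<otimes> a)" using a c x zc by (simp add: F.m_assoc)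
    then show "x \<otimes> b \<in> ?J" using a(1) c x by blast
    then show "b \<otimes> x \<in> ?J" using b x by (simp add: m_comm)
  qed
  moreover have "\<delta> b \<in> ?J" if \<delta>: "\<delta> \<in> \<Delta>" and b: "b \<in> ?J" for \<delta> b
  proof -
    obtain a where a: "a \<in> carrier R" "\<phi> b \<otimes>\<^bsub>F\<^esub> z = \<phi> a" using b by blast
    have c: "b \<in> carrier R" using b by blast
    have "\<phi> (\<delta> b) \<otimes>\<^bsub>F\<^esub> z = D \<delta> (\<phi> b \<otimes>\<^bsub>F\<^esub> z)"
      using c zc \<delta> DeltaD(2)[OF \<delta>] by (simp add: D_mult dz D_hom)
    also have "\<dots> = \<phi> (\<delta> a)" using a \<delta> by (simp add: D_hom)
    finally show ?thesis using DeltaD(2)[OF \<delta> c] DeltaD(2)[OF \<delta> a(1)] by blast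
  qed
  ultimately have J: "delta_ideal R \<Delta> ?J" by (auto simp: delta_ideal_def)
  obtain a b where "a \<in> carrier R" "b \<in> carrier R" "\<phi> b \<noteq> \<zero>\<^bsub>F\<^esub>" "\<phi> b \<otimes>\<^bsub>F\<^esub> z = \<phi> a"
    using fraction[OF zc] by blast
  then have "\<not> ?J \<subseteq> delta_core R \<Delta> M" using ker by blast
  then have "\<not> ?J \<subseteq> M" using delta_core(3)[OF M J] by blast
  then show thesis using that by blast
qed

text \<open>The partially defined residue map \<open>\<phi> a / \<phi> b \<mapsto> (M + a) / (M + b)\<close>, as a relation.\<close>

definition residue :: "'a set \<Rightarrow> 'f \<Rightarrow> 'a set \<Rightarrow> bool" where
  "residue M z l \<longleftrightarrow> z \<in> carrier F \<and> l \<in> carrier (R Quot M) \<and>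
     (\<exists>a\<in>carrier R. \<exists>b\<in>carrier R. b \<notin> M \<and> \<phi> b \<otimes>\<^bsub>F\<^esub> z = \<phi> a \<and>
       (M +> b) \<otimes>\<^bsub>R Quot M\<^esub> l = M +> a)"

text \<open>One step of Horner's scheme, which also yields products for \<open>c = \<zero>\<close>.
  Denominators are multiplied, and primeness of \<open>M\<close> keeps the product outside
  \<open>M\<close>.\<close>

lemma residue_step:
  assumes M: "primeideal M R" and "residue M y m" "residue M z l" and c: "c \<in> carrier R"
  shows "residue M (y \<otimes>\<^bsub>F\<^esub> z \<oplus>\<^bsub>F\<^esub> \<phi> c) (m \<otimes>\<^bsub>R Quot M\<^esub> l \<oplus>\<^bsub>R Quot M\<^esub> (M +> c))"
proof -
  interpret M: primeideal M R by fact
  interpret L: "domain" "R Quot M" by (rule M.quotient_is_domain)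
  interpret \<pi>: ring_hom_ring R "R Quot M" "(+>) M" by (rule M.rcos_ring_hom_ring)
  obtain a b where y: "y \<in> carrier F" "m \<in> carrier (R Quot M)" "a \<in> carrier R" "b \<in> carrier R" "b \<notin> M"
    and e: "\<phi> b \<otimes>\<^bsub>F\<^esub> y = \<phi> a" "(M +> b) \<otimes>\<^bsub>R Quot M\<^esub> m = M +> a"
    using assms(2) unfolding residue_def by blast
  obtain a' b' where z: "z \<in> carrier F" "l \<in> carrier (R Quot M)" "a' \<in> carrier R" "b' \<in> carrier R" "b' \<notin> M"
    and e': "\<phi> b' \<otimes>\<^bsub>F\<^esub> z = \<phi> a'" "(M +> b') \<otimes>\<^bsub>R Quot M\<^esub> l = M +> a'"
    using assms(3) unfolding residue_def by blast
  have "\<phi> (b \<otimes> b') \<otimes>\<^bsub>F\<^esub> (y \<otimes>\<^bsub>F\<^esub> z) = (\<phi> b \<otimes>\<^bsub>F\<^esub> y) \<otimes>\<^bsub>F\<^esub> (\<phi> b' \<otimes>\<^bsub>F\<^esub> z)"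
    using y z by (simp add: F.m_ac)
  then have 1: "\<phi> (b \<otimes> b') \<otimes>\<^bsub>F\<^esub> (y \<otimes>\<^bsub>F\<^esub> z \<oplus>\<^bsub>F\<^esub> \<phi> c) = \<phi> (a \<otimes> a' \<oplus> b \<otimes> b' \<otimes> c)"
    using y z c by (simp add: F.r_distr e e')
  have 2: "(M +> (b \<otimes> b')) \<otimes>\<^bsub>R Quot M\<^esub> (m \<otimes>\<^bsub>R Quot M\<^esub> l \<oplus>\<^bsub>R Quot M\<^esub> (M +> c)) =
      M +> (a \<otimes> a' \<oplus> b \<otimes> b' \<otimes> c)"
  proof -
    let ?b = "M +> b" and ?b' = "M +> b'" and ?c = "M +> c"
    have cl: "?b \<in> carrier (R Quot M)" "?b' \<in> carrier (R Quot M)" "?c \<in> carrier (R Quot M)"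
      using y z c by simp_all
    have "?b \<otimes>\<^bsub>R Quot M\<^esub> ?b' \<otimes>\<^bsub>R Quot M\<^esub> (m \<otimes>\<^bsub>R Quot M\<^esub> l \<oplus>\<^bsub>R Quot M\<^esub> ?c) =
        (?b \<otimes>\<^bsub>R Quot M\<^esub> m) \<otimes>\<^bsub>R Quot M\<^esub> (?b' \<otimes>\<^bsub>R Quot M\<^esub> l) \<oplus>\<^bsub>R Quot M\<^esub>
        ?b \<otimes>\<^bsub>R Quot M\<^esub> ?b' \<otimes>\<^bsub>R Quot M\<^esub> ?c"
      using cl y(2) z(2) by (simp only: L.r_distr L.m_ac L.m_closed)
    then show ?thesis unfolding e e' using y z c by simp
  qed
  have "b \<otimes> b' \<notin> M" using M.I_prime y z by blast
  then show ?thesis unfolding residue_def using y z c 1 2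
    by (intro conjI bexI[of _ "a \<otimes> a' \<oplus> b \<otimes> b' \<otimes> c"] bexI[of _ "b \<otimes> b'"]) simp_all
qed

text \<open>Lift a polynomial that kills the residue of \<open>z\<close> to coefficients in
  \<open>K\<close>; its value at \<open>z\<close> is a constant with residue zero. If that value
  were nonzero, its inverse would be a constant with a residue too, and one would have residue zero.
  This exclusion replaces a proof that residues are unique.\<close>

theorem rational_if_primitive:
  assumes dim: "dim_less_card_field K R" and M: "maximalideal M R"
    and ker: "\<And>x. x \<in> carrier R \<Longrightarrow> \<phi> x = \<zero>\<^bsub>F\<^esub> \<longleftrightarrow> x \<in> delta_core R \<Delta> M"
    and z: "z \<in> constants"
  shows "(ring.algebraic F over scalars) z"
proof -
  interpret M: maximalideal M R by fact
  have prime: "primeideal M R" using M by (rule maximalideal_prime)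
  interpret M: primeideal M R by (rule prime)
  interpret L: "domain" "R Quot M" by (rule M.quotient_is_domain)
  interpret \<pi>: ring_hom_ring R "R Quot M" "(+>) M" by (rule M.rcos_ring_hom_ring)
  let ?k = "(\<lambda>c. M +> scalar c) ` carrier K"
  note k = scalar_image[OF \<pi>.ring_hom_ring_axioms L.one_not_zero]
  have core: "delta_core R \<Delta> M \<subseteq> M" by (rule delta_core(2)[OF M.ideal_axioms])
  have unit: "\<exists>r\<in>carrier R. \<exists>m\<in>M. m \<oplus> r \<otimes> x = \<one>" if x: "x \<in> carrier R" "x \<notin> M" for x
  proof -
    have sub: "insert x M \<subseteq> carrier R" using x M.a_subset by auto
    let ?J = "Idl (insert x M)"
    interpret J: ideal ?J R by (rule genideal_ideal[OF sub])
    have xJ: "x \<in> ?J" "M \<subseteq> ?J" using genideal_self[OF sub] by blast+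
    have "?J = M \<or> ?J = carrier R" by (rule M.I_maximal[OF J.ideal_axioms xJ(2) J.a_subset])
    then have "\<one> \<in> ?J" using xJ(1) x(2) by blast
    then show ?thesis by (rule mem_genideal_insert[OF M.ideal_axioms x(1)])
  qed
  \<comment> \<open>For a maximal \<open>M\<close> every element outside \<open>M\<close> has a
    multiple congruent to one, so \<open>{\<one>}\<close> serves as the set of denominators.\<close>
  have alg: "(L.algebraic over ?k) l" if "l \<in> carrier (R Quot M)" for l
  proof (rule quotient_algebraic[OF dim prime _ _ _ that])
    show "{\<one>} \<subseteq> carrier R - M" using M.I_notcarr M.one_imp_carrier by blast
    show "{\<one>} \<prec> carrier K" by (simp add: finite_lesspoll_infinite infinite_K)
    show "\<exists>r\<in>carrier R. \<exists>m\<in>M. m \<oplus> r \<otimes> x \<in> {\<one>}" if "x \<in> carrier R" "x \<notin> M" for x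
      using unit[OF that] by simp
  qed
  have ex_residue: "\<exists>l. residue M y l" if y: "y \<in> constants" for y
  proof -
    obtain a b where ab: "a \<in> carrier R" "b \<in> carrier R" "b \<notin> M" "\<phi> b \<otimes>\<^bsub>F\<^esub> y = \<phi> a"
    proof (rule constant_denominator[OF y M.ideal_axioms])
      show "\<phi> x = \<zero>\<^bsub>F\<^esub>" if "x \<in> delta_core R \<Delta> M" for x
        using that ker[of x] core M.a_subset by blast
    qed blast
    obtain r m where r: "r \<in> carrier R" "m \<in> M" "m \<oplus> r \<otimes> b = \<one>" using unit ab by blast
    let ?a = "M +> a" and ?b = "M +> b" and ?r = "M +> r"
    have cl: "?a \<in> carrier (R Quot M)" "?b \<in> carrier (R Quot M)" "?r \<in> carrier (R Quot M)"
      using ab r by simp_all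
    have "M +> m = \<zero>\<^bsub>R Quot M\<^esub>"
      using coset_eq_zero_iff[OF M.ideal_axioms M.Icarr[OF r(2)]] r(2) by blast
    then have br: "?r \<otimes>\<^bsub>R Quot M\<^esub> ?b = M +> (m \<oplus> r \<otimes> b)"
      using r(1) ab(2) M.Icarr[OF r(2)] cl by simp
    have "?b \<otimes>\<^bsub>R Quot M\<^esub> (?r \<otimes>\<^bsub>R Quot M\<^esub> ?a) = (?r \<otimes>\<^bsub>R Quot M\<^esub> ?b) \<otimes>\<^bsub>R Quot M\<^esub> ?a"
      using cl by (simp only: L.m_ac)
    also have "\<dots> = ?a" unfolding br r(3) using cl by simp
    finally have "?b \<otimes>\<^bsub>R Quot M\<^esub> (?r \<otimes>\<^bsub>R Quot M\<^esub> ?a) = ?a" .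
    moreover have "?r \<otimes>\<^bsub>R Quot M\<^esub> ?a \<in> carrier (R Quot M)" using cl by (intro L.m_closed)
    moreover have "y \<in> carrier F" using y by (simp add: constants_def)
    ultimately show ?thesis unfolding residue_def using ab by blast
  qed
  obtain l where l: "residue M z l" using ex_residue[OF z] by blast
  then have lc: "l \<in> carrier (R Quot M)" and zc: "z \<in> carrier F" by (auto simp: residue_def)
  obtain p where p: "p \<in> carrier (?k[X]\<^bsub>R Quot M\<^esub>)" "p \<noteq> []" "L.eval p l = \<zero>\<^bsub>R Quot M\<^esub>"
    using L.algebraicE[OF subfieldE(1)[OF k(2)] lc alg[OF lc]] by blast
  have pk: "set p \<subseteq> ?k" "hd p \<noteq> \<zero>\<^bsub>R Quot M\<^esub>"
    using p(1,2) by (auto simp: univ_poly_carrier[symmetric] polynomial_def)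
  then have "p \<in> lists ?k" by blast
  then obtain q where q: "set q \<subseteq> carrier K" "p = map (\<lambda>c. M +> scalar c) q"
    unfolding lists_image by blast
  let ?f = "\<lambda>c. \<phi> (scalar c)"
  \<comment> \<open>Coefficients are listed from the highest degree, so splitting off the last one
    is a Horner step.\<close>
  have eval: "residue M (F.eval (map ?f q) z) (L.eval (map (\<lambda>c. M +> scalar c) q) l) \<and>
      F.eval (map ?f q) z \<in> constants" if "set q \<subseteq> carrier K" for q
    using that
  proof (induct q rule: rev_induct)
    case Nil
    have "residue M \<zero>\<^bsub>F\<^esub> \<zero>\<^bsub>R Quot M\<^esub>"
      unfolding residue_def using M.I_notcarr M.one_imp_carrier
      by (intro conjI bexI[of _ \<zero>] bexI[of _ \<one>]) auto
    then show ?case using subringE(2)[OF subring_constants] by simp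
  next
    case (snoc c q)
    have c: "scalar c \<in> carrier R" "c \<in> carrier K" using snoc.prems by auto
    have s: "set (map ?f q) \<subseteq> carrier F" "set (map (\<lambda>c. M +> scalar c) q) \<subseteq> carrier (R Quot M)"
      using snoc.prems by auto
    have "?f c \<in> constants" using c scalars_subset_constants by (auto simp: scalars_def)
    then show ?case
      using snoc c residue_step[OF prime _ l, of _ _ "scalar c"] subringE(6,7)[OF subring_constants] z
      by (simp add: F.eval_append_aux[OF s(1) _ zc] L.eval_append_aux[OF s(2) _ lc])
  qed
  let ?w = "F.eval (map ?f q) z"
  have w: "residue M ?w \<zero>\<^bsub>R Quot M\<^esub>" "?w \<in> constants" using eval[OF q(1)] p(3) q(2) by auto
  have "?w = \<zero>\<^bsub>F\<^esub>"
  proof (rule ccontr)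
    assume ne: "?w \<noteq> \<zero>\<^bsub>F\<^esub>"
    obtain m where m: "residue M (inv\<^bsub>F\<^esub> ?w) m" using ex_residue[OF inverse_constant[OF w(2) ne]] by blast
    have "?w \<in> Units F" using w(2) ne by (simp add: F.field_Units constants_def)
    moreover have "m \<in> carrier (R Quot M)" using m by (simp add: residue_def)
    ultimately have "residue M \<one>\<^bsub>F\<^esub> \<zero>\<^bsub>R Quot M\<^esub>"
      using residue_step[OF prime w(1) m, of \<zero>] coset_eq_zero_iff[OF M.ideal_axioms, of \<zero>] by simp
    \<comment> \<open>Here \<open>a / b\<close> represents one, so \<open>b \<ominus> a\<close> lies
      in the kernel and hence in \<open>M\<close>; together with \<open>a\<close> in
      \<open>M\<close> this forces \<open>b\<close> into \<open>M\<close>.\<close>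
    then obtain a b where ab: "a \<in> carrier R" "b \<in> carrier R" "b \<notin> M" "\<phi> b = \<phi> a" "M +> a = \<zero>\<^bsub>R Quot M\<^esub>"
      unfolding residue_def by auto
    then have "\<phi> (b \<ominus> a) = \<zero>\<^bsub>F\<^esub>" by (simp add: minus_eq F.r_neg)
    then have "b \<ominus> a \<in> M" using ker[OF minus_closed[OF ab(2,1)]] core by blast
    moreover have "a \<in> M" using ab coset_eq_zero_iff[OF M.ideal_axioms] by blast
    ultimately have "(b \<ominus> a) \<oplus> a \<in> M" by (rule M.a_closed)
    also have "(b \<ominus> a) \<oplus> a = b" using ab by algebra
    finally show False using ab(3) by blast
  qed
  moreover have "map ?f q \<in> carrier (scalars[X]\<^bsub>F\<^esub>)"
  proof -
    have "q \<noteq> []" using p(2) q(2) by blast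
    then have h: "hd q \<in> carrier K" "hd p = M +> scalar (hd q)" using q by (auto simp: hd_map)
    have "hd q \<noteq> \<zero>\<^bsub>K\<^esub>"
    proof
      assume "hd q = \<zero>\<^bsub>K\<^esub>"
      then have "hd p = \<zero>\<^bsub>R Quot M\<^esub>" unfolding h(2) by (simp only: scalar.hom_zero \<pi>.hom_zero)
      then show False using pk(2) by blast
    qed
    then have "?f (hd q) \<noteq> ?f \<zero>\<^bsub>K\<^esub>" using inj_onD[OF inj_on_scalars _ h(1)] by blast
    then have "hd (map ?f q) \<noteq> \<zero>\<^bsub>F\<^esub>" using \<open>q \<noteq> []\<close> by (simp add: hd_map)
    moreover have "set (map ?f q) \<subseteq> scalars" using q(1) unfolding scalars_def by auto
    ultimately show ?thesis by (simp add: univ_poly_carrier[symmetric] polynomial_def)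
  qed
  moreover have "map ?f q \<noteq> []" using p(2) q(2) by simp
  ultimately show ?thesis by (intro F.algebraicI)
qed

end


section \<open>Separation by differential operators\<close>

text \<open>With \<open>y = z x\<close> for the quotient \<open>z\<close>, no inverse has to be
  differentiated: the Leibniz rule and the hypothesis leave \<open>x\<close> times
  \<open>d z\<close> times \<open>x\<close> equal to zero.\<close>

lemma (in field) derivation_quotient_eq_zero:
  assumes d: "d \<in> derivations R" and x: "x \<in> carrier R" "x \<noteq> \<zero>" and y: "y \<in> carrier R"
    and e: "x \<otimes> d y = d x \<otimes> y"
  shows "d (y \<otimes> inv x) = \<zero>"
proof -
  note [simp] = derivationsD(1)[OF d]
  have u: "x \<in> Units R" using x by (simp add: field_Units)
  define z where "z = y \<otimes> inv x"
  have z: "z \<in> carrier R" using u y by (simp add: z_def)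
  have yz: "y = z \<otimes> x" using u x y by (simp add: z_def m_assoc)
  have "x \<otimes> d y = x \<otimes> (z \<otimes> d x) \<oplus> x \<otimes> (d z \<otimes> x)"
    unfolding yz using derivationsD(3)[OF d z x(1)] x z by (simp add: r_distr)
  moreover have "d x \<otimes> y = x \<otimes> (z \<otimes> d x)" unfolding yz using x z by (simp add: m_ac)
  ultimately have "x \<otimes> (z \<otimes> d x) \<oplus> x \<otimes> (d z \<otimes> x) = x \<otimes> (z \<otimes> d x)" using e by simp
  then have "x \<otimes> (d z \<otimes> x) = \<zero>" using x z by (simp add: add.l_cancel_one')
  then have "d z = \<zero>" using x z by (simp add: integral_iff)
  then show ?thesis by (simp add: z_def)
qed

lemma (in ring) combine_zeros:
  assumes "set Ks \<subseteq> carrier R" "set ys \<subseteq> {\<zero>}"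
  shows "combine Ks ys = \<zero>"
  using assms by (induct Ks ys rule: combine.induct) auto

lemma (in cring) combine_linear:
  assumes "set Ks \<subseteq> carrier R" "a \<in> carrier R" "b \<in> carrier R"
    and "\<And>u. u \<in> set us \<Longrightarrow> f u \<in> carrier R \<and> g u \<in> carrier R"
  shows "combine Ks (map (\<lambda>u. a \<otimes> f u \<oplus> b \<otimes> g u) us) =
    a \<otimes> combine Ks (map f us) \<oplus> b \<otimes> combine Ks (map g us)"
  using assms
proof (induct us arbitrary: Ks)
  case (Cons u us)
  show ?case
  proof (cases Ks)
    case (Cons k Ks')
    have k: "k \<in> carrier R" "set Ks' \<subseteq> carrier R" using Cons.prems(1) Cons by auto
    have c: "combine Ks' (map f us) \<in> carrier R" "combine Ks' (map g us) \<in> carrier R"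
      using Cons.prems(4) k by (auto intro!: combine_in_carrier)
    have fg: "f u \<in> carrier R" "g u \<in> carrier R" using Cons.prems(4) by auto
    have IH: "combine Ks' (map (\<lambda>u. a \<otimes> f u \<oplus> b \<otimes> g u) us) =
        a \<otimes> combine Ks' (map f us) \<oplus> b \<otimes> combine Ks' (map g us)"
      using Cons.hyps[OF k(2)] Cons.prems by simp
    show ?thesis unfolding \<open>Ks = k # Ks'\<close> using IH k c fg Cons.prems(2,3)
      by (simp add: r_distr m_lcomm a_ac)
  qed (use Cons.prems in simp)
qed (use assms(2,3) in simp)

context char_zero_differential_algebra
begin

text \<open>Differential operators as functions, with coefficients in \<open>R\<close> and not in
  the fraction field, so that each of them maps every differential ideal into itself. The rule
  \<open>lin\<close> provides sums and multiples together.\<close>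

inductive_set operators :: "('a \<Rightarrow> 'a) set" where
  id: "(\<lambda>x. x) \<in> operators"
| deriv: "L \<in> operators \<Longrightarrow> \<delta> \<in> \<Delta> \<Longrightarrow> (\<lambda>x. \<delta> (L x)) \<in> operators"
| lin: "L \<in> operators \<Longrightarrow> L' \<in> operators \<Longrightarrow> a \<in> carrier R \<Longrightarrow> b \<in> carrier R \<Longrightarrow>
    (\<lambda>x. a \<otimes> L x \<oplus> b \<otimes> L' x) \<in> operators"

lemma operators_closed: "L \<in> operators \<Longrightarrow> x \<in> carrier R \<Longrightarrow> L x \<in> carrier R"
  by (induct rule: operators.induct) (auto simp: DeltaD(2))

lemma operators_delta_ideal:
  assumes "L \<in> operators" "delta_ideal R \<Delta> Q" "x \<in> Q"
  shows "L x \<in> Q"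
proof -
  interpret Q: ideal Q R using assms(2) by (simp add: delta_ideal_def)
  show ?thesis using assms(1)
  proof (induct rule: operators.induct)
    case (deriv L \<delta>)
    then show ?case using assms(2) unfolding delta_ideal_def by blast
  qed (use assms(3) in \<open>auto intro: Q.a_closed Q.I_l_closed\<close>)
qed

end

section \<open>Density for differential operators\<close>

context differential_fraction_field
begin

lemma D_combine:
  assumes "set Ks \<subseteq> constants" "set ys \<subseteq> carrier F" "\<delta> \<in> \<Delta>"
  shows "D \<delta> (F.combine Ks ys) = F.combine Ks (map (D \<delta>) ys)"
  using assms(1,2)
proof (induct Ks ys rule: F.combine.induct)
  case (1 k Ks u Us)
  have k: "k \<in> carrier F" "D \<delta> k = \<zero>\<^bsub>F\<^esub>" "u \<in> carrier F" "set Us \<subseteq> carrier F" "set Ks \<subseteq> carrier F"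
    using 1 assms(3) by (auto simp: constants_def)
  have "F.combine Ks Us \<in> carrier F" using k by (intro F.combine_in_carrier)
  then show ?case using 1 k assms(3) by (simp add: D_add D_mult)
qed (auto simp: F.derivation_zero D_derivation[OF assms(3)])

text \<open>Operators are linear over the constants, which derivations annihilate. The identity is
  stated through \<phi> because the coefficients live in \<open>F\<close>, where the operators do
  not act.\<close>

lemma operators_combine:
  assumes L: "L \<in> operators" and Ks: "set Ks \<subseteq> constants" and us: "set us \<subseteq> carrier R"
    and f: "f \<in> carrier R" "\<phi> f = F.combine Ks (map \<phi> us)"
  shows "\<phi> (L f) = F.combine Ks (map (\<lambda>u. \<phi> (L u)) us)"
  using L
proof (induct rule: operators.induct)
  case id
  then show ?case using f(2) by simp
next
  case (deriv L \<delta>)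
  have c: "L u \<in> carrier R" if "u \<in> carrier R" for u using operators_closed deriv(1) that by blast
  have "\<phi> (\<delta> (L f)) = D \<delta> (F.combine Ks (map (\<lambda>u. \<phi> (L u)) us))"
    using D_hom[OF deriv(3) c[OF f(1)]] deriv(2) by simp
  also have "\<dots> = F.combine Ks (map (D \<delta>) (map (\<lambda>u. \<phi> (L u)) us))"
    using us c by (intro D_combine[OF Ks _ deriv(3)]) auto
  also have "map (D \<delta>) (map (\<lambda>u. \<phi> (L u)) us) = map (\<lambda>u. \<phi> (\<delta> (L u))) us"
    using us c D_hom[OF deriv(3)] by auto
  finally show ?case .
next
  case (lin L L' a b)
  have c: "L u \<in> carrier R" "L' u \<in> carrier R" if "u \<in> carrier R" for u
    using operators_closed lin(1,3) that by blast+
  have KF: "set Ks \<subseteq> carrier F" using Ks by (auto simp: constants_def)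
  have m: "map (\<lambda>u. \<phi> (a \<otimes> L u \<oplus> b \<otimes> L' u)) us =
      map (\<lambda>u. \<phi> a \<otimes>\<^bsub>F\<^esub> \<phi> (L u) \<oplus>\<^bsub>F\<^esub> \<phi> b \<otimes>\<^bsub>F\<^esub> \<phi> (L' u)) us"
    using us c lin(5,6) by auto
  have e: "F.combine Ks (map (\<lambda>u. \<phi> a \<otimes>\<^bsub>F\<^esub> \<phi> (L u) \<oplus>\<^bsub>F\<^esub> \<phi> b \<otimes>\<^bsub>F\<^esub> \<phi> (L' u)) us) =
      \<phi> a \<otimes>\<^bsub>F\<^esub> \<phi> (L f) \<oplus>\<^bsub>F\<^esub> \<phi> b \<otimes>\<^bsub>F\<^esub> \<phi> (L' f)"
    unfolding lin(2,4) using us c lin(5,6) by (intro F.combine_linear[OF KF]) auto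
  show ?case unfolding m e using c[OF f(1)] lin(5,6) by simp
qed

text \<open>The case of Jacobson's density theorem for the simple module \<open>F\<close> over the ring of
  differential operators, whose endomorphism ring is the field of constants.\<close>

theorem operators_separate:
  assumes "set (u # vs) \<subseteq> carrier R" "F.independent constants (map \<phi> (u # vs))"
  shows "\<exists>L\<in>operators. (\<forall>v\<in>set vs. \<phi> (L v) = \<zero>\<^bsub>F\<^esub>) \<and> \<phi> (L u) \<noteq> \<zero>\<^bsub>F\<^esub>"
  using assms
proof (induct vs arbitrary: u rule: length_induct)
  case (1 vs)
  note C = subfield_constants
  have u: "u \<in> carrier R" and vs: "set vs \<subseteq> carrier R" using 1(2) by auto
  have ind: "F.independent constants (map \<phi> vs)" and nspan: "\<phi> u \<notin> F.Span constants (map \<phi> vs)"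
    using F.independent_backwards[of constants "\<phi> u" "map \<phi> vs"] 1(3) by simp_all
  have dist: "distinct vs" using F.independent_distinct[OF C ind] by (simp add: distinct_map)
  \<comment> \<open>Omitting one member at a time, the induction hypothesis yields a family of
    operators dual to \<open>vs\<close> up to nonzero factors.\<close>
  have "\<exists>L\<in>operators. (\<forall>w\<in>set vs - {v}. \<phi> (L w) = \<zero>\<^bsub>F\<^esub>) \<and> \<phi> (L v) \<noteq> \<zero>\<^bsub>F\<^esub>" if v: "v \<in> set vs" for v
  proof -
    have s: "set vs = set (v # remove1 v vs)" using dist v by auto
    have len: "length (v # remove1 v vs) = length vs" "length (remove1 v vs) < length vs"
      using v length_pos_if_in_set[OF v] by (auto simp: length_remove1)
    have "F.independent constants (map \<phi> (v # remove1 v vs))"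
      using s len by (intro F.independent_same_set[OF C _ _ ind]) auto
    then have "\<exists>L\<in>operators. (\<forall>w\<in>set (remove1 v vs). \<phi> (L w) = \<zero>\<^bsub>F\<^esub>) \<and> \<phi> (L v) \<noteq> \<zero>\<^bsub>F\<^esub>"
      using 1(1)[rule_format, OF len(2), of v] vs s by auto
    then show ?thesis using dist by simp
  qed
  then obtain M where M: "\<And>v. v \<in> set vs \<Longrightarrow> M v \<in> operators"
    and M0: "\<And>v w. v \<in> set vs \<Longrightarrow> w \<in> set vs \<Longrightarrow> w \<noteq> v \<Longrightarrow> \<phi> (M v w) = \<zero>\<^bsub>F\<^esub>"
    and M1: "\<And>v. v \<in> set vs \<Longrightarrow> \<phi> (M v v) \<noteq> \<zero>\<^bsub>F\<^esub>"
    by (metis Diff_iff singletonD)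
  have Mc: "M v x \<in> carrier R" if "v \<in> set vs" "x \<in> carrier R" for v x
    using operators_closed M that by blast
  show ?case
  proof (rule ccontr)
    assume "\<not> ?thesis"
    then have no: "\<phi> (L u) = \<zero>\<^bsub>F\<^esub>" if "L \<in> operators" "\<And>v. v \<in> set vs \<Longrightarrow> \<phi> (L v) = \<zero>\<^bsub>F\<^esub>" for L
      using that by blast
    \<comment> \<open>If \<phi> \<open>u\<close> were a combination of the images of
      \<open>vs\<close> with constant coefficients, \<open>z v\<close> would be the coefficient at
      \<open>v\<close>. The proof shows that the assumption makes \<open>z v\<close> constant and
      that these coefficients do represent \<phi> \<open>u\<close>.\<close>
    define z where "z v = \<phi> (M v u) \<otimes>\<^bsub>F\<^esub> inv\<^bsub>F\<^esub> \<phi> (M v v)" for v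
    have zF: "z v \<in> carrier F" and zM: "z v \<otimes>\<^bsub>F\<^esub> \<phi> (M v v) = \<phi> (M v u)" if v: "v \<in> set vs" for v
    proof -
      have c: "\<phi> (M v v) \<in> Units F" "\<phi> (M v u) \<in> carrier F"
        using M1 Mc v vs u by (auto simp: F.field_Units)
      then show "z v \<in> carrier F" "z v \<otimes>\<^bsub>F\<^esub> \<phi> (M v v) = \<phi> (M v u)"
        by (simp_all add: z_def F.m_assoc F.Units_closed)
    qed
    have z: "z v \<in> constants" if v: "v \<in> set vs" for v
    proof -
      have "D \<delta> (z v) = \<zero>\<^bsub>F\<^esub>" if \<delta>: "\<delta> \<in> \<Delta>" for \<delta>
      proof -
        let ?s = "M v v"
        have s: "?s \<in> carrier R" "\<delta> ?s \<in> carrier R" using Mc v vs \<delta> DeltaD(2) by auto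
        \<comment> \<open>The numerator of the quotient rule for \<open>z v\<close>, read as an
          operator. It kills \<open>v\<close> since \<open>?s\<close> is the value of
          \<open>M v\<close> there, and the rest of \<open>vs\<close> since \<open>M v\<close> does;
          so it kills \<open>u\<close>.\<close>
        let ?L = "\<lambda>x. ?s \<otimes> \<delta> (M v x) \<oplus> (\<ominus> \<delta> ?s) \<otimes> M v x"
        have "?L \<in> operators"
          by (rule operators.lin[OF operators.deriv[OF M[OF v] \<delta>] M[OF v] s(1) a_inv_closed[OF s(2)]])
        moreover have "\<phi> (?L w) = \<zero>\<^bsub>F\<^esub>" if w: "w \<in> set vs" for w
        proof (cases "w = v")
          case True
          have "?L v = \<zero>" using s by (simp add: l_minus m_comm[of "\<delta> ?s" ?s] r_neg)
          then show ?thesis using True by simp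
        next
          case False
          have c: "M v w \<in> carrier R" "\<delta> (M v w) \<in> carrier R" using Mc v w vs \<delta> DeltaD(2) by auto
          have "\<phi> (\<delta> (M v w)) = D \<delta> \<zero>\<^bsub>F\<^esub>" using D_hom[OF \<delta> c(1)] M0[OF v w False] by simp
          then show ?thesis using s c M0[OF v w False] \<delta> by (simp add: F.derivation_zero D_derivation)
        qed
        ultimately have "\<phi> (?L u) = \<zero>\<^bsub>F\<^esub>" by (rule no)
        moreover have m: "M v u \<in> carrier R" "\<delta> (M v u) \<in> carrier R" using Mc v u \<delta> DeltaD(2) by auto
        ultimately have "\<phi> ?s \<otimes>\<^bsub>F\<^esub> \<phi> (\<delta> (M v u)) \<ominus>\<^bsub>F\<^esub> \<phi> (\<delta> ?s) \<otimes>\<^bsub>F\<^esub> \<phi> (M v u) = \<zero>\<^bsub>F\<^esub>"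
          using s by (simp add: F.minus_eq F.l_minus)
        then have "\<phi> ?s \<otimes>\<^bsub>F\<^esub> D \<delta> (\<phi> (M v u)) = D \<delta> (\<phi> ?s) \<otimes>\<^bsub>F\<^esub> \<phi> (M v u)"
          using s m \<delta> by (simp add: D_hom F.r_right_minus_eq)
        then show ?thesis unfolding z_def
          using s m M1[OF v] by (intro F.derivation_quotient_eq_zero D_derivation \<delta>) auto
      qed
      then show ?thesis using zF[OF v] by (simp add: constants_def)
    qed
    \<comment> \<open>Elimination starting from the identity: for each \<open>w\<close> a multiple
      of \<open>M w\<close> is subtracted so that \<open>w\<close> is killed. The factor
      \<open>s\<close> is the common denominator forced by coefficients in \<open>R\<close>, and
      \<open>y\<close> collects the terms \<open>z w\<close> times \<phi> \<open>w\<close>.\<close>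
    have "\<exists>L\<in>operators. \<exists>s\<in>carrier R. \<exists>y\<in>F.Span constants (map \<phi> ws). \<phi> s \<noteq> \<zero>\<^bsub>F\<^esub> \<and>
        (\<forall>w\<in>set ws. \<phi> (L w) = \<zero>\<^bsub>F\<^esub>) \<and> (\<forall>w\<in>set vs - set ws. \<phi> (L w) = \<phi> s \<otimes>\<^bsub>F\<^esub> \<phi> w) \<and>
        \<phi> (L u) = \<phi> s \<otimes>\<^bsub>F\<^esub> (\<phi> u \<ominus>\<^bsub>F\<^esub> y)"
      if "set ws \<subseteq> set vs" "distinct ws" for ws
      using that
    proof (induct ws)
      case Nil
      show ?case
        using u vs by (intro bexI[OF _ operators.id] bexI[of _ \<one>] bexI[of _ "\<zero>\<^bsub>F\<^esub>"])
          (auto simp: F.minus_eq)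
    next
      case (Cons w ws)
      have w: "w \<in> set vs" "w \<in> carrier R" "w \<notin> set ws" using Cons.prems vs by auto
      have wsF: "set (map \<phi> ws) \<subseteq> carrier F" using Cons.prems vs by auto
      obtain L s y where L: "L \<in> operators" and s: "s \<in> carrier R" "\<phi> s \<noteq> \<zero>\<^bsub>F\<^esub>"
        and y: "y \<in> F.Span constants (map \<phi> ws)"
        and L0: "\<And>v. v \<in> set ws \<Longrightarrow> \<phi> (L v) = \<zero>\<^bsub>F\<^esub>"
        and L1: "\<And>v. v \<in> set vs \<Longrightarrow> v \<notin> set ws \<Longrightarrow> \<phi> (L v) = \<phi> s \<otimes>\<^bsub>F\<^esub> \<phi> v"
        and Lu: "\<phi> (L u) = \<phi> s \<otimes>\<^bsub>F\<^esub> (\<phi> u \<ominus>\<^bsub>F\<^esub> y)"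
        using Cons by auto
      have yF: "y \<in> carrier F" using F.Span_in_carrier[OF subfieldE(3)[OF C] wsF] y by blast
      let ?t = "M w w"
      have t: "?t \<in> carrier R" "\<phi> ?t \<noteq> \<zero>\<^bsub>F\<^esub>" using Mc M1 w by auto
      let ?L = "\<lambda>x. ?t \<otimes> L x \<oplus> (\<ominus> (s \<otimes> w)) \<otimes> M w x"
      have \<phi>L: "\<phi> (?L x) = \<phi> ?t \<otimes>\<^bsub>F\<^esub> \<phi> (L x) \<ominus>\<^bsub>F\<^esub> \<phi> s \<otimes>\<^bsub>F\<^esub> \<phi> w \<otimes>\<^bsub>F\<^esub> \<phi> (M w x)"
        if "x \<in> carrier R" for x
        using that t s w operators_closed[OF L] Mc[OF w(1)] by (simp add: F.minus_eq F.l_minus)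
      have Lop: "?L \<in> operators"
        by (rule operators.lin[OF L M[OF w(1)] t(1) a_inv_closed[OF m_closed[OF s(1) w(2)]]])
      have st: "?t \<otimes> s \<in> carrier R" "\<phi> (?t \<otimes> s) \<noteq> \<zero>\<^bsub>F\<^esub>" using s t by (auto simp: F.integral_iff)
      let ?y = "z w \<otimes>\<^bsub>F\<^esub> \<phi> w \<oplus>\<^bsub>F\<^esub> y"
      have y': "?y \<in> F.Span constants (map \<phi> (w # ws))"
        using z[OF w(1)] y by (auto simp: F.line_extension_mem_iff)
      have 0: "\<phi> (?L v) = \<zero>\<^bsub>F\<^esub>" if v: "v \<in> set (w # ws)" for v
      proof (cases "v = w")
        case True
        then show ?thesis unfolding True \<phi>L[OF w(2)] L1[OF w(1,3)] using s t w
          by (simp add: F.minus_eq F.m_ac F.r_neg)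
      next
        case False
        then have v': "v \<in> set ws" "v \<in> set vs" "v \<in> carrier R" using v Cons.prems vs by auto
        show ?thesis unfolding \<phi>L[OF v'(3)] L0[OF v'(1)] M0[OF w(1) v'(2) False]
          using s t w by (simp add: F.minus_eq)
      qed
      have 1: "\<phi> (?L v) = \<phi> (?t \<otimes> s) \<otimes>\<^bsub>F\<^esub> \<phi> v" if v: "v \<in> set vs" "v \<notin> set (w # ws)" for v
      proof -
        have v': "v \<in> carrier R" "v \<noteq> w" "v \<notin> set ws" using v vs by auto
        show ?thesis unfolding \<phi>L[OF v'(1)] L1[OF v(1) v'(3)] M0[OF w(1) v(1) v'(2)]
          using s t w v' by (simp add: F.minus_eq F.m_assoc)
      qed
      have "\<phi> (?L u) = \<phi> (?t \<otimes> s) \<otimes>\<^bsub>F\<^esub> (\<phi> u \<ominus>\<^bsub>F\<^esub> ?y)"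
      proof -
        let ?T = "\<phi> ?t" and ?S = "\<phi> s" and ?W = "\<phi> w" and ?U = "\<phi> u" and ?Z = "z w"
        have c: "?T \<in> carrier F" "?S \<in> carrier F" "?W \<in> carrier F" "?U \<in> carrier F" "?Z \<in> carrier F"
          using t s w u zF by auto
        have "?T \<otimes>\<^bsub>F\<^esub> (?S \<otimes>\<^bsub>F\<^esub> (?U \<ominus>\<^bsub>F\<^esub> y)) \<ominus>\<^bsub>F\<^esub> ?S \<otimes>\<^bsub>F\<^esub> ?W \<otimes>\<^bsub>F\<^esub> (?Z \<otimes>\<^bsub>F\<^esub> ?T) =
            ?T \<otimes>\<^bsub>F\<^esub> ?S \<otimes>\<^bsub>F\<^esub> (?U \<ominus>\<^bsub>F\<^esub> (?Z \<otimes>\<^bsub>F\<^esub> ?W \<oplus>\<^bsub>F\<^esub> y))"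
          using c yF by (simp add: F.minus_eq F.r_distr F.l_distr F.r_minus F.l_minus F.minus_add F.m_ac F.a_ac)
        then show ?thesis unfolding \<phi>L[OF u] Lu zM[OF w(1), symmetric] using t s by simp
      qed
      then show ?case using 0 1 Lop st y'
        by (intro bexI[OF _ Lop] bexI[OF _ st(1)] bexI[OF _ y']) blast
    qed
    \<comment> \<open>After all of \<open>vs\<close> is eliminated the operator must kill
      \<open>u\<close> as well, so \<phi> \<open>u\<close> equals \<open>y\<close> and lies in the
      span, against independence.\<close>
    from this[OF subset_refl dist] obtain L s y where L: "L \<in> operators" "\<And>v. v \<in> set vs \<Longrightarrow> \<phi> (L v) = \<zero>\<^bsub>F\<^esub>"
      and s: "s \<in> carrier R" "\<phi> s \<noteq> \<zero>\<^bsub>F\<^esub>" and y: "y \<in> F.Span constants (map \<phi> vs)"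
      and Lu: "\<phi> (L u) = \<phi> s \<otimes>\<^bsub>F\<^esub> (\<phi> u \<ominus>\<^bsub>F\<^esub> y)" by blast
    have vsF: "set (map \<phi> vs) \<subseteq> carrier F" using vs by auto
    have yF: "y \<in> carrier F" using F.Span_in_carrier[OF subfieldE(3)[OF C] vsF] y by blast
    have "\<phi> s \<otimes>\<^bsub>F\<^esub> (\<phi> u \<ominus>\<^bsub>F\<^esub> y) = \<zero>\<^bsub>F\<^esub>" using no[OF L] Lu by simp
    then have "\<phi> u \<ominus>\<^bsub>F\<^esub> y = \<zero>\<^bsub>F\<^esub>" using s u yF by (simp add: F.integral_iff)
    then have "\<phi> u = y" using u yF by (simp add: F.r_right_minus_eq)
    then show False using nspan y by blast
  qed
qed

section \<open>A small separating set from rationality\<close>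

lemma Span_scalars_subset:
  assumes "set us \<subseteq> carrier F"
  shows "F.Span scalars us \<subseteq> F.Span constants us"
proof
  fix x assume "x \<in> F.Span scalars us"
  then obtain Ks where "set Ks \<subseteq> scalars" "length Ks = length us" "x = F.combine Ks us"
    using F.Span_mem_iff_length_version[OF subfield_scalars assms] by blast
  then show "x \<in> F.Span constants us"
    using F.Span_mem_iff_length_version[OF subfield_constants assms] scalars_subset_constants by blast
qed

lemma independent_subset_Span:
  assumes "set us \<subseteq> carrier R"
  shows "\<exists>vs. set vs \<subseteq> set us \<and> F.independent constants (map \<phi> vs) \<and>
    F.Span constants (map \<phi> us) \<subseteq> F.Span constants (map \<phi> vs)"
  using assms
proof (induct us)
  case Nil
  show ?case by (intro exI[of _ "[]"]) simp
next
  case (Cons u us)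
  note C = subfield_constants
  obtain vs where vs: "set vs \<subseteq> set us" "F.independent constants (map \<phi> vs)"
    "F.Span constants (map \<phi> us) \<subseteq> F.Span constants (map \<phi> vs)"
    using Cons by auto
  have c: "set (map \<phi> (u # us)) \<subseteq> carrier F" "set (map \<phi> vs) \<subseteq> carrier F" "set (map \<phi> us) \<subseteq> carrier F"
    using Cons.prems vs(1) by auto
  have us: "set (map \<phi> us) \<subseteq> F.Span constants (map \<phi> vs)"
    using F.Span_base_incl[OF C c(3)] vs(3) by blast
  show ?case
  proof (cases "\<phi> u \<in> F.Span constants (map \<phi> vs)")
    case True
    then have "set (map \<phi> (u # us)) \<subseteq> F.Span constants (map \<phi> vs)" using us by simp
    then have "F.Span constants (map \<phi> (u # us)) \<subseteq> F.Span constants (map \<phi> vs)"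
      by (rule F.mono_Span_subset[OF C _ c(2)])
    then show ?thesis using vs(1,2) by (intro exI[of _ vs]) auto
  next
    case False
    have uF: "\<phi> u \<in> carrier F" using c(1) by simp
    have ind: "F.independent constants (map \<phi> (u # vs))"
      using F.li_Cons[OF uF False vs(2)] by simp
    have "set (map \<phi> vs) \<subseteq> set (map \<phi> (u # vs))" by auto
    moreover have c': "set (map \<phi> (u # vs)) \<subseteq> carrier F" using c uF by simp
    moreover note F.Span_base_incl[OF C c']
    ultimately have "F.Span constants (map \<phi> vs) \<subseteq> F.Span constants (map \<phi> (u # vs))"
      by (intro F.mono_Span_subset[OF C]) blast+
    then have "set (map \<phi> (u # us)) \<subseteq> F.Span constants (map \<phi> (u # vs))"
      using us F.Span_base_incl[OF C c'] by auto
    then have "F.Span constants (map \<phi> (u # us)) \<subseteq> F.Span constants (map \<phi> (u # vs))"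
      by (rule F.mono_Span_subset[OF C _ c'])
    then show ?thesis using vs(1) ind by (intro exI[of _ "u # vs"]) auto
  qed
qed

text \<open>If \<open>\<phi> q = \<gamma> \<phi> s\<close> with \<open>\<gamma> \<noteq> 0\<close> algebraic, then \<open>\<gamma>\<^sup>-\<^sup>1\<close> is a polynomial in \<open>\<gamma>\<close>, so a power of
  \<open>s\<close> is a multiple of \<open>q\<close> up to the kernel of \<open>\<phi>\<close>.\<close>

lemma mem_prime_if_algebraic_multiple:
  assumes Q: "primeideal Q R" and ker: "\<And>x. x \<in> carrier R \<Longrightarrow> \<phi> x = \<zero>\<^bsub>F\<^esub> \<Longrightarrow> x \<in> Q"
    and \<gamma>: "\<gamma> \<in> carrier F" "\<gamma> \<noteq> \<zero>\<^bsub>F\<^esub>" "(ring.algebraic F over scalars) \<gamma>"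
    and s: "s \<in> carrier R" and q: "q \<in> Q" "\<phi> q = \<gamma> \<otimes>\<^bsub>F\<^esub> \<phi> s"
  shows "s \<in> Q"
proof -
  interpret Q: primeideal Q R by (rule Q)
  have qc: "q \<in> carrier R" using q(1) by (rule Q.Icarr)
  obtain i where i: "i \<in> F.simple_extension scalars \<gamma>" "i \<in> carrier F" "\<gamma> \<otimes>\<^bsub>F\<^esub> i = \<one>\<^bsub>F\<^esub>"
    using F.algebraic_inverse[OF subfield_scalars \<gamma>] by blast
  \<comment> \<open>Every further power of \<gamma> costs one factor \<phi> \<open>s\<close>, which
    converts it into \<phi> \<open>q\<close>.\<close>
  have "x \<in> carrier F \<and> (\<exists>m::nat. \<exists>r\<in>carrier R. \<phi> (s [^] m) \<otimes>\<^bsub>F\<^esub> x = \<phi> r)"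
    if "x \<in> F.simple_extension scalars \<gamma>" for x
    using that
  proof (induct rule: F.simple_extension.induct)
    case zero
    show ?case using s by (intro conjI exI[of _ 0] bexI[of _ \<zero>]) auto
  next
    case (lin x k)
    obtain m :: nat and r where r: "r \<in> carrier R" "\<phi> (s [^] m) \<otimes>\<^bsub>F\<^esub> x = \<phi> r" and x: "x \<in> carrier F"
      using lin(2) by blast
    obtain c where c: "c \<in> carrier R" "k = \<phi> c" using lin(3) scalar_closed unfolding scalars_def by blast
    let ?p = "\<phi> (s [^] m)"
    have p: "?p \<in> carrier F" "\<phi> s \<in> carrier F" using s by auto
    have "?p \<otimes>\<^bsub>F\<^esub> \<phi> s \<otimes>\<^bsub>F\<^esub> (x \<otimes>\<^bsub>F\<^esub> \<gamma> \<oplus>\<^bsub>F\<^esub> k) =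
        (?p \<otimes>\<^bsub>F\<^esub> x) \<otimes>\<^bsub>F\<^esub> (\<gamma> \<otimes>\<^bsub>F\<^esub> \<phi> s) \<oplus>\<^bsub>F\<^esub> ?p \<otimes>\<^bsub>F\<^esub> \<phi> s \<otimes>\<^bsub>F\<^esub> k"
      using p x \<gamma>(1) c by (simp add: F.r_distr F.m_ac)
    also have "\<dots> = \<phi> (r \<otimes> q \<oplus> s [^] Suc m \<otimes> c)"
      unfolding r(2) q(2)[symmetric] c(2) using r(1) qc c(1) s by simp
    finally have "\<phi> (s [^] Suc m) \<otimes>\<^bsub>F\<^esub> (x \<otimes>\<^bsub>F\<^esub> \<gamma> \<oplus>\<^bsub>F\<^esub> k) = \<phi> (r \<otimes> q \<oplus> s [^] Suc m \<otimes> c)"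
      using s by simp
    moreover have "r \<otimes> q \<oplus> s [^] Suc m \<otimes> c \<in> carrier R" using r(1) qc c(1) s by simp
    ultimately show ?case using x \<gamma>(1) c by blast
  qed
  then obtain m :: nat and r where r: "r \<in> carrier R" "\<phi> (s [^] m) \<otimes>\<^bsub>F\<^esub> i = \<phi> r" using i(1) by blast
  let ?p = "\<phi> (s [^] m)"
  have p: "?p \<in> carrier F" "\<phi> s \<in> carrier F" using s by auto
  \<comment> \<open>Applied to the inverse \<open>i\<close> of \<gamma>, one extra factor
    \<open>s\<close> lets \<gamma> cancel and exhibits a power of \<open>s\<close> as a multiple of
    \<open>q\<close>.\<close>
  have "\<phi> (r \<otimes> q) = (?p \<otimes>\<^bsub>F\<^esub> i) \<otimes>\<^bsub>F\<^esub> (\<gamma> \<otimes>\<^bsub>F\<^esub> \<phi> s)"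
    unfolding r(2) q(2)[symmetric] using r(1) qc by simp
  also have "\<dots> = (\<gamma> \<otimes>\<^bsub>F\<^esub> i) \<otimes>\<^bsub>F\<^esub> (?p \<otimes>\<^bsub>F\<^esub> \<phi> s)"
    using p i(2) \<gamma>(1) by (simp only: F.m_ac F.m_closed)
  also have "\<dots> = \<phi> (s [^] Suc m)" unfolding i(3) using s by simp
  finally have "\<phi> (s [^] Suc m \<ominus> r \<otimes> q) = \<zero>\<^bsub>F\<^esub>"
    using r(1) qc s by (simp add: minus_eq F.r_neg)
  then have "s [^] Suc m \<ominus> r \<otimes> q \<in> Q" using r(1) qc s by (intro ker) auto
  then have "(s [^] Suc m \<ominus> r \<otimes> q) \<oplus> r \<otimes> q \<in> Q"
    using Q.I_l_closed[OF q(1) r(1)] by (rule Q.a_closed)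
  also have "(s [^] Suc m \<ominus> r \<otimes> q) \<oplus> r \<otimes> q = s [^] Suc m"
    using r(1) qc s by (simp add: minus_eq a_assoc l_neg del: nat_pow_Suc)
  finally show ?thesis by (rule Q.pow_memD[OF s])
qed

text \<open>The set is chosen before any \<open>Q\<close> is given: one nonzero value of an
  isolating operator per pair of a finite subset and an element of a small generating set, hence
  fewer than |K| values. Given \<open>f\<close> in \<open>Q\<close> outside the kernel, the operator
  for a shortest expression of \<open>f\<close> maps \<open>f\<close> to \<gamma> times such a
  value; \<gamma> is algebraic by rationality and can be removed.\<close>

theorem separated_if_rational:
  assumes dim: "dim_less_card_field K R"
    and rational: "\<And>z. z \<in> constants \<Longrightarrow> (ring.algebraic F over scalars) z"
  obtains S where "S \<subseteq> carrier R" "S \<prec> carrier K" "\<And>s. s \<in> S \<Longrightarrow> \<phi> s \<noteq> \<zero>\<^bsub>F\<^esub>"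
    "\<And>Q. primeideal Q R \<Longrightarrow> delta_ideal R \<Delta> Q \<Longrightarrow>
       (\<And>x. x \<in> carrier R \<Longrightarrow> \<phi> x = \<zero>\<^bsub>F\<^esub> \<Longrightarrow> x \<in> Q) \<Longrightarrow> \<exists>x\<in>Q. \<phi> x \<noteq> \<zero>\<^bsub>F\<^esub> \<Longrightarrow> S \<inter> Q \<noteq> {}"
proof -
  note C = subfield_constants
  obtain B where B: "B \<subseteq> carrier R" "B \<prec> carrier K" "\<And>x. x \<in> carrier R \<Longrightarrow> x \<in> span B"
    using dim_less_card_field_imp_generators[OF dim] by blast
  define sep where "sep p s \<longleftrightarrow> (\<exists>L\<in>operators. s = L (snd p) \<and> \<phi> s \<noteq> \<zero>\<^bsub>F\<^esub> \<and>
    (\<forall>v\<in>fst p. \<phi> (L v) = \<zero>\<^bsub>F\<^esub>))" for p :: "'a set \<times> 'a" and s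
  define T where "T = {p \<in> Fpow B \<times> B. \<exists>s. sep p s}"
  define g where "g p = (SOME s. sep p s)" for p
  have g: "sep p (g p)" if "p \<in> T" for p
    unfolding g_def by (rule someI_ex) (use that in \<open>auto simp: T_def\<close>)
  show thesis
  proof (rule that[of "g ` T"])
    show "g ` T \<subseteq> carrier R"
    proof
      fix s assume "s \<in> g ` T"
      then obtain p where p: "p \<in> T" "s = g p" by blast
      then have "snd p \<in> carrier R" using B(1) by (auto simp: T_def)
      then show "s \<in> carrier R" using g[OF p(1)] operators_closed unfolding sep_def p(2) by metis
    qed
    have "T \<lesssim> Fpow B \<times> B" by (rule subset_imp_lepoll) (auto simp: T_def)
    then have "g ` T \<lesssim> Fpow B \<times> B" by (rule lepoll_trans[OF image_lepoll])
    then show "g ` T \<prec> carrier K"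
      by (rule lesspoll_trans1) (intro lesspoll_Times lesspoll_Fpow infinite_K B(2))
    show "\<phi> s \<noteq> \<zero>\<^bsub>F\<^esub>" if "s \<in> g ` T" for s using that g by (auto simp: sep_def)
    fix Q assume Q: "primeideal Q R" "delta_ideal R \<Delta> Q"
      and ker: "\<And>x. x \<in> carrier R \<Longrightarrow> \<phi> x = \<zero>\<^bsub>F\<^esub> \<Longrightarrow> x \<in> Q" and ex: "\<exists>x\<in>Q. \<phi> x \<noteq> \<zero>\<^bsub>F\<^esub>"
    interpret Q: primeideal Q R by (rule Q(1))
    obtain f where f: "f \<in> Q" "\<phi> f \<noteq> \<zero>\<^bsub>F\<^esub>" using ex by blast
    have fc: "f \<in> carrier R" using f(1) by (rule Q.Icarr)
    let ?P = "\<lambda>vs. set vs \<subseteq> B \<and> F.independent constants (map \<phi> vs) \<and> \<phi> f \<in> F.Span constants (map \<phi> vs)"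
    \<comment> \<open>Generators independent over \<open>K\<close> can become dependent over the
      constants, so the expression of \<open>f\<close> is rewritten in an independent
      sublist.\<close>
    have "\<exists>vs. ?P vs"
    proof -
      obtain us where us: "set us \<subseteq> B" "\<phi> f \<in> F.Span scalars (map \<phi> us)"
        using hom_span_subset_Span[OF ring_hom_ring F.one_not_zero B(1) B(3)[OF fc]]
        unfolding scalars_def by blast
      have usc: "set us \<subseteq> carrier R" using us(1) B(1) by blast
      then have "set (map \<phi> us) \<subseteq> carrier F" by auto
      then have "\<phi> f \<in> F.Span constants (map \<phi> us)" using us(2) Span_scalars_subset by blast
      then show ?thesis using independent_subset_Span[OF usc] us(1) by blast
    qed
    then obtain vs where vs: "?P vs" and min: "\<And>ws. ?P ws \<Longrightarrow> length vs \<le> length ws"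
      using ex_has_least_nat[of ?P _ length] by blast
    have "vs \<noteq> []" using vs f(2) by auto
    then obtain u ws where uws: "vs = u # ws" by (cases vs) auto
    have c: "u \<in> carrier R" "set ws \<subseteq> carrier R" "u \<in> B" "set ws \<subseteq> B" using vs B(1) uws by auto
    have wsF: "set (map \<phi> ws) \<subseteq> carrier F" using c by auto
    obtain \<gamma> y where \<gamma>: "\<gamma> \<in> constants" and y: "y \<in> F.Span constants (map \<phi> ws)"
      and fy: "\<phi> f = \<gamma> \<otimes>\<^bsub>F\<^esub> \<phi> u \<oplus>\<^bsub>F\<^esub> y"
      using vs by (auto simp: uws F.line_extension_mem_iff)
    have yF: "y \<in> carrier F" using F.Span_in_carrier[OF subfieldE(3)[OF C] wsF] y by blast
    have \<gamma>F: "\<gamma> \<in> carrier F" using \<gamma> by (simp add: constants_def)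
    have "F.independent constants (map \<phi> ws)"
      using F.independent_backwards[of constants "\<phi> u" "map \<phi> ws"] vs by (simp add: uws)
    \<comment> \<open>Were the leading coefficient zero, the tail would be a shorter admissible
      list.\<close>
    then have \<gamma>0: "\<gamma> \<noteq> \<zero>\<^bsub>F\<^esub>"
      using min[of ws] c y yF fy by (auto simp: uws)
    obtain Ks where Ks: "set Ks \<subseteq> constants" "y = F.combine Ks (map \<phi> ws)"
      using F.Span_mem_iff_length_version[OF C wsF] y by blast
    have fK: "\<phi> f = F.combine (\<gamma> # Ks) (map \<phi> (u # ws))" using fy Ks by simp
    have usc: "set (u # ws) \<subseteq> carrier R" using c by simp
    have ind: "F.independent constants (map \<phi> (u # ws))" using vs unfolding uws by blast
    have p: "(set ws, u) \<in> T"
      using operators_separate[OF usc ind] c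
      by (auto simp: T_def sep_def Fpow_def)
    then obtain L where L: "L \<in> operators" "g (set ws, u) = L u"
      and L0: "\<And>v. v \<in> set ws \<Longrightarrow> \<phi> (L v) = \<zero>\<^bsub>F\<^esub>"
      using g[OF p] by (auto simp: sep_def)
    have "\<phi> (L f) = \<gamma> \<otimes>\<^bsub>F\<^esub> \<phi> (L u) \<oplus>\<^bsub>F\<^esub> F.combine Ks (map (\<lambda>u. \<phi> (L u)) ws)"
      using operators_combine[OF L(1) _ usc fc fK] \<gamma> Ks(1) by simp
    also have "F.combine Ks (map (\<lambda>u. \<phi> (L u)) ws) = \<zero>\<^bsub>F\<^esub>"
      using Ks(1) L0 by (intro F.combine_zeros) (auto simp: constants_def)
    also have "\<gamma> \<otimes>\<^bsub>F\<^esub> \<phi> (L u) \<oplus>\<^bsub>F\<^esub> \<zero>\<^bsub>F\<^esub> = \<gamma> \<otimes>\<^bsub>F\<^esub> \<phi> (L u)"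
      using \<gamma>F operators_closed[OF L(1) c(1)] by simp
    finally have e: "\<phi> (L f) = \<gamma> \<otimes>\<^bsub>F\<^esub> \<phi> (L u)" .
    have "L u \<in> Q"
      by (rule mem_prime_if_algebraic_multiple[OF Q(1) ker \<gamma>F \<gamma>0 rational[OF \<gamma>]
            operators_closed[OF L(1) c(1)] operators_delta_ideal[OF L(1) Q(2) f(1)] e])
    then show "g ` T \<inter> Q \<noteq> {}" using p L(2) by (metis IntI empty_iff imageI)
  qed
qed

end


section \<open>The Dixmier-Moeglin equivalence is topological\<close>

context char_zero_differential_algebra
begin

lemma fraction_field_of_quotient:
  assumes P: "delta_ideal R \<Delta> P" "primeideal P R"
  defines "\<phi> \<equiv> \<lambda>x. fraction (R Quot P) (P +> x) \<one>\<^bsub>R Quot P\<^esub>"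
    and "D \<equiv> \<lambda>\<delta>. frac_derivation (R Quot P) (quotient_derivation R P \<delta>)"
  shows "differential_fraction_field R K \<Delta> (Frac (R Quot P)) \<phi> D"
    and "x \<in> carrier R \<Longrightarrow> \<phi> x = \<zero>\<^bsub>Frac (R Quot P)\<^esub> \<longleftrightarrow> x \<in> P"
proof -
  interpret P: primeideal P R by (rule P(2))
  interpret A: "domain" "R Quot P" by (rule P.quotient_is_domain)
  interpret F: field "Frac (R Quot P)" by (rule A.Frac_field)
  interpret \<pi>: ring_hom_ring R "R Quot P" "(+>) P" by (rule P.rcos_ring_hom_ring)
  have \<phi>0: "\<phi> x = \<zero>\<^bsub>Frac (R Quot P)\<^esub> \<longleftrightarrow> x \<in> P" if x: "x \<in> carrier R" for x
  proof -
    have "\<phi> x = \<zero>\<^bsub>Frac (R Quot P)\<^esub> \<longleftrightarrow> P +> x = \<zero>\<^bsub>R Quot P\<^esub>"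
      unfolding \<phi>_def A.Frac_zero using x by (subst A.fraction_eq_iff) simp_all
    then show ?thesis using coset_eq_zero_iff[OF P.ideal_axioms x] by simp
  qed
  then show "x \<in> carrier R \<Longrightarrow> \<phi> x = \<zero>\<^bsub>Frac (R Quot P)\<^esub> \<longleftrightarrow> x \<in> P" .
  have D: "D \<delta> \<in> derivations (Frac (R Quot P))"
    "a \<in> carrier (R Quot P) \<Longrightarrow> D \<delta> (fraction (R Quot P) a \<one>\<^bsub>R Quot P\<^esub>) =
      fraction (R Quot P) (quotient_derivation R P \<delta> a) \<one>\<^bsub>R Quot P\<^esub>"
    if \<delta>: "\<delta> \<in> \<Delta>" for \<delta> a
    using theI'[OF A.frac_derivation_ex1[OF
          quotient_derivation(1)[OF cring_axioms P(1) \<delta> DeltaD(1)[OF \<delta>]]]]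
    unfolding D_def frac_derivation_def by blast+
  show "differential_fraction_field R K \<Delta> (Frac (R Quot P)) \<phi> D"
  proof (intro differential_fraction_field.intro differential_fraction_field_axioms.intro)
    show "char_zero_differential_algebra R K \<Delta>" by (rule char_zero_differential_algebra_axioms)
    show "field (Frac (R Quot P))" by (rule F.field_axioms)
    show "\<phi> \<in> ring_hom R (Frac (R Quot P))"
    proof (rule ring_hom_memI)
      show "\<phi> x \<in> carrier (Frac (R Quot P))" if "x \<in> carrier R" for x
        unfolding \<phi>_def using that by (intro A.fraction_carrier) simp_all
      show "\<phi> \<one> = \<one>\<^bsub>Frac (R Quot P)\<^esub>" unfolding \<phi>_def A.Frac_one by simp
      fix x y assume c: "x \<in> carrier R" "y \<in> carrier R"
      show "\<phi> (x \<otimes> y) = \<phi> x \<otimes>\<^bsub>Frac (R Quot P)\<^esub> \<phi> y"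
        unfolding \<phi>_def using c by (subst A.Frac_mult) simp_all
      show "\<phi> (x \<oplus> y) = \<phi> x \<oplus>\<^bsub>Frac (R Quot P)\<^esub> \<phi> y"
        unfolding \<phi>_def using c by (subst A.Frac_add) simp_all
    qed
    show "D \<delta> \<in> derivations (Frac (R Quot P))" if "\<delta> \<in> \<Delta>" for \<delta> using that by (rule D(1))
    show "D \<delta> (\<phi> x) = \<phi> (\<delta> x)" if \<delta>: "\<delta> \<in> \<Delta>" and x: "x \<in> carrier R" for \<delta> x
      unfolding \<phi>_def using D(2)[OF \<delta>, of "P +> x"]
        quotient_derivation(2)[OF cring_axioms P(1) \<delta> DeltaD(1)[OF \<delta>] x] x by simp
    fix z assume "z \<in> carrier (Frac (R Quot P))"
    then obtain a b where ab: "a \<in> carrier (R Quot P)" "b \<in> carrier (R Quot P)" "b \<noteq> \<zero>\<^bsub>R Quot P\<^esub>"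
      and z: "z = fraction (R Quot P) a b"
      by (rule A.Frac_cases)
    obtain x y where xy: "x \<in> carrier R" "a = P +> x" "y \<in> carrier R" "b = P +> y"
      using ab(1,2) unfolding FactRing_simps by auto
    have "\<phi> y \<otimes>\<^bsub>Frac (R Quot P)\<^esub> z = \<phi> x"
      unfolding \<phi>_def z xy(2,4)[symmetric] using ab by (simp add: A.Frac_mult A.fraction_eq_iff A.m_comm)
    moreover have "\<phi> y \<noteq> \<zero>\<^bsub>Frac (R Quot P)\<^esub>"
      using \<phi>0[OF xy(3)] ab(3) xy coset_eq_zero_iff[OF P.ideal_axioms xy(3)] by simp
    ultimately show "\<exists>a\<in>carrier R. \<exists>b\<in>carrier R.
        \<phi> b \<noteq> \<zero>\<^bsub>Frac (R Quot P)\<^esub> \<and> \<phi> b \<otimes>\<^bsub>Frac (R Quot P)\<^esub> z = \<phi> a"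
      using xy by blast
  qed
qed

end

section \<open>Separating elements and the topology of the differential spectrum\<close>

locale noetherian_small_differential_algebra = char_zero_differential_algebra +
  assumes noetherian: "noetherian_ring R" and dim: "dim_less_card_field K R"
begin

abbreviation spec where "spec \<equiv> delta_spec_topology R \<Delta>"

lemma openin_delta_spec_iff:
  "openin spec U \<longleftrightarrow> (\<exists>S\<subseteq>carrier R. U = {P \<in> delta_spec R \<Delta>. \<not> S \<subseteq> P})"
proof -
  have "{P. primeideal P R \<and> \<not> S \<subseteq> P} \<inter> delta_spec R \<Delta> = {P \<in> delta_spec R \<Delta>. \<not> S \<subseteq> P}" for S
    using delta_spec_prime[OF noetherian] by blast
  moreover have "openin spec U \<longleftrightarrow>
      (\<exists>S\<subseteq>carrier R. U = {P. primeideal P R \<and> \<not> S \<subseteq> P} \<inter> delta_spec R \<Delta>)"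
    unfolding delta_spec_topology_def openin_subtopology openin_zariski by blast
  ultimately show ?thesis by simp
qed

lemma topspace_delta_spec: "topspace spec = delta_spec R \<Delta>"
  unfolding delta_spec_topology_def topspace_subtopology topspace_zariski
  using delta_spec_prime[OF noetherian] by blast

lemma closedin_delta_spec_upper:
  assumes "P \<subseteq> carrier R"
  shows "closedin spec {Q \<in> delta_spec R \<Delta>. P \<subseteq> Q}"
proof -
  have "delta_spec R \<Delta> - {Q \<in> delta_spec R \<Delta>. P \<subseteq> Q} = {Q \<in> delta_spec R \<Delta>. \<not> P \<subseteq> Q}" by blast
  then show ?thesis using assms unfolding closedin_def topspace_delta_spec openin_delta_spec_iff by auto
qed

lemma closedin_delta_spec_mono:
  assumes "closedin spec C" "P \<in> C" "Q \<in> delta_spec R \<Delta>" "P \<subseteq> Q"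
  shows "Q \<in> C"
proof -
  obtain S where S: "delta_spec R \<Delta> - C = {P \<in> delta_spec R \<Delta>. \<not> S \<subseteq> P}"
    using assms(1) unfolding closedin_def topspace_delta_spec openin_delta_spec_iff by blast
  then have "S \<subseteq> P"
    using assms(2) closedin_subset[OF assms(1)] unfolding topspace_delta_spec by blast
  then show ?thesis using S assms(3,4) by blast
qed

text \<open>An open set around \<open>P\<close> contains a basic one, given by one element outside
  \<open>P\<close>, and a closed set through \<open>P\<close> contains all differential primes above
  \<open>P\<close>. So it suffices to cut the closure of \<open>P\<close> by basic open
  sets.\<close>

lemma small_cut_iff_separated:
  assumes P: "P \<in> delta_spec R \<Delta>"
  shows "small_cut spec \<kappa> P \<longleftrightarrow> (\<exists>S\<subseteq>carrier R - P. S \<prec> \<kappa> \<and>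
    (\<forall>Q\<in>delta_spec R \<Delta>. P \<subseteq> Q \<longrightarrow> Q \<noteq> P \<longrightarrow> S \<inter> Q \<noteq> {}))"
proof
  assume "small_cut spec \<kappa> P"
  then obtain \<U> C where U: "\<forall>U\<in>\<U>. openin spec U" "\<U> \<prec> \<kappa>"
    and C: "closedin spec C" "C \<inter> \<Inter>\<U> = {P}"
    unfolding small_cut_def by blast
  have "\<exists>s\<in>carrier R - P. \<forall>Q\<in>delta_spec R \<Delta>. s \<notin> Q \<longrightarrow> Q \<in> U" if "U \<in> \<U>" for U
  proof -
    have "openin spec U" using U(1) that by (rule bspec)
    then obtain S where S: "S \<subseteq> carrier R" "U = {P \<in> delta_spec R \<Delta>. \<not> S \<subseteq> P}"
      unfolding openin_delta_spec_iff by (elim exE conjE)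
    have "P \<in> U" using C(2) that by blast
    then obtain s where s: "s \<in> S" "s \<notin> P" unfolding S(2) by blast
    then have "Q \<in> U" if "Q \<in> delta_spec R \<Delta>" "s \<notin> Q" for Q
      using that unfolding S(2) by blast
    then show ?thesis using s S(1) by (intro bexI[of _ s]) auto
  qed
  then obtain s where s: "\<And>U. U \<in> \<U> \<Longrightarrow> s U \<in> carrier R - P"
    and sU: "\<And>U Q. U \<in> \<U> \<Longrightarrow> Q \<in> delta_spec R \<Delta> \<Longrightarrow> s U \<notin> Q \<Longrightarrow> Q \<in> U"
    by metis
  have "s ` \<U> \<inter> Q \<noteq> {}" if Q: "Q \<in> delta_spec R \<Delta>" "P \<subseteq> Q" "Q \<noteq> P" for Q
  proof
    assume "s ` \<U> \<inter> Q = {}"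
    then have "Q \<in> \<Inter>\<U>" using sU[OF _ Q(1)] by blast
    moreover have "Q \<in> C" using closedin_delta_spec_mono[OF C(1) _ Q(1,2)] C(2) by blast
    ultimately show False using C(2) Q(3) by blast
  qed
  moreover have "s ` \<U> \<prec> \<kappa>" by (rule lesspoll_trans1[OF image_lepoll U(2)])
  moreover have "s ` \<U> \<subseteq> carrier R - P" using s by blast
  ultimately show "\<exists>S\<subseteq>carrier R - P. S \<prec> \<kappa> \<and>
      (\<forall>Q\<in>delta_spec R \<Delta>. P \<subseteq> Q \<longrightarrow> Q \<noteq> P \<longrightarrow> S \<inter> Q \<noteq> {})" by blast
next
  assume "\<exists>S\<subseteq>carrier R - P. S \<prec> \<kappa> \<and>
      (\<forall>Q\<in>delta_spec R \<Delta>. P \<subseteq> Q \<longrightarrow> Q \<noteq> P \<longrightarrow> S \<inter> Q \<noteq> {})"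
  then obtain S where S: "S \<subseteq> carrier R - P" "S \<prec> \<kappa>"
    and sep: "\<And>Q. Q \<in> delta_spec R \<Delta> \<Longrightarrow> P \<subseteq> Q \<Longrightarrow> Q \<noteq> P \<Longrightarrow> S \<inter> Q \<noteq> {}" by blast
  define U where "U s = {Q \<in> delta_spec R \<Delta>. \<not> {s} \<subseteq> Q}" for s
  show "small_cut spec \<kappa> P" unfolding small_cut_def
  proof (intro exI conjI)
    have "openin spec (U s)" if "s \<in> S" for s
      unfolding openin_delta_spec_iff U_def using that S(1) by (intro exI[of _ "{s}"] conjI refl) auto
    then show "\<forall>V\<in>U ` S. openin spec V" by simp
    show "U ` S \<prec> \<kappa>" by (rule lesspoll_trans1[OF image_lepoll S(2)])
    have Pc: "P \<subseteq> carrier R"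
      by (intro additive_subgroup.a_subset ideal.axioms(1) primeideal.axioms(1)
          delta_spec_prime[OF noetherian P])
    show "closedin spec {Q \<in> delta_spec R \<Delta>. P \<subseteq> Q}" by (rule closedin_delta_spec_upper[OF Pc])
    show "{Q \<in> delta_spec R \<Delta>. P \<subseteq> Q} \<inter> \<Inter>(U ` S) = {P}"
    proof
      show "{Q \<in> delta_spec R \<Delta>. P \<subseteq> Q} \<inter> \<Inter>(U ` S) \<subseteq> {P}"
      proof
        fix Q assume Q: "Q \<in> {Q \<in> delta_spec R \<Delta>. P \<subseteq> Q} \<inter> \<Inter>(U ` S)"
        then have "S \<inter> Q = {}" unfolding U_def by blast
        then show "Q \<in> {P}" using sep[of Q] Q by blast
      qed
      show "{P} \<subseteq> {Q \<in> delta_spec R \<Delta>. P \<subseteq> Q} \<inter> \<Inter>(U ` S)" using P S(1) unfolding U_def by blast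
    qed
  qed
qed

text \<open>The implications from a small cut to primitive, from primitive to rational and from
  rational back to a small cut close a cycle.\<close>

theorem primitive_iff_small_cut:
  assumes P: "P \<in> delta_spec R \<Delta>"
  shows "delta_primitive R \<Delta> P \<longleftrightarrow> small_cut spec (carrier K) P"
    and "delta_rational K R \<Delta> P \<longleftrightarrow> small_cut spec (carrier K) P"
proof -
  have prime: "primeideal P R" by (rule delta_spec_prime[OF noetherian P])
  have Pd: "delta_ideal R \<Delta> P" using P by (simp add: delta_spec_def delta_prime_def)
  define \<phi> where "\<phi> x = fraction (R Quot P) (P +> x) \<one>\<^bsub>R Quot P\<^esub>" for x
  define D where "D \<delta> = frac_derivation (R Quot P) (quotient_derivation R P \<delta>)" for \<delta>
  interpret Q: differential_fraction_field R K \<Delta> "Frac (R Quot P)" \<phi> D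
    using fraction_field_of_quotient(1)[OF Pd prime] unfolding \<phi>_def D_def .
  have ker: "\<phi> x = \<zero>\<^bsub>Frac (R Quot P)\<^esub> \<longleftrightarrow> x \<in> P" if "x \<in> carrier R" for x
    using fraction_field_of_quotient(2)[OF Pd prime that] unfolding \<phi>_def .
  have rational: "delta_rational K R \<Delta> P \<longleftrightarrow>
      (\<forall>z\<in>Q.constants. (ring.algebraic (Frac (R Quot P)) over Q.scalars) z)"
  proof -
    have "frac_constants R \<Delta> P = Q.constants"
      unfolding frac_constants_def Q.constants_def D_def ..
    moreover have "frac_scalars K R P = Q.scalars"
      unfolding frac_scalars_def Q.scalars_def \<phi>_def scalar_def ..
    ultimately show ?thesis unfolding delta_rational_def by simp
  qed
  have 1: "delta_primitive R \<Delta> P" if cut: "small_cut spec (carrier K) P"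
  proof -
    obtain S where "S \<subseteq> carrier R - P" "S \<prec> carrier K"
      "\<forall>Q\<in>delta_spec R \<Delta>. P \<subseteq> Q \<longrightarrow> Q \<noteq> P \<longrightarrow> S \<inter> Q \<noteq> {}"
      using cut unfolding small_cut_iff_separated[OF P] by (elim exE conjE)
    then show ?thesis by (intro delta_primitive_if_separated[OF dim Pd prime, of S]) simp_all
  qed
  have 2: "delta_rational K R \<Delta> P" if prim: "delta_primitive R \<Delta> P"
  proof -
    obtain M where M: "maximalideal M R" "P = delta_core R \<Delta> M"
      using prim by (auto simp: delta_primitive_def)
    show ?thesis unfolding rational
      by (intro ballI Q.rational_if_primitive[OF dim M(1)]) (use ker M(2) in auto)
  qed
  have 3: "small_cut spec (carrier K) P" if rat: "delta_rational K R \<Delta> P"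
  proof -
    obtain S where S: "S \<subseteq> carrier R" "S \<prec> carrier K" "\<And>s. s \<in> S \<Longrightarrow> \<phi> s \<noteq> \<zero>\<^bsub>Frac (R Quot P)\<^esub>"
      and sep: "\<And>Q. primeideal Q R \<Longrightarrow> delta_ideal R \<Delta> Q \<Longrightarrow>
       (\<And>x. x \<in> carrier R \<Longrightarrow> \<phi> x = \<zero>\<^bsub>Frac (R Quot P)\<^esub> \<Longrightarrow> x \<in> Q) \<Longrightarrow>
       \<exists>x\<in>Q. \<phi> x \<noteq> \<zero>\<^bsub>Frac (R Quot P)\<^esub> \<Longrightarrow> S \<inter> Q \<noteq> {}"
      by (rule Q.separated_if_rational[OF dim]) (use rat rational in blast)+
    have "S \<inter> Q \<noteq> {}" if Q: "Q \<in> delta_spec R \<Delta>" "P \<subseteq> Q" "Q \<noteq> P" for Q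
    proof (rule sep)
      show prime: "primeideal Q R" by (rule delta_spec_prime[OF noetherian Q(1)])
      show "delta_ideal R \<Delta> Q" using Q(1) by (simp add: delta_spec_def delta_prime_def)
      show "x \<in> Q" if "x \<in> carrier R" "\<phi> x = \<zero>\<^bsub>Frac (R Quot P)\<^esub>" for x
        using that ker Q(2) by blast
      obtain x where "x \<in> Q" "x \<notin> P" using Q by blast
      moreover have "x \<in> carrier R"
        by (rule ideal.Icarr[OF primeideal.axioms(1)[OF prime] \<open>x \<in> Q\<close>])
      ultimately show "\<exists>x\<in>Q. \<phi> x \<noteq> \<zero>\<^bsub>Frac (R Quot P)\<^esub>" using ker by blast
    qed
    moreover have "S \<subseteq> carrier R - P" using S ker by blast
    ultimately show ?thesis unfolding small_cut_iff_separated[OF P] using S(2) by blast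
  qed
  show "delta_primitive R \<Delta> P \<longleftrightarrow> small_cut spec (carrier K) P"
    and "delta_rational K R \<Delta> P \<longleftrightarrow> small_cut spec (carrier K) P"
    using 1 2 3 by blast+
qed

text \<open>Primitive and rational always agree, and local closedness gives a small cut because
  \<open>carrier K\<close> is infinite; one implication remains.\<close>

theorem dixmier_moeglin_iff:
  "delta_dixmier_moeglin K R \<Delta> \<longleftrightarrow>
    (\<forall>P\<in>topspace spec. small_cut spec (carrier K) P \<longrightarrow> locally_closed_in spec {P})"
proof -
  have lc: "small_cut spec (carrier K) P" if "locally_closed_in spec {P}" for P
    using that unfolding locally_closed_in_iff_small_cut
    by (rule small_cut_mono[OF infinite_le_lepoll[THEN iffD1, OF infinite_K]])
  show ?thesis unfolding delta_dixmier_moeglin_def topspace_delta_spec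
  proof (intro ball_cong refl)
    fix P assume "P \<in> delta_spec R \<Delta>"
    note primitive_iff_small_cut[OF this]
    then show "((locally_closed_in spec {P} \<longleftrightarrow> delta_primitive R \<Delta> P) \<and>
        (delta_primitive R \<Delta> P \<longleftrightarrow> delta_rational K R \<Delta> P)) \<longleftrightarrow>
        (small_cut spec (carrier K) P \<longrightarrow> locally_closed_in spec {P})"
      using lc[of P] by blast
  qed
qed

end

lemma noetherian_small_differential_algebraI:
  assumes "char_zero_field K" "differential_algebra K R \<Delta>" "noetherian_ring R"
    "dim_less_card_field K R"
  shows "noetherian_small_differential_algebra R K \<Delta>"
proof -
  have "cring R" using assms(2) by (simp add: differential_algebra_def algebra_def)
  then show ?thesis using assms
    by (simp add: noetherian_small_differential_algebra_def char_zero_differential_algebra_def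
        noetherian_small_differential_algebra_axioms_def char_zero_differential_algebra_axioms_def)
qed

text \<open>All pieces are algebras over the same field, so the same cardinal |K| measures the cuts
  in \<open>R\<close> and in every \<open>R' i\<close>, and homeomorphisms carry them
  across.\<close>

theorem theorem5p1:
  fixes K :: "('k, 'm) ring_scheme"
    and R :: "('k, 'a, 'n) module_scheme"
    and \<Delta> :: "('a \<Rightarrow> 'a) set"
    and I :: "'i set"
    and Y :: "'i \<Rightarrow> 'a set set"
    and R' :: "'i \<Rightarrow> ('k, 'b, 'p) module_scheme"
    and \<Delta>' :: "'i \<Rightarrow> ('b \<Rightarrow> 'b) set"
  assumes "char_zero_field K"
    and "differential_algebra K R \<Delta>" and "noetherian_ring R"
    and "dim_less_card_field K R" and "\<Delta> \<prec> carrier K"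
    and "\<And>i. i \<in> I \<Longrightarrow> differential_algebra K (R' i) (\<Delta>' i)"
    and "\<And>i. i \<in> I \<Longrightarrow> noetherian_ring (R' i)"
    and "\<And>i. i \<in> I \<Longrightarrow> dim_less_card_field K (R' i)"
    and "\<And>i. i \<in> I \<Longrightarrow> \<Delta>' i \<prec> carrier K"
    and "delta_spec R \<Delta> = (\<Union>i\<in>I. Y i)"
    and "\<And>i. i \<in> I \<Longrightarrow> locally_closed_in (delta_spec_topology R \<Delta>) (Y i)"
    and "\<And>i. i \<in> I \<Longrightarrow> subtopology (delta_spec_topology R \<Delta>) (Y i)
           homeomorphic_space delta_spec_topology (R' i) (\<Delta>' i)"
  shows "delta_dixmier_moeglin K R \<Delta> \<longleftrightarrow> (\<forall>i\<in>I. delta_dixmier_moeglin K (R' i) (\<Delta>' i))"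
proof -
  interpret R: noetherian_small_differential_algebra R K \<Delta>
    by (rule noetherian_small_differential_algebraI) (fact assms)+
  have R': "noetherian_small_differential_algebra (R' i) K (\<Delta>' i)" if "i \<in> I" for i
    using that assms(1,6-8) by (intro noetherian_small_differential_algebraI)
  have "delta_dixmier_moeglin K R \<Delta> \<longleftrightarrow> (\<forall>i\<in>I. \<forall>Q\<in>topspace (delta_spec_topology (R' i) (\<Delta>' i)).
      small_cut (delta_spec_topology (R' i) (\<Delta>' i)) (carrier K) Q \<longrightarrow>
      locally_closed_in (delta_spec_topology (R' i) (\<Delta>' i)) {Q})"
    unfolding R.dixmier_moeglin_iff
    using R.infinite_K assms(10-12) R.topspace_delta_spec
    by (intro small_cut_imp_locally_closed_local) simp_all
  then show ?thesis using noetherian_small_differential_algebra.dixmier_moeglin_iff[OF R'] by simp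
qed

end
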